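(* For every integer $N\geq 1$, the inclusion $S_N\leq S_N^+$ is maximal at easiness level three. That is: for every $k\geq 1$, all partitions $p_1,p_2,p_3\in\mathcal{P}(k)$ and all $\alpha_1,\alpha_2,\alpha_3\in\mathbb{C}$ such that $\xi=\alpha_1\xi_{p_1}+\alpha_2\xi_{p_2}+\alpha_3\xi_{p_3}\in(\mathbb{C}^N)^{\otimes k}$ is non-zero, the Tannaka--Krein dual $\langle\mathcal{NC},\xi\rangle$ is equal to $\mathcal{P}$ or to $\mathcal{NC}$.
   Context: Fix $N$ and write $[k]=\{1,\dots,k\}$. $\mathcal{P}(k)$ is the set of set partitions of $[k]$; $x\sim_p y$ means $x,y$ lie in the same block of $p$. For $p\in\mathcal{P}(k)$, $\xi_p\in(\mathbb{C}^N)^{\otimes k}$ is $\xi_p=\sum e_{i_1}\otimes\cdots\otimes e_{i_k}$, the sum over all $(i_1,\dots,i_k)\in[N]^k$ with $i_x=i_y$ whenever $x\sim_p y$. More generally $\mathcal{P}(k,\ell)$ is the set of partitions of a set of $k$ upper and $\ell$ lower points; for $p\in\mathcal{P}(k,\ell)$ the matrix $T_p\in M_{N^\ell\times N^k}(\mathbb{C})$ has $((i_1,\dots,i_\ell),(j_1,\dots,j_k))$-entry $1$ if, writing $j_1,\dots,j_k$ on the upper points and $i_1,\dots,i_\ell$ on the lower points (left to right), points in the same block carry equal indices, and $0$ otherwise. So $\xi_p=T_p$ for $p\in\mathcal{P}(0,k)=\mathcal{P}(k)$. A partition is crossing if, for points ordered as upper points left-to-right followed by lower points right-to-left, there are $\kappa_1<\kappa_2<\kappa_3<\kappa_4$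 with $\kappa_1\sim_p\kappa_3$, $\kappa_2\sim_p\kappa_4$, $\kappa_1\not\sim_p\kappa_2$; otherwise it is non-crossing. A Tannaka--Krein dual (at parameter $N$) is a family $\mathcal{C}$ of linear subspaces $\hom_{\mathcal{C}}(k,\ell)\subseteq M_{N^\ell\times N^k}(\mathbb{C})$, $k,\ell\geq 0$, closed under tensor (Kronecker) products, composition of composable maps, and adjoints, containing $\mathrm{id}_N\in\hom_{\mathcal C}(1,1)$ and the row vector in $\hom_{\mathcal C}(2,0)$ with $(i,j)$-entry $\delta_{i,j}$. $\mathcal{P}$ (the dual of the classical permutation group $S_N$) is given by $\hom_{\mathcal{P}}(k,\ell)=\operatorname{span}\{T_p: p\in\mathcal{P}(k,\ell)\}$, and $\mathcal{NC}$ (the dual of the quantum permutation group $S_N^+$) by $\hom_{\mathcal{NC}}(k,\ell)=\operatorname{span}\{T_p: p\in\mathcal{P}(k,\ell)\text{ non-crossing}\}$. For $\xi\in(\mathbb{C}^N)^{\otimes k}=M_{N^k\times 1}(\mathbb{C})$, $\langle\mathcal{NC},\xi\rangle$ is the smallest Tannaka--Krein dual containing $\mathcal{NC}$ with $\xi\in\hom(0,k)$. $S_N\leq S_N^+$ is called maximal at easiness level $m$ if $\langle\mathcal{NC},\xi\rangle\in\{\mathcal{P},\mathcal{NC}\}$ for every linear combination $\xi=\sum_{i=1}^m\alpha_i\xi_{p_i}$ of length $m$ ($p_i\in\mathcal{P}(k)$ for a common $k$). *)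

theory Defs
  imports "Jordan_Normal_Form.VS_Connect" "Jordan_Normal_Form.Schur_Decomposition"
    "HOL-Library.Disjoint_Sets"
begin

text \<open>
  Complex $N^l \times N^k$ matrices are elements of \<^term>\<open>carrier_mat (N ^ l) (N ^ k)\<close>. Their rows and
  columns are numbered from 0; the row number \<open>i < N ^ l\<close> stands for the multi-index
  $(i_1,\ldots,i_l)$ formed by its base-\<open>N\<close> digits, most significant digit first, with digit values
  $0,\ldots,N-1$ in place of $1,\ldots,N$. With this convention the Kronecker product concatenates
  multi-indices.
\<close>

definition digit :: "nat \<Rightarrow> nat \<Rightarrow> nat \<Rightarrow> nat \<Rightarrow> nat" where
  "digit N k i x = (i div N ^ (k - x)) mod N"  \<comment> \<open>position \<open>x\<close> in \<open>{1..k}\<close>\<close>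

definition kron :: "complex mat \<Rightarrow> complex mat \<Rightarrow> complex mat" where
  "kron A B = mat (dim_row A * dim_row B) (dim_col A * dim_col B)
     (\<lambda>(i, j). A $$ (i div dim_row B, j div dim_col B) * B $$ (i mod dim_row B, j mod dim_col B))"

definition same_block :: "'a set set \<Rightarrow> 'a \<Rightarrow> 'a \<Rightarrow> bool" where
  "same_block p x y \<longleftrightarrow> (\<exists>B\<in>p. x \<in> B \<and> y \<in> B)"

definition partitions :: "nat \<Rightarrow> nat set set set" where
  "partitions k = {p. partition_on {1..k} p}"

definition xi :: "nat \<Rightarrow> nat \<Rightarrow> nat set set \<Rightarrow> complex mat" where
  "xi N k p = mat (N ^ k) 1
     (\<lambda>(i, _). if \<forall>x y. same_block p x y \<longrightarrow> digit N k i x = digit N k i y then 1 else 0)"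

text \<open>Upper points are \<open>Inl 1, \<dots>, Inl k\<close>, lower points \<open>Inr 1, \<dots>, Inr l\<close>, each from left to right.\<close>

definition points :: "nat \<Rightarrow> nat \<Rightarrow> (nat + nat) set" where
  "points k l = {1..k} <+> {1..l}"

definition partitions2 :: "nat \<Rightarrow> nat \<Rightarrow> (nat + nat) set set set" where
  "partitions2 k l = {p. partition_on (points k l) p}"

definition T_mat :: "nat \<Rightarrow> nat \<Rightarrow> nat \<Rightarrow> (nat + nat) set set \<Rightarrow> complex mat" where
  "T_mat N k l p = mat (N ^ l) (N ^ k)
     (\<lambda>(i, j). let label = case_sum (digit N k j) (digit N l i)
               in if \<forall>x y. same_block p x y \<longrightarrow> label x = label y then 1 else 0)"

lemma same_block_Inr:
  "same_block ((`) Inr ` p) a b \<longleftrightarrow> (\<exists>x y. a = Inr x \<and> b = Inr y \<and> same_block p x y)"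
  unfolding same_block_def by blast

lemma xi_eq_T_mat: "xi N k p = T_mat N 0 k ((`) Inr ` p)"
proof -
  have "(\<forall>a b. same_block ((`) Inr ` p) a b \<longrightarrow> case_sum f g a = case_sum f g b) \<longleftrightarrow>
      (\<forall>x y. same_block p x y \<longrightarrow> g x = g y)" (is "?L \<longleftrightarrow> ?R") for f g :: "nat \<Rightarrow> nat"
  proof
    assume L: ?L
    show ?R
    proof (intro allI impI)
      fix x y assume "same_block p x y"
      then have "same_block ((`) Inr ` p) (Inr x) (Inr y :: nat + nat)"
        by (simp add: same_block_Inr)
      with L have "case_sum f g (Inr x) = case_sum f g (Inr y)" by (elim allE impE)
      then show "g x = g y" by (simp only: sum.case)
    qed
  next
    assume R: ?R
    show ?L
    proof (intro allI impI)
      fix a b :: "nat + nat" assume "same_block ((`) Inr ` p) a b"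
      then obtain x y where "a = Inr x" "b = Inr y" "same_block p x y"
        unfolding same_block_Inr by (elim exE conjE)
      with R show "case_sum f g a = case_sum f g b" by simp
    qed
  qed
  then show ?thesis
    unfolding xi_def T_mat_def Let_def by (simp only: power_0)
qed

text \<open>The position in the order: upper points left to right, then lower points right to left.\<close>

fun pos :: "nat \<Rightarrow> nat \<Rightarrow> nat + nat \<Rightarrow> nat" where
  "pos k l (Inl x) = x"
| "pos k l (Inr y) = k + (l + 1 - y)"

definition crossing :: "nat \<Rightarrow> nat \<Rightarrow> (nat + nat) set set \<Rightarrow> bool" where
  "crossing k l p \<longleftrightarrow> (\<exists>a\<in>points k l. \<exists>b\<in>points k l. \<exists>c\<in>points k l. \<exists>d\<in>points k l.
     pos k l a < pos k l b \<and> pos k l b < pos k l c \<and> pos k l c < pos k l d \<and>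
     same_block p a c \<and> same_block p b d \<and> \<not> same_block p a b)"

type_synonym hom_family = "nat \<Rightarrow> nat \<Rightarrow> complex mat set"

abbreviation mat_space :: "nat \<Rightarrow> nat \<Rightarrow> (complex, complex mat) module" where
  "mat_space nr nc \<equiv> module_mat TYPE(complex) nr nc"

locale tannaka_krein_dual =
  fixes N :: nat and hom_C :: hom_family
  assumes hom_subspace:
      "VectorSpace.subspace class_ring (hom_C k l) (mat_space (N ^ l) (N ^ k))"
    and hom_tensor:
      "A \<in> hom_C k l \<Longrightarrow> B \<in> hom_C k' l' \<Longrightarrow> kron A B \<in> hom_C (k + k') (l + l')"
    and hom_comp: "A \<in> hom_C k l \<Longrightarrow> B \<in> hom_C l m \<Longrightarrow> B * A \<in> hom_C k m"
    and hom_adjoint: "A \<in> hom_C k l \<Longrightarrow> mat_adjoint A \<in> hom_C l k"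
    and hom_id: "1\<^sub>m N \<in> hom_C 1 1"
    and hom_pairing:
      "mat 1 (N ^ 2) (\<lambda>(_, j). if digit N 2 j 1 = digit N 2 j 2 then 1 else 0) \<in> hom_C 2 0"

definition mat_span :: "nat \<Rightarrow> nat \<Rightarrow> complex mat set \<Rightarrow> complex mat set" where
  "mat_span nr nc S = LinearCombinations.module.span class_ring (mat_space nr nc) S"

definition P_dual :: "nat \<Rightarrow> hom_family" where
  "P_dual N k l = mat_span (N ^ l) (N ^ k) (T_mat N k l ` partitions2 k l)"

definition NC_dual :: "nat \<Rightarrow> hom_family" where
  "NC_dual N k l =
     mat_span (N ^ l) (N ^ k) (T_mat N k l ` {p \<in> partitions2 k l. \<not> crossing k l p})"

definition NC_gen :: "nat \<Rightarrow> nat \<Rightarrow> complex mat \<Rightarrow> hom_family" where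
  "NC_gen N n \<xi> k l =
     \<Inter> {C k l | C. tannaka_krein_dual N C \<and> (\<forall>k' l'. NC_dual N k' l' \<subseteq> C k' l') \<and> \<xi> \<in> C 0 n}"

text \<open>
  The intersection \<^const>\<open>NC_gen\<close> really is the smallest Tannaka--Krein dual of this kind; the
  family of all matrices shows that it is not an empty intersection.
\<close>

lemma subspace_mat_iff:
  "VectorSpace.subspace class_ring W (mat_space nr nc) \<longleftrightarrow>
     W \<subseteq> carrier_mat nr nc \<and> 0\<^sub>m nr nc \<in> W \<and>
     (\<forall>A\<in>W. \<forall>B\<in>W. A + B \<in> W) \<and> (\<forall>c. \<forall>A\<in>W. c \<cdot>\<^sub>m A \<in> W)"
proof -
  have vs: "vectorspace class_ring (mat_space nr nc)" by (rule matrix_vs)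
  then have "Module.module class_ring (mat_space nr nc)" by (simp add: vectorspace_def)
  with vs have "VectorSpace.subspace class_ring W (mat_space nr nc) \<longleftrightarrow>
      W \<subseteq> carrier_mat nr nc \<and> (\<forall>A B. A \<in> W \<longrightarrow> B \<in> W \<longrightarrow> A + B \<in> W) \<and> 0\<^sub>m nr nc \<in> W \<and>
      (\<forall>c A. c \<in> (UNIV :: complex set) \<longrightarrow> A \<in> W \<longrightarrow> c \<cdot>\<^sub>m A \<in> W)"
    by (simp only: VectorSpace.subspace_def submodule_def module_mat_simps simp_thms
      partial_object.simps)
  then show ?thesis
    by blast
qed

lemma mat_adjoint_carrier: "A \<in> carrier_mat nr nc \<Longrightarrow> mat_adjoint A \<in> carrier_mat nc nr"
  by (auto simp: mat_adjoint_def)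

lemma kron_carrier:
  "A \<in> carrier_mat a b \<Longrightarrow> B \<in> carrier_mat c d \<Longrightarrow> kron A B \<in> carrier_mat (a * c) (b * d)"
  by (auto simp: kron_def)

lemma tannaka_krein_dual_full: "tannaka_krein_dual N (\<lambda>k l. carrier_mat (N ^ l) (N ^ k))"
  by (rule tannaka_krein_dual.intro)
    (simp_all add: subspace_mat_iff power_add mat_adjoint_carrier kron_carrier)

lemma mat_span_subset:
  assumes "S \<subseteq> carrier_mat nr nc"
  shows "mat_span nr nc S \<subseteq> carrier_mat nr nc"
proof -
  have "Module.module class_ring (mat_space nr nc)"
    using matrix_vs by (auto simp: vectorspace_def)
  from LinearCombinations.module.span_is_subset2[OF this, of S] assms show ?thesis
    by (simp add: mat_span_def module_mat_simps)
qed

lemma NC_dual_subset: "NC_dual N k l \<subseteq> carrier_mat (N ^ l) (N ^ k)"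
  unfolding NC_dual_def by (rule mat_span_subset) (auto simp: T_mat_def)

lemma NC_gen_tannaka_krein_dual:
  assumes "\<xi> \<in> carrier_mat (N ^ n) 1"
  shows "tannaka_krein_dual N (NC_gen N n \<xi>)"
proof -
  define F where
    "F = {C. tannaka_krein_dual N C \<and> (\<forall>k' l'. NC_dual N k' l' \<subseteq> C k' l') \<and> \<xi> \<in> C 0 n}"
  have mem: "A \<in> NC_gen N n \<xi> k l \<longleftrightarrow> (\<forall>C\<in>F. A \<in> C k l)" for A k l
    by (auto simp: NC_gen_def F_def)
  have full: "(\<lambda>k l. carrier_mat (N ^ l) (N ^ k)) \<in> F"
    using assms tannaka_krein_dual_full NC_dual_subset by (auto simp: F_def)
  have dual: "tannaka_krein_dual N C" if "C \<in> F" for C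
    using that by (simp add: F_def)
  note sub = tannaka_krein_dual.hom_subspace[OF dual, unfolded subspace_mat_iff]
  show ?thesis
  proof (rule tannaka_krein_dual.intro)
    fix k l
    have "NC_gen N n \<xi> k l \<subseteq> carrier_mat (N ^ l) (N ^ k)"
      using bspec[OF mem[THEN iffD1] full] by (intro subsetI)
    moreover have "0\<^sub>m (N ^ l) (N ^ k) \<in> NC_gen N n \<xi> k l"
      unfolding mem by (intro ballI sub[THEN conjunct2, THEN conjunct1])
    moreover have "A + B \<in> NC_gen N n \<xi> k l"
      if "A \<in> NC_gen N n \<xi> k l" "B \<in> NC_gen N n \<xi> k l" for A B
      unfolding mem
    proof
      fix C assume "C \<in> F"
      with sub[of C k l] that show "A + B \<in> C k l" by (simp add: mem)
    qed
    moreover have "c \<cdot>\<^sub>m A \<in> NC_gen N n \<xi> k l" if "A \<in> NC_gen N n \<xi> k l" for A c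
      unfolding mem
    proof
      fix C assume "C \<in> F"
      with sub[of C k l] that show "c \<cdot>\<^sub>m A \<in> C k l" by (simp add: mem)
    qed
    ultimately show "VectorSpace.subspace class_ring (NC_gen N n \<xi> k l) (mat_space (N ^ l) (N ^ k))"
      unfolding subspace_mat_iff by simp
  next
    fix A B k l k' l'
    assume "A \<in> NC_gen N n \<xi> k l" "B \<in> NC_gen N n \<xi> k' l'"
    then show "kron A B \<in> NC_gen N n \<xi> (k + k') (l + l')"
      by (simp add: mem tannaka_krein_dual.hom_tensor[OF dual])
  next
    fix A B k l m
    assume AB: "A \<in> NC_gen N n \<xi> k l" "B \<in> NC_gen N n \<xi> l m"
    show "B * A \<in> NC_gen N n \<xi> k m"
      unfolding mem
    proof
      fix C assume "C \<in> F"
      with AB show "B * A \<in> C k m"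
        by (intro tannaka_krein_dual.hom_comp[OF dual, of C A k l B m]) (simp_all add: mem)
    qed
  next
    fix A k l
    assume "A \<in> NC_gen N n \<xi> k l"
    then show "mat_adjoint A \<in> NC_gen N n \<xi> l k"
      by (simp add: mem tannaka_krein_dual.hom_adjoint[OF dual])
  next
    show "1\<^sub>m N \<in> NC_gen N n \<xi> 1 1"
      unfolding mem by (intro ballI tannaka_krein_dual.hom_id[OF dual])
  next
    show "mat 1 (N ^ 2) (\<lambda>(_, j). if digit N 2 j 1 = digit N 2 j 2 then 1 else 0) \<in> NC_gen N n \<xi> 2 0"
      unfolding mem by (intro ballI tannaka_krein_dual.hom_pairing[OF dual])
  qed
qed

lemma NC_gen_contains: "NC_dual N k l \<subseteq> NC_gen N n \<xi> k l" "\<xi> \<in> NC_gen N n \<xi> 0 n"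
  by (auto simp: NC_gen_def)

lemma NC_gen_least:
  assumes "tannaka_krein_dual N C" "\<And>k l. NC_dual N k l \<subseteq> C k l" "\<xi> \<in> C 0 n"
  shows "NC_gen N n \<xi> k l \<subseteq> C k l"
  unfolding NC_gen_def by (rule Inter_lower) (use assms in blast)

end

theory Submission
  imports Defs "HOL-Library.Sublist"
begin

text \<open>
  Everything happens at the level of formal combinations of partitions, so that linear dependencies
  between the vectors $\xi_p$ for small $N$ play no role. Subtracting the non-crossing terms, one
  may assume that $\xi = \sum_{j \in J} \alpha_j \xi_{p_j}$ with $|J| \le 3$, all $p_j$ crossing and pairwise
  distinct, and all $\alpha_j \neq 0$. If there are at least five points, then either summing out some
  point $e$ (which removes $e$ from each partition and multiplies by $N$ where $e$ was a singleton), or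
  fusing some $e$ with a cyclic neighbour, again gives a combination in which the crossing
  terms do not all cancel. Hence one descends to four points, where only one crossing partition
  exists; this basic crossing generates all permutations and therefore all of \<^term>\<open>P_dual N\<close>.

  Why the cancellation is impossible: since only points common to all crossings of $p_j$ can
  destroy its crossing when they are removed, some $e$ leaves a crossing $q = p_i \setminus e$, which
  must be matched by another $p_j$, so that $p_i$ and $p_j$ differ only in the block of $q$ that
  contains $e$. Fusing $e$ with its two neighbours then produces crossing terms that the single
  remaining partition cannot cancel; the weight $N \ge 2$ is needed only if $e$ is a singleton of $p_i$.
  Partitions are encoded as words, two positions being in the same block when the letters agree.
\<close>

section \<open>Cancelling crossing partitions\<close>

text \<open>Three is decisive through a pigeonhole argument: two different terms that cannot be
  matched with each other but both need a partner must share the single remaining term, which makes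
  them equal. Relations between several coefficients are evaluated only in
  \<open>no_single_config\<close>: there deletion gives \<open>N * a + b = 0\<close> and fusion
  \<open>a + b = 0\<close>. These are compatible for \<open>N = 1\<close>, but then every tensor
  space is one-dimensional and all partition vectors coincide, so that case is settled directly.
  Identifying the generated dual also requires that \<open>P_dual N\<close> and
  \<open>NC_dual N\<close> are Tannaka-Krein duals themselves. Reading lower points left to right
  and then upper points right to left turns hom(k, l) into hom(0, k + l). The axioms then become
  concatenation, rotation, contraction of adjacent letters and reversal with conjugation. All of
  these can be checked on words, where crossing means containing a pattern x y x y of two different
  letters.\<close>

definition between :: "nat \<Rightarrow> nat \<Rightarrow> nat \<Rightarrow> bool" where
  "between a c x \<longleftrightarrow> (a < x \<and> x < c) \<or> (c < x \<and> x < a)"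

text \<open>Phrased without fixing the order of the four points, so that it is invariant under
  cyclic rotation: on a circle, the chord from \<open>a\<close> to \<open>c\<close> separates
  \<open>b\<close> from \<open>d\<close>.\<close>

definition chords_cross :: "nat \<Rightarrow> nat \<Rightarrow> nat \<Rightarrow> nat \<Rightarrow> bool" where
  "chords_cross a c b d \<longleftrightarrow>
     b \<noteq> a \<and> b \<noteq> c \<and> d \<noteq> a \<and> d \<noteq> c \<and> between a c b \<noteq> between a c d"

text \<open>Words encode partitions only up to renaming of letters; this is equality of the encoded
  partitions of \<open>B\<close>.\<close>

definition same_kernel :: "nat set \<Rightarrow> (nat \<Rightarrow> nat) \<Rightarrow> (nat \<Rightarrow> nat) \<Rightarrow> bool" where
  "same_kernel B v w \<longleftrightarrow> (\<forall>x\<in>B. \<forall>y\<in>B. v x = v y \<longleftrightarrow> w x = w y)"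

definition crossing_on :: "nat set \<Rightarrow> (nat \<Rightarrow> nat) \<Rightarrow> bool" where
  "crossing_on B w \<longleftrightarrow> (\<exists>a\<in>B. \<exists>c\<in>B. \<exists>b\<in>B. \<exists>d\<in>B.
     chords_cross a c b d \<and> w a = w c \<and> w b = w d \<and> w a \<noteq> w b)"

text \<open>For \<open>e'\<close> in \<open>A - {e}\<close>, the restriction to
  \<open>A - {e}\<close> describes the partition in which the blocks of \<open>e\<close> and
  \<open>e'\<close> are joined and \<open>e\<close> is dropped.\<close>

definition fuse :: "nat \<Rightarrow> nat \<Rightarrow> (nat \<Rightarrow> nat) \<Rightarrow> nat \<Rightarrow> nat" where
  "fuse e e' w = (\<lambda>x. if w x = w e then w e' else w x)"

text \<open>The second alternative is the wrap-around: \<open>e\<close> and \<open>e'\<close> are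
  then the first and the last point of \<open>A\<close>.\<close>

definition neighbours :: "nat set \<Rightarrow> nat \<Rightarrow> nat \<Rightarrow> bool" where
  "neighbours A e e' \<longleftrightarrow> e \<in> A \<and> e' \<in> A \<and> e \<noteq> e' \<and>
     ((\<forall>x\<in>A. \<not> between e e' x) \<or> (\<forall>x\<in>A - {e, e'}. between e e' x))"

lemma same_kernelD: "same_kernel B v w \<Longrightarrow> x \<in> B \<Longrightarrow> y \<in> B \<Longrightarrow> v x = v y \<longleftrightarrow> w x = w y"
  by (auto simp: same_kernel_def)

lemma same_kernel_refl [simp]: "same_kernel B v v"
  and same_kernel_sym: "same_kernel B v w \<Longrightarrow> same_kernel B w v"
  and same_kernel_trans [trans]: "same_kernel B u v \<Longrightarrow> same_kernel B v w \<Longrightarrow> same_kernel B u w"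
  by (auto simp: same_kernel_def)

lemma crossing_onI:
  "a \<in> B \<Longrightarrow> c \<in> B \<Longrightarrow> b \<in> B \<Longrightarrow> d \<in> B \<Longrightarrow> chords_cross a c b d \<Longrightarrow>
   w a = w c \<Longrightarrow> w b = w d \<Longrightarrow> w a \<noteq> w b \<Longrightarrow> crossing_on B w"
  unfolding crossing_on_def by blast

lemma crossing_onE:
  assumes "crossing_on B w"
  obtains a c b d where "a \<in> B" "c \<in> B" "b \<in> B" "d \<in> B" "chords_cross a c b d"
    "w a = w c" "w b = w d" "w a \<noteq> w b"
  using assms unfolding crossing_on_def by blast

lemma crossing_on_mono: "crossing_on B w \<Longrightarrow> B \<subseteq> B' \<Longrightarrow> crossing_on B' w"
  unfolding crossing_on_def by blast

lemma crossing_on_cong: "same_kernel B v w \<Longrightarrow> crossing_on B v \<longleftrightarrow> crossing_on B w"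
  unfolding crossing_on_def same_kernel_def by (intro bex_cong refl) blast

lemma between_iff: "x \<noteq> a \<Longrightarrow> x \<noteq> c \<Longrightarrow> between a c x \<longleftrightarrow> (a < x) \<noteq> (c < x)"
  unfolding between_def by linarith

lemma chords_cross_iff:
  "chords_cross a c b d \<longleftrightarrow> b \<noteq> a \<and> b \<noteq> c \<and> d \<noteq> a \<and> d \<noteq> c \<and>
     ((a < b) \<noteq> (c < b)) \<noteq> ((a < d) \<noteq> (c < d))"
  unfolding chords_cross_def using between_iff by metis

lemma chords_cross_sym:
  "chords_cross a c b d \<longleftrightarrow> chords_cross c a b d"
  "chords_cross a c b d \<longleftrightarrow> chords_cross a c d b"
  "chords_cross a c b d \<longleftrightarrow> chords_cross b d a c"
  unfolding chords_cross_iff by (metis linorder_neq_iff order_less_asym)+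

lemma chords_cross_distinct: "chords_cross a c b d \<Longrightarrow> distinct [a, b, c, d]"
  unfolding chords_cross_iff by auto

text \<open>One of the two arcs from \<open>e\<close> to \<open>e'\<close> contains no other point
  of \<open>A\<close>, so every chord between other points has both on the same side.\<close>

lemma neighbours_swap:
  assumes "neighbours A e e'" "x \<in> A - {e, e'}" "y \<in> A - {e, e'}" "z \<in> A - {e, e'}"
  shows "chords_cross e x y z \<longleftrightarrow> chords_cross e' x y z"
proof -
  have ne: "y \<noteq> e" "y \<noteq> e'" "z \<noteq> e" "z \<noteq> e'" using assms(2-4) by auto
  from assms have "(\<not> between e e' y \<and> \<not> between e e' z) \<or> (between e e' y \<and> between e e' z)"
    unfolding neighbours_def by blast
  then have "(e < y) = (e' < y) \<longleftrightarrow> (e < z) = (e' < z)"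
    using between_iff[OF ne(1,2)] between_iff[OF ne(3,4)] by blast
  with ne show ?thesis
    unfolding chords_cross_iff by metis
qed

lemma neighbours_no_cross:
  assumes "neighbours A e e'" "x \<in> A" "y \<in> A"
  shows "\<not> chords_cross e e' x y"
  using assms unfolding neighbours_def chords_cross_def by blast

text \<open>A neighbour \<open>f\<close> of \<open>e\<close> lying in the same block can take over the role of \<open>e\<close> in a crossing.\<close>

lemma crossing_on_delete_transfer:
  assumes swap: "\<And>x y z. x \<in> B \<Longrightarrow> y \<in> B \<Longrightarrow> z \<in> B \<Longrightarrow> x \<notin> {e, f} \<Longrightarrow> y \<notin> {e, f} \<Longrightarrow> z \<notin> {e, f} \<Longrightarrow>
      chords_cross e x y z \<longleftrightarrow> chords_cross f x y z"
    and no: "\<And>x y. x \<in> B \<Longrightarrow> y \<in> B \<Longrightarrow> \<not> chords_cross e f x y"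
    and f: "f \<in> B" "f \<noteq> e" "w e = w f"
    and cr: "crossing_on B w"
  shows "crossing_on (B - {e}) w"
proof -
  from cr obtain a c b d where q: "a \<in> B" "c \<in> B" "b \<in> B" "d \<in> B" "chords_cross a c b d"
    "w a = w c" "w b = w d" "w a \<noteq> w b" by (rule crossing_onE)
  have main: "crossing_on (B - {e}) w"
    if "chords_cross e c b d" "c \<in> B" "b \<in> B" "d \<in> B" "w e = w c" "w b = w d" "w e \<noteq> w b" for c b d
  proof -
    have ne: "c \<noteq> f" "b \<noteq> f" "d \<noteq> f" "c \<noteq> e" "b \<noteq> e" "d \<noteq> e"
      using no[of b d] that f chords_cross_distinct[OF that(1)] by force+
    then have "chords_cross f c b d" using swap[of c b d] that by simp
    with that f ne show ?thesis
      by (intro crossing_onI[of f _ c b d]) auto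
  qed
  consider "a = e" | "c = e" | "b = e" | "d = e" | "e \<notin> {a, b, c, d}" by auto
  then show ?thesis
  proof cases
    case 1 with q main[of c b d] show ?thesis by simp
  next
    case 2 with q main[of a b d] chords_cross_sym show ?thesis by metis
  next
    case 3 with q main[of d a c] chords_cross_sym show ?thesis by metis
  next
    case 4 with q main[of b a c] chords_cross_sym show ?thesis by metis
  next
    case 5 with q show ?thesis by (intro crossing_onI[of a _ c b d]) auto
  qed
qed

lemma crossing_on_delete_neighbour:
  assumes "neighbours A e f" "w e = w f" "crossing_on A w"
  shows "crossing_on (A - {e}) w"
proof (rule crossing_on_delete_transfer[of A e f])
  fix x y z assume "x \<in> A" "y \<in> A" "z \<in> A" "x \<notin> {e, f}" "y \<notin> {e, f}" "z \<notin> {e, f}"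
  then show "chords_cross e x y z \<longleftrightarrow> chords_cross f x y z"
    using neighbours_swap[OF assms(1)] by auto
qed (use assms neighbours_no_cross[OF assms(1)] in \<open>auto simp: neighbours_def\<close>)

lemma neighbours_commute: "neighbours A e f \<longleftrightarrow> neighbours A f e"
  unfolding neighbours_def between_def by auto

text \<open>Once \<open>e\<close> is gone, its two neighbours are adjacent to each other, so the
  same replacement argument applies to them.\<close>

lemma crossing_on_delete_second_neighbour:
  assumes n: "neighbours A e e1" "neighbours A e e2" "e1 \<noteq> e2"
    and "w e1 = w e2" "crossing_on (A - {e}) w"
  shows "crossing_on (A - {e, e1}) w"
proof -
  have "crossing_on (A - {e} - {e1}) w"
  proof (rule crossing_on_delete_transfer[of "A - {e}" e1 e2])
    fix x y z assume *: "x \<in> A - {e}" "y \<in> A - {e}" "z \<in> A - {e}"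
      "x \<notin> {e1, e2}" "y \<notin> {e1, e2}" "z \<notin> {e1, e2}"
    then show "chords_cross e1 x y z \<longleftrightarrow> chords_cross e2 x y z"
      using neighbours_swap[OF n(1), of x y z] neighbours_swap[OF n(2), of x y z] by auto
  next
    fix x y assume *: "x \<in> A - {e}" "y \<in> A - {e}"
    show "\<not> chords_cross e1 e2 x y"
    proof
      assume c: "chords_cross e1 e2 x y"
      have "chords_cross e e2 x y"
        using neighbours_swap[OF n(1), of e2 x y] c * n chords_cross_distinct[OF c]
        by (auto simp: neighbours_def)
      with neighbours_no_cross[OF n(2)] * show False by auto
    qed
  qed (use assms in \<open>auto simp: neighbours_def\<close>)
  then show ?thesis by (simp add: Diff_insert2 [symmetric] insert_commute)
qed

text \<open>Joining two blocks can remove a crossing only if these two blocks are the ones that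
  cross.\<close>

lemma fuse_noncrossing:
  assumes "\<not> crossing_on B (fuse e e' w)"
    and "a \<in> B" "c \<in> B" "b \<in> B" "d \<in> B" "chords_cross a c b d" "w a = w c" "w b = w d" "w a \<noteq> w b"
  shows "w a = w e \<and> w b = w e' \<or> w a = w e' \<and> w b = w e"
proof (rule ccontr)
  assume "\<not> ?thesis"
  with assms have "crossing_on B (fuse e e' w)"
    by (intro crossing_onI[of a _ c b d]) (auto simp: fuse_def)
  with assms show False by simp
qed

lemma fuse_noncrossingE:
  assumes "\<not> crossing_on B (fuse e e' w)" "crossing_on B w"
  obtains a c b d where "a \<in> B" "c \<in> B" "b \<in> B" "d \<in> B" "chords_cross a c b d"
    "w a = w e'" "w c = w e'" "w b = w e" "w d = w e" "w e \<noteq> w e'"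
proof -
  from assms(2) obtain a c b d where q: "a \<in> B" "c \<in> B" "b \<in> B" "d \<in> B" "chords_cross a c b d"
    "w a = w c" "w b = w d" "w a \<noteq> w b" by (rule crossing_onE)
  from fuse_noncrossing[OF assms(1) q] show thesis
  proof
    assume "w a = w e \<and> w b = w e'"
    with q show thesis by (intro that[of b d a c]) (use chords_cross_sym in \<open>metis+\<close>)
  next
    assume "w a = w e' \<and> w b = w e"
    with q show thesis by (intro that[of a c b d]) auto
  qed
qed

lemma fuse_same_kernel:
  assumes "(\<forall>x\<in>B. w x \<noteq> w e) \<or> w e = w e'"
  shows "same_kernel B (fuse e e' w) w"
  using assms unfolding same_kernel_def fuse_def by auto

text \<open>A crossing occupies four points, so any fifth point can be removed. This is why the
  descent stops at four points.\<close>

lemma crossing_on_delete_exists: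
  assumes "crossing_on A w" "finite A" "5 \<le> card A"
  shows "\<exists>e\<in>A. crossing_on (A - {e}) w"
proof -
  from assms(1) obtain a c b d where q: "a \<in> A" "c \<in> A" "b \<in> A" "d \<in> A" "chords_cross a c b d"
    "w a = w c" "w b = w d" "w a \<noteq> w b" by (rule crossing_onE)
  have "card {a, b, c, d} \<le> 4" by (simp add: card_insert_if)
  moreover have "card A \<le> card {a, b, c, d}" if "A \<subseteq> {a, b, c, d}"
    using that by (intro card_mono) auto
  ultimately have "\<not> A \<subseteq> {a, b, c, d}" using assms(3) by linarith
  then obtain e where "e \<in> A" "e \<notin> {a, b, c, d}" by blast
  with q show ?thesis by (intro bexI[of _ e] crossing_onI[of a _ c b d]) auto
qed

section \<open>Combinations in which every deletion and every fusion cancels all crossing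
  terms\<close>

definition delete_weight :: "nat \<Rightarrow> nat set \<Rightarrow> nat \<Rightarrow> (nat \<Rightarrow> nat) \<Rightarrow> complex" where
  "delete_weight N A e w = (if \<exists>x\<in>A - {e}. w x = w e then 1 else of_nat N)"

text \<open>A hypothetical obstruction to the descent: crossing partitions with non-zero
  coefficients such that, after deleting any point or fusing it with a neighbour, every crossing
  partition has total weight zero. \<open>J_empty\<close> shows that only the empty combination
  qualifies.\<close>

locale uncappable =
  fixes A J :: "nat set" and w :: "nat \<Rightarrow> nat \<Rightarrow> nat" and \<alpha> :: "nat \<Rightarrow> complex" and N :: nat
  assumes N: "2 \<le> N"
    and finite_A: "finite A" and card_A: "5 \<le> card A"
    and two_neighbours: "e \<in> A \<Longrightarrow> \<exists>e1 e2. e1 \<noteq> e2 \<and> neighbours A e e1 \<and> neighbours A e e2"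
    and finite_J: "finite J" and card_J: "card J \<le> 3"
    and crossing: "j \<in> J \<Longrightarrow> crossing_on A (w j)"
    and distinct: "i \<in> J \<Longrightarrow> j \<in> J \<Longrightarrow> same_kernel A (w i) (w j) \<Longrightarrow> i = j"
    and nonzero: "j \<in> J \<Longrightarrow> \<alpha> j \<noteq> 0"
    and delete: "e \<in> A \<Longrightarrow> i \<in> J \<Longrightarrow> crossing_on (A - {e}) (w i) \<Longrightarrow>
      (\<Sum>j | j \<in> J \<and> same_kernel (A - {e}) (w i) (w j). \<alpha> j * delete_weight N A e (w j)) = 0"
    and fuse: "neighbours A e e' \<Longrightarrow> i \<in> J \<Longrightarrow> crossing_on (A - {e}) (fuse e e' (w i)) \<Longrightarrow>
      (\<Sum>j | j \<in> J \<and> same_kernel (A - {e}) (fuse e e' (w i)) (fuse e e' (w j)). \<alpha> j) = 0"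
begin

lemma J_three: "\<lbrakk>i \<in> J; j \<in> J; k \<in> J; l \<in> J; i \<noteq> j; i \<noteq> k; j \<noteq> k\<rbrakk> \<Longrightarrow> l = i \<or> l = j \<or> l = k"
proof (rule ccontr)
  assume *: "i \<in> J" "j \<in> J" "k \<in> J" "l \<in> J" "i \<noteq> j" "i \<noteq> k" "j \<noteq> k" "\<not> (l = i \<or> l = j \<or> l = k)"
  then have "card {i, j, k, l} = 4" by auto
  moreover have "card {i, j, k, l} \<le> card J" using * finite_J by (intro card_mono) auto
  ultimately show False using card_J by simp
qed

text \<open>One non-zero term alone cannot form a vanishing sum, and the factor
  \<open>delete_weight\<close> is \<open>1\<close> or \<open>N\<close>, hence non-zero.\<close>

lemma delete_partner:
  assumes "e \<in> A" "i \<in> J" "crossing_on (A - {e}) (w i)"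
  obtains j where "j \<in> J" "j \<noteq> i" "same_kernel (A - {e}) (w i) (w j)"
proof (rule ccontr)
  assume "\<not> thesis"
  with that assms have "{j. j \<in> J \<and> same_kernel (A - {e}) (w i) (w j)} = {i}" by auto
  with delete[OF assms] nonzero[OF assms(2)] N show False by (auto simp: delete_weight_def split: if_splits)
qed

lemma fuse_partner:
  assumes "neighbours A e e'" "i \<in> J" "crossing_on (A - {e}) (fuse e e' (w i))"
  obtains j where "j \<in> J" "j \<noteq> i" "same_kernel (A - {e}) (fuse e e' (w i)) (fuse e e' (w j))"
proof (rule ccontr)
  assume "\<not> thesis"
  with that assms have "{j. j \<in> J \<and> same_kernel (A - {e}) (fuse e e' (w i)) (fuse e e' (w j))} = {i}" by auto
  with fuse[OF assms] nonzero[OF assms(2)] show False by auto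
qed

text \<open>The two partitions agree, with a crossing, away from \<open>e\<close>; they differ only
  in how \<open>e\<close> is attached. This is the situation that \<open>delete_partner\<close>
  produces.\<close>

definition config :: "nat \<Rightarrow> nat \<Rightarrow> nat \<Rightarrow> bool" where
  "config e i j \<longleftrightarrow> e \<in> A \<and> i \<in> J \<and> j \<in> J \<and> i \<noteq> j \<and> same_kernel (A - {e}) (w i) (w j) \<and>
     crossing_on (A - {e}) (w i)"

definition single :: "nat \<Rightarrow> nat \<Rightarrow> bool" where
  "single e i \<longleftrightarrow> (\<forall>x\<in>A - {e}. w i x \<noteq> w i e)"

lemma config_sym: "config e i j \<longleftrightarrow> config e j i"
  unfolding config_def using crossing_on_cong same_kernel_sym by blast

lemma configD:
  assumes "config e i j"
  shows "e \<in> A" "i \<in> J" "j \<in> J" "i \<noteq> j" "same_kernel (A - {e}) (w i) (w j)"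
    "crossing_on (A - {e}) (w i)" "crossing_on (A - {e}) (w j)"
  using assms crossing_on_cong unfolding config_def by blast+

text \<open>A point \<open>z\<close> joined to \<open>e\<close> in both partitions determines the
  attachment of \<open>e\<close> in both, by their agreement away from \<open>e\<close>; they would
  be equal, against \<open>distinct\<close>.\<close>

lemma config_disjoint:
  assumes "config e i j" "z \<in> A - {e}" "w i z = w i e" "w j z = w j e"
  shows False
proof -
  note c = configD[OF assms(1)]
  have "same_kernel A (w i) (w j)"
    unfolding same_kernel_def
  proof (intro ballI)
    fix x y assume xy: "x \<in> A" "y \<in> A"
    have *: "w i x = w i e \<longleftrightarrow> w j x = w j e" if "x \<in> A" for x
      using same_kernelD[OF c(5), of x z] that assms by (cases "x = e") auto
    show "w i x = w i y \<longleftrightarrow> w j x = w j y"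
      using same_kernelD[OF c(5), of x y] *[of x] *[of y] xy by (cases "x = e"; cases "y = e") auto
  qed
  with c distinct show False by blast
qed

lemma config_not_both_single:
  assumes "config e i j" "single e i" shows "\<not> single e j"
proof
  assume "single e j"
  note c = configD[OF assms(1)]
  have "same_kernel A (w i) (w j)"
    unfolding same_kernel_def
  proof (intro ballI)
    fix x y assume xy: "x \<in> A" "y \<in> A"
    show "w i x = w i y \<longleftrightarrow> w j x = w j y"
      using same_kernelD[OF c(5), of x y] assms(2) \<open>single e j\<close> xy unfolding single_def
      by (cases "x = e"; cases "y = e") (auto; metis)+
  qed
  with c distinct show False by blast
qed

lemma fuse_trivial:
  assumes "single e i \<or> w i e = w i e'"
  shows "same_kernel (A - {e}) (fuse e e' (w i)) (w i)"
  using assms by (intro fuse_same_kernel) (auto simp: single_def)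

text \<open>Some other point \<open>z\<close> of the block of \<open>e\<close> becomes joined to
  \<open>e'\<close> by fusing, while it is separated from \<open>e'\<close> in \<open>w i\<close>
  and therefore also in \<open>w j\<close>.\<close>

lemma fuse_differ_trivial:
  assumes "config e i j" "neighbours A e e'" "\<not> single e i" "w i e \<noteq> w i e'"
  shows "\<not> same_kernel (A - {e}) (fuse e e' (w i)) (w j)"
proof
  assume s: "same_kernel (A - {e}) (fuse e e' (w i)) (w j)"
  from assms obtain z where z: "z \<in> A - {e}" "w i z = w i e" by (auto simp: single_def)
  have e': "e' \<in> A - {e}" using assms by (auto simp: neighbours_def)
  have "w j z = w j e'" using same_kernelD[OF s z(1) e'] z by (auto simp: fuse_def)
  with same_kernelD[OF configD(5)[OF assms(1)] z(1) e'] z assms show False by simp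
qed

text \<open>A point \<open>z\<close> of the block of \<open>e\<close> in \<open>w i\<close> is
  joined to \<open>e'\<close> by fusing \<open>w i\<close>. Fusing \<open>w j\<close> could do the
  same only if \<open>z\<close> were in the block of \<open>e\<close> in \<open>w j\<close> too,
  which \<open>config_disjoint\<close> excludes.\<close>

lemma fuse_differ:
  assumes "config e i j" "neighbours A e e'" "\<not> single e i" "w i e \<noteq> w i e'"
    "\<not> single e j" "w j e \<noteq> w j e'"
  shows "\<not> same_kernel (A - {e}) (fuse e e' (w i)) (fuse e e' (w j))"
proof
  assume s: "same_kernel (A - {e}) (fuse e e' (w i)) (fuse e e' (w j))"
  from assms obtain z where z: "z \<in> A - {e}" "w i z = w i e" by (auto simp: single_def)
  have e': "e' \<in> A - {e}" using assms by (auto simp: neighbours_def)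
  have "fuse e e' (w j) z = fuse e e' (w j) e'"
    using same_kernelD[OF s z(1) e'] z by (auto simp: fuse_def)
  moreover have "w j z \<noteq> w j e'"
    using same_kernelD[OF configD(5)[OF assms(1)] z(1) e'] z assms by simp
  ultimately have "w j z = w j e" using assms by (auto simp: fuse_def split: if_splits)
  with config_disjoint[OF assms(1)] z show False by blast
qed

text \<open>Both partitions share a crossing, which would have to be destroyed in both. The crossing
  block away from \<open>e'\<close> would then be the block of \<open>e\<close> in both partitions,
  against \<open>config_disjoint\<close>.\<close>

lemma fuse_not_both_noncrossing:
  assumes "config e i j" "\<not> crossing_on (A - {e}) (fuse e e' (w i))" "neighbours A e e'"
  shows "crossing_on (A - {e}) (fuse e e' (w j))"
proof (rule ccontr)
  assume n: "\<not> ?thesis"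
  note c = configD[OF assms(1)]
  have e': "e' \<in> A - {e}" using assms by (auto simp: neighbours_def)
  from fuse_noncrossingE[OF assms(2) c(6)] obtain a c b d where
    q: "a \<in> A - {e}" "c \<in> A - {e}" "b \<in> A - {e}" "d \<in> A - {e}" "chords_cross a c b d"
    "w i a = w i e'" "w i c = w i e'" "w i b = w i e" "w i d = w i e" "w i e \<noteq> w i e'" by metis
  note sk = same_kernelD[OF c(5)]
  have j: "w j a = w j e'" "w j c = w j e'" "w j b = w j d" "w j a \<noteq> w j b"
    using sk q e' by metis+
  from fuse_noncrossing[OF n q(1-5)] j have "w j b = w j e" by auto
  with config_disjoint[OF assms(1) q(3)] q show False by blast
qed

text \<open>The three partitions are classified by the place of \<open>e\<close>: a singleton, in
  the block of a fixed neighbour \<open>e'\<close>, or neither. Each of the first two types occurs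
  at most once; \<open>ST\<close> treats the case that both occur, \<open>lone\<close> that exactly
  one occurs, \<open>others\<close> that none does.\<close>

lemma no_triple_config:
  assumes "config e i j" "config e i k" "j \<noteq> k"
  shows False
proof -
  note ci = configD[OF assms(1)] and ck = configD[OF assms(2)]
  have cjk: "config e j k"
    using ci ck assms(3) same_kernel_trans[OF same_kernel_sym[OF ci(5)] ck(5)] unfolding config_def by blast
  obtain e' where nb: "neighbours A e e'" using two_neighbours ci by blast
  have e': "e' \<in> A - {e}" using nb by (auto simp: neighbours_def)
  have nbA: "e' \<in> A" "e' \<noteq> e" using e' by auto
  \<comment> \<open>Fusing leaves \<open>i\<close> and \<open>j\<close> unchanged away from
    \<open>e\<close> but changes \<open>k\<close>, so the fused \<open>k\<close> is unmatched and
    must lose its crossing; this yields a second point \<open>z\<close> in the block of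
    \<open>e'\<close> in \<open>w k\<close>. Deleting \<open>e'\<close> from \<open>j\<close> keeps
    a crossing, because \<open>e\<close> replaces \<open>e'\<close>. A partner would have to join
    \<open>z\<close> to \<open>e\<close>, and neither \<open>i\<close> nor \<open>k\<close>
    does.\<close>
  have ST: False if c: "config e i j" "config e i k" "config e j k"
    and S: "single e i" and T: "w j e = w j e'" for i j k
  proof -
    note ci = configD[OF c(1)] and ck = configD[OF c(2)] and cj = configD[OF c(3)]
    have k: "\<not> single e k" "w k e \<noteq> w k e'"
      using config_not_both_single[OF c(2) S] config_disjoint[OF c(3) e'] T by auto
    have "\<not> crossing_on (A - {e}) (fuse e e' (w k))"
    proof
      assume "crossing_on (A - {e}) (fuse e e' (w k))"
      then obtain l where l: "l \<in> J" "l \<noteq> k"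
        "same_kernel (A - {e}) (fuse e e' (w k)) (fuse e e' (w l))"
        using fuse_partner[OF nb] ck by metis
      have "l = i \<or> l = j" using J_three[of i j k l] l ci ck cj by auto
      then have "config e k l" "same_kernel (A - {e}) (fuse e e' (w l)) (w l)"
        using c config_sym fuse_trivial S T by blast+
      with fuse_differ_trivial[OF _ nb k] same_kernel_trans[OF l(3)] show False by blast
    qed
    from fuse_noncrossingE[OF this ck(7)] obtain a c b d where
      q: "a \<in> A - {e}" "c \<in> A - {e}" "b \<in> A - {e}" "d \<in> A - {e}" "chords_cross a c b d"
      "w k a = w k e'" "w k c = w k e'" "w k b = w k e" "w k d = w k e" "w k e \<noteq> w k e'" by metis
    have "a \<noteq> c" using q(5) chords_cross_distinct by auto
    then obtain z where z: "z \<in> A - {e}" "z \<noteq> e'" "w k z = w k e'" using q by metis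
    have jz: "w j z = w j e'" using same_kernelD[OF cj(5) z(1) e'] z by simp
    have "crossing_on (A - {e'}) (w j)"
      using crossing_on_delete_neighbour[of A e' e "w j"] nb T crossing[of j] ci
      by (simp add: neighbours_commute)
    then obtain l where l: "l \<in> J" "l \<noteq> j" "same_kernel (A - {e'}) (w j) (w l)"
      using delete_partner[of e' j] nbA ci by metis
    have "w l z = w l e" using same_kernelD[OF l(3), of z e] z jz T ci nbA by auto
    moreover have "l = i \<or> l = k" using J_three[of i j k l] l ci ck cj by auto
    ultimately show False using S z k by (auto simp: single_def)
  qed
  \<comment> \<open>Fusing preserves \<open>i\<close> away from \<open>e\<close>, but makes both
    other partitions different from \<open>w i\<close>, so the crossing of \<open>i\<close> has no
    partner.\<close>
  have lone: False if c: "config e i j" "config e i k" "config e j k"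
    and ij: "single e i \<or> w i e = w i e'" and j: "\<not> single e j" "w j e \<noteq> w j e'"
    and k: "\<not> single e k" "w k e \<noteq> w k e'" for i j k
  proof -
    note ci = configD[OF c(1)] and ck = configD[OF c(2)] and cj = configD[OF c(3)]
    note tr = fuse_trivial[OF ij]
    have "crossing_on (A - {e}) (fuse e e' (w i))" using crossing_on_cong[OF tr] ci by simp
    then obtain l where l: "l \<in> J" "l \<noteq> i"
      "same_kernel (A - {e}) (fuse e e' (w i)) (fuse e e' (w l))"
      using fuse_partner[OF nb] ci by metis
    have "same_kernel (A - {e}) (fuse e e' (w l)) (w i)"
      using same_kernel_trans[OF same_kernel_sym[OF l(3)] tr] .
    moreover have "l = j \<or> l = k" using J_three[of i j k l] l ci ck cj by auto
    ultimately show False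
      using fuse_differ_trivial[of e l i e'] nb c config_sym j k by blast
  qed
  \<comment> \<open>The fused partitions are pairwise different, so none could be matched; hence
    \<open>i\<close> and \<open>j\<close> both lose their crossings, against
    \<open>fuse_not_both_noncrossing\<close>.\<close>
  have others: False if c: "config e i j" "config e i k" "config e j k"
    and i: "\<not> single e i" "w i e \<noteq> w i e'" and j: "\<not> single e j" "w j e \<noteq> w j e'"
    and k: "\<not> single e k" "w k e \<noteq> w k e'" for i j k
  proof -
    note ci = configD[OF c(1)] and ck = configD[OF c(2)] and cj = configD[OF c(3)]
    have J3: "l = i \<or> l = j \<or> l = k" if "l \<in> J" for l
      using J_three[of i j k l] that ci ck cj by auto
    have nc: "\<not> crossing_on (A - {e}) (fuse e e' (w l))" if "l = i \<or> l = j" for l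
    proof
      assume "crossing_on (A - {e}) (fuse e e' (w l))"
      moreover have "l \<in> J" using ci that by auto
      ultimately obtain m where "m \<in> J" "m \<noteq> l"
        "same_kernel (A - {e}) (fuse e e' (w l)) (fuse e e' (w m))"
        using fuse_partner[OF nb, of l] by blast
      moreover have "config e l m" using that J3[of m] calculation c config_sym by auto
      ultimately show False
        using fuse_differ[OF _ nb] that J3[of m] i j k by blast
    qed
    from fuse_not_both_noncrossing[OF c(1) nc nb] nc show False by blast
  qed
  let ?S = "\<lambda>i. single e i" and ?T = "\<lambda>i. w i e = w i e'"
  have cs: "config e j i" "config e k i" "config e k j"
    using assms cjk config_sym by auto
  have SS: "\<not> (?S i \<and> ?S j)" "\<not> (?S i \<and> ?S k)" "\<not> (?S j \<and> ?S k)"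
    using config_not_both_single assms cjk by blast+
  have TT: "\<not> (?T i \<and> ?T j)" "\<not> (?T i \<and> ?T k)" "\<not> (?T j \<and> ?T k)"
    using config_disjoint[OF _ e'] assms(1,2) cjk by metis+
  have ST': "\<not> (?S i \<and> ?T j)" "\<not> (?S i \<and> ?T k)" "\<not> (?S j \<and> ?T i)" "\<not> (?S j \<and> ?T k)"
    "\<not> (?S k \<and> ?T i)" "\<not> (?S k \<and> ?T j)"
    using ST[of i j k] ST[of i k j] ST[of j i k] ST[of j k i] ST[of k i j] ST[of k j i] assms cjk cs
    by blast+
  show False
    using lone[of i j k] lone[of j i k] lone[of k i j] others[of i j k] assms(1,2) cjk cs SS TT ST'
    by blast
qed

text \<open>Deleting \<open>e\<close> gives \<open>N * \<alpha> i + \<alpha> j = 0\<close>, whereas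
  a fusion matching exactly \<open>i\<close> and \<open>j\<close> would give
  \<open>\<alpha> i + \<alpha> j = 0\<close>. For \<open>N \<ge> 2\<close> a third partition
  \<open>k\<close> must therefore fuse to \<open>w i\<close> at both neighbours of \<open>e\<close>,
  which puts these neighbours into one block of \<open>i\<close> and of \<open>j\<close>. Deleting a
  point from \<open>k\<close> and looking for its partner then gives the contradiction.\<close>

lemma no_single_config:
  assumes cfg: "config e i j" and S: "single e i"
  shows False
proof -
  note c = configD[OF cfg]
  have nSj: "\<not> single e j" using config_not_both_single[OF cfg S] .
  have third: "l = i \<or> l = j" if "l \<in> J" "same_kernel (A - {e}) (w i) (w l)" for l
  proof (rule ccontr)
    assume "\<not> ?thesis"
    then have "config e i l" using that c unfolding config_def by auto
    with no_triple_config[OF cfg] \<open>\<not> ?thesis\<close> show False by auto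
  qed
  have fuse_third: "\<exists>k\<in>J. k \<noteq> i \<and> k \<noteq> j \<and> same_kernel (A - {e}) (fuse e e' (w k)) (w i)"
    if nb: "neighbours A e e'" for e'
  proof -
    have e': "e' \<in> A - {e}" using nb by (auto simp: neighbours_def)
    have tr: "same_kernel (A - {e}) (fuse e e' (w i)) (w i)" using fuse_trivial S by blast
    then have cr: "crossing_on (A - {e}) (fuse e e' (w i))" using crossing_on_cong c by blast
    let ?K = "{l. l \<in> J \<and> same_kernel (A - {e}) (fuse e e' (w i)) (fuse e e' (w l))}"
    have "?K \<noteq> {i, j}"
    proof
      assume K: "?K = {i, j}"
      then have "same_kernel (A - {e}) (fuse e e' (w i)) (fuse e e' (w j))" by blast
      then have "same_kernel (A - {e}) (fuse e e' (w j)) (w i)"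
        using tr same_kernel_sym same_kernel_trans by blast
      then have T: "w j e = w j e'"
        using fuse_differ_trivial[of e j i e'] nb cfg config_sym nSj by blast
      have "{l. l \<in> J \<and> same_kernel (A - {e}) (w i) (w l)} = {i, j}"
        using third c by auto
      with delete[OF c(1,2,6)] c(4)
      have "\<alpha> i * delete_weight N A e (w i) + \<alpha> j * delete_weight N A e (w j) = 0" by simp
      moreover have "delete_weight N A e (w i) = of_nat N" "delete_weight N A e (w j) = 1"
        using S T e' unfolding delete_weight_def single_def by auto
      ultimately have "\<alpha> i * of_nat N + \<alpha> j = 0" by simp
      moreover have "\<alpha> i + \<alpha> j = 0" using fuse[OF nb c(2) cr] K c(4) by simp
      ultimately have "\<alpha> i * (of_nat N - 1) = 0" by (simp add: right_diff_distrib add_eq_0_iff)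
      with nonzero[OF c(2)] N show False by (simp add: of_nat_eq_1_iff)
    qed
    moreover have "?K \<noteq> {i}" using fuse_partner[OF nb c(2) cr] by blast
    moreover have "i \<in> ?K" using c by simp
    ultimately have "\<not> ?K \<subseteq> {i, j}" by blast
    then obtain k where "k \<in> ?K" "k \<noteq> i" "k \<noteq> j" by blast
    then show ?thesis using tr same_kernel_sym same_kernel_trans by blast
  qed
  obtain e1 e2 where nb: "neighbours A e e1" "neighbours A e e2" "e1 \<noteq> e2"
    using two_neighbours c by blast
  have e12: "e1 \<in> A - {e}" "e2 \<in> A - {e}" using nb by (auto simp: neighbours_def)
  obtain k where k: "k \<in> J" "k \<noteq> i" "k \<noteq> j" "same_kernel (A - {e}) (fuse e e1 (w k)) (w i)"
    using fuse_third[OF nb(1)] by blast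
  have J3: "l = i \<or> l = j \<or> l = k" if "l \<in> J" for l using J_three[of i j k l] that c k by auto
  have k2: "same_kernel (A - {e}) (fuse e e2 (w k)) (w i)"
    using fuse_third[OF nb(2)] J3 by blast
  have nk: "\<not> same_kernel (A - {e}) (w i) (w k)" using third[of k] k by blast
  have ntr: "\<not> (single e k \<or> w k e = w k f)" if "same_kernel (A - {e}) (fuse e f (w k)) (w i)" for f
    using fuse_trivial[of e k f] nk that same_kernel_sym same_kernel_trans by blast
  have nSk: "\<not> single e k" and ne1: "w k e \<noteq> w k e1" and ne2: "w k e \<noteq> w k e2"
    using ntr[OF k(4)] ntr[OF k2] by blast+
  \<comment> \<open>The rest of the block of \<open>e\<close> in \<open>w k\<close> is joined to
    \<open>e1\<close> by one fusion and to \<open>e2\<close> by the other, and both results are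
    \<open>w i\<close>.\<close>
  have merged: "w i z = w i e1" "w i z = w i e2" if "z \<in> A - {e}" "w k z = w k e" for z
    using same_kernelD[OF k(4) that(1) e12(1)] same_kernelD[OF k2 that(1) e12(2)] that
    by (auto simp: fuse_def)
  obtain z0 where z0: "z0 \<in> A - {e}" "w k z0 = w k e" using nSk by (auto simp: single_def)
  have i12: "w i e1 = w i e2" using merged[OF z0] by simp
  have j12: "w j e1 = w j e2" using same_kernelD[OF c(5) e12] i12 by simp
  have merged_j: "w j z = w j e1" if "z \<in> A - {e}" "w k z = w k e" for z
    using merged(1)[OF that] same_kernelD[OF c(5) that(1) e12(1)] by simp
  \<comment> \<open>If \<open>e\<close> and \<open>e1\<close> are separated in \<open>w j\<close>,
    the fused \<open>j\<close> has no partner, because \<open>i\<close> and \<open>k\<close> both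
    fuse to \<open>w i\<close>. So it loses its crossing, which must lie between the blocks of
    \<open>e1\<close> and \<open>e\<close>.\<close>
  have quad: thesis if "w j e \<noteq> w j e1" "\<And>a c b d. \<lbrakk>a \<in> A - {e}; c \<in> A - {e}; b \<in> A - {e};
      d \<in> A - {e}; chords_cross a c b d; w j a = w j e1; w j c = w j e1; w j b = w j e; w j d = w j e\<rbrakk> \<Longrightarrow> thesis" for thesis
  proof -
    have "\<not> crossing_on (A - {e}) (fuse e e1 (w j))"
    proof
      assume "crossing_on (A - {e}) (fuse e e1 (w j))"
      then obtain l where l: "l \<in> J" "l \<noteq> j"
        "same_kernel (A - {e}) (fuse e e1 (w j)) (fuse e e1 (w l))"
        using fuse_partner[OF nb(1) c(3)] by blast
      then have "same_kernel (A - {e}) (fuse e e1 (w l)) (w i)"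
        using J3[OF l(1)] k fuse_trivial S by blast
      then show False
        using same_kernel_trans[OF l(3)] fuse_differ_trivial[of e j i e1] cfg config_sym nb(1) nSj that(1) by blast
    qed
    from fuse_noncrossingE[OF this c(7)] show thesis using that(2) by metis
  qed
  obtain e3 where e3: "e3 \<in> A" "crossing_on (A - {e3}) (w k)"
    using crossing_on_delete_exists[OF crossing[OF k(1)] finite_A card_A] by blast
  obtain l where l: "l \<in> J" "l \<noteq> k" "same_kernel (A - {e3}) (w k) (w l)"
    using delete_partner[OF e3(1) k(1) e3(2)] by blast
  have "e3 \<noteq> e"
  proof
    assume "e3 = e"
    with l have "same_kernel (A - {e}) (w i) (w k)"
      using J3[OF l(1)] c(5) same_kernel_sym same_kernel_trans by blast
    with nk show False by blast
  qed
  then have eA: "e \<in> A - {e3}" using c by auto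
  from J3[OF l(1)] l(2) consider "l = i" | "l = j" by blast
  then show False
  proof cases
    case 1
    \<comment> \<open>Since \<open>e\<close> is a singleton of \<open>i\<close>, agreement of
      \<open>k\<close> with \<open>i\<close> away from \<open>e3\<close> leaves
      \<open>{e, e3}\<close> as the block of \<open>e\<close> in \<open>w k\<close>.\<close>
    have "z = e3" if "z \<in> A - {e}" "w k z = w k e" for z
      using same_kernelD[OF l(3), of z e] that eA S 1 by (auto simp: single_def)
    with z0 have z3: "e3 \<in> A - {e}" "w k e3 = w k e" by auto
    have ne3: "e3 \<noteq> e1" "e3 \<noteq> e2" using z3 ne1 ne2 by auto
    show False
    proof (cases "w j e = w j e1")
      case False
      then obtain a c' b d where q: "a \<in> A - {e}" "c' \<in> A - {e}" "b \<in> A - {e}"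
        "d \<in> A - {e}" "chords_cross a c' b d" "w j a = w j e1" "w j c' = w j e1" "w j b = w j e" "w j d = w j e"
        using quad by metis
      \<comment> \<open>Deleting \<open>e1\<close> keeps a crossing of \<open>i\<close>, but no
        partner is possible: \<open>e\<close> stays joined to \<open>b\<close> in \<open>j\<close>
        and to \<open>e3\<close> in \<open>k\<close>, while it is a singleton of
        \<open>i\<close>.\<close>
      have "crossing_on (A - {e, e1}) (w i)"
        using crossing_on_delete_second_neighbour[OF nb i12 c(6)] .
      then have "crossing_on (A - {e1}) (w i)" by (rule crossing_on_mono) auto
      then obtain m where m: "m \<in> J" "m \<noteq> i" "same_kernel (A - {e1}) (w i) (w m)"
        using delete_partner[of e1 i] e12 c by blast
      from J3[OF m(1)] m(2) consider "m = j" | "m = k" by blast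
      then show False
      proof cases
        case 1
        have "b \<noteq> e1" using q False by auto
        then have "w i b = w i e" using same_kernelD[OF m(3), of b e] 1 q c(1) e12 by auto
        with S q show False by (auto simp: single_def)
      next
        case 2
        then have "w i e3 = w i e" using same_kernelD[OF m(3), of e3 e] z3 c(1) ne3 e12 by auto
        with S z3 show False by (auto simp: single_def)
      qed
    next
      case True
      \<comment> \<open>Now all three partitions fuse to the same one, so the three coefficients sum
        to zero. Deleting \<open>e3\<close> matches \<open>k\<close> with \<open>i\<close> only,
        both with weight 1, which leaves \<open>\<alpha> j = 0\<close>.\<close>
      have "same_kernel (A - {e}) (fuse e e1 (w i)) (w i)" "same_kernel (A - {e}) (fuse e e1 (w j)) (w j)"
        using fuse_trivial S True by blast+
      then have "same_kernel (A - {e}) (fuse e e1 (w i)) (fuse e e1 (w l))" if "l \<in> J" for l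
        using J3[OF that] k(4) c(5) same_kernel_sym same_kernel_trans same_kernel_refl by metis
      then have "{l. l \<in> J \<and> same_kernel (A - {e}) (fuse e e1 (w i)) (fuse e e1 (w l))} = {i, j, k}"
        using J3 c k by blast
      moreover have "crossing_on (A - {e}) (fuse e e1 (w i))"
        using \<open>same_kernel (A - {e}) (fuse e e1 (w i)) (w i)\<close> c crossing_on_cong by blast
      ultimately have sum3: "\<alpha> i + \<alpha> j + \<alpha> k = 0"
        using fuse[OF nb(1) c(2)] c(4) k by (simp add: add.assoc)
      have ck: "config e3 k i" using e3 l 1 c k unfolding config_def by auto
      have "\<not> same_kernel (A - {e3}) (w k) (w j)"
      proof
        assume "same_kernel (A - {e3}) (w k) (w j)"
        then have "config e3 k j" using ck c k unfolding config_def by auto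
        with no_triple_config[OF ck] c(4) show False by auto
      qed
      then have "{l. l \<in> J \<and> same_kernel (A - {e3}) (w k) (w l)} = {k, i}"
        using J3 c(2) k(1) l(3)[unfolded 1] same_kernel_refl[of "A - {e3}" "w k"] by blast
      with delete[OF e3(1) k(1) e3(2)] k(2)
      have "\<alpha> k * delete_weight N A e3 (w k) + \<alpha> i * delete_weight N A e3 (w i) = 0" by simp
      moreover have "delete_weight N A e3 (w k) = 1"
        using z3 eA unfolding delete_weight_def by auto
      moreover have "delete_weight N A e3 (w i) = 1"
        using merged(1)[OF z3] ne3 e12 unfolding delete_weight_def by auto
      ultimately have "\<alpha> i + \<alpha> k = 0" by (simp add: add.commute)
      moreover have "\<alpha> j = (\<alpha> i + \<alpha> j + \<alpha> k) - (\<alpha> i + \<alpha> k)" by simp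
      ultimately have "\<alpha> j = 0" using sum3 by simp
      with nonzero[OF c(3)] show False by simp
    qed
  next
    case 2
    show False
    proof (cases "w j e = w j e1")
      case True
      \<comment> \<open>At least one neighbour survives the deletion of \<open>e3\<close>. It is
        joined to \<open>e\<close> in \<open>w j\<close>, but separated from it in
        \<open>w k\<close>.\<close>
      obtain f where f: "f \<in> {e1, e2}" "f \<noteq> e3" using nb by auto
      then have "w j f = w j e" "f \<in> A - {e3}" using True j12 e12 by auto
      with same_kernelD[OF l(3) _ eA, of f] 2 f ne1 ne2 show False by auto
    next
      case False
      then obtain a c' b d where q: "a \<in> A - {e}" "c' \<in> A - {e}" "b \<in> A - {e}"
        "d \<in> A - {e}" "chords_cross a c' b d" "w j a = w j e1" "w j c' = w j e1" "w j b = w j e" "w j d = w j e"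
        using quad by metis
      \<comment> \<open>One of the two points \<open>b\<close>, \<open>d\<close> differs from
        \<open>e3\<close>, hence is joined to \<open>e\<close> in \<open>w k\<close> as well;
        \<open>merged_j\<close> then moves it to the block of \<open>e1\<close> in
        \<open>w j\<close>.\<close>
      have "b \<noteq> d" using chords_cross_distinct[OF q(5)] by simp
      then obtain y where y: "y \<in> A - {e}" "w j y = w j e" "y \<noteq> e3" using q by metis
      then have "w k y = w k e" using same_kernelD[OF l(3) _ eA, of y] 2 by auto
      with merged_j[OF y(1)] y False show False by simp
    qed
  qed
qed

text \<open>Fusing leaves \<open>j\<close> unchanged away from \<open>e\<close>, so \<open>j\<close>
  has a partner \<open>k\<close>, which cannot be \<open>i\<close>. Deleting \<open>e'\<close> also
  keeps a crossing of \<open>j\<close>, with \<open>e\<close> in place of \<open>e'\<close>, and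
  again only \<open>k\<close> can match. With singletons and triples already excluded, these two
  agreements are incompatible.\<close>

lemma no_fused_config:
  assumes cfg: "config e i j" and nb: "neighbours A e e'" and T: "w j e = w j e'"
  shows False
proof -
  note c = configD[OF cfg]
  have e': "e' \<in> A - {e}" using nb by (auto simp: neighbours_def)
  have nS: "\<not> single e i" using no_single_config[OF cfg] by blast
  have nT: "w i e \<noteq> w i e'" using config_disjoint[OF cfg e'] T by auto
  have tr: "same_kernel (A - {e}) (fuse e e' (w j)) (w j)" using fuse_trivial T by blast
  then have "crossing_on (A - {e}) (fuse e e' (w j))" using crossing_on_cong c by blast
  then obtain k where k: "k \<in> J" "k \<noteq> j" "same_kernel (A - {e}) (fuse e e' (w j)) (fuse e e' (w k))"
    using fuse_partner[OF nb c(3)] by blast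
  have kj: "same_kernel (A - {e}) (fuse e e' (w k)) (w j)"
    using k(3) tr same_kernel_sym same_kernel_trans by blast
  have nd: "\<not> same_kernel (A - {e}) (fuse e e' (w i)) (w j)"
    using fuse_differ_trivial[OF cfg nb nS nT] .
  have ki: "k \<noteq> i" using kj nd by blast
  have J3: "l = i \<or> l = j \<or> l = k" if "l \<in> J" for l using J_three[of i j k l] that c k ki by auto
  have "\<not> crossing_on (A - {e}) (fuse e e' (w i))"
  proof
    assume "crossing_on (A - {e}) (fuse e e' (w i))"
    then obtain l where l: "l \<in> J" "l \<noteq> i" "same_kernel (A - {e}) (fuse e e' (w i)) (fuse e e' (w l))"
      using fuse_partner[OF nb c(2)] by blast
    then have "same_kernel (A - {e}) (fuse e e' (w l)) (w j)" using J3[of l] kj tr by blast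
    with l(3) nd same_kernel_trans show False by blast
  qed
  from fuse_noncrossingE[OF this c(6)] obtain a c' b d where
    q: "a \<in> A - {e}" "c' \<in> A - {e}" "b \<in> A - {e}" "d \<in> A - {e}" "chords_cross a c' b d"
    "w i a = w i e'" "w i c' = w i e'" by metis
  \<comment> \<open>This gives a second point \<open>y\<close> in the block of \<open>e'\<close> in
    \<open>w i\<close>. It is joined to \<open>e\<close> in \<open>w j\<close> but not in
    \<open>w i\<close>, so \<open>i\<close> is not the partner of \<open>j\<close> after deleting
    \<open>e'\<close>.\<close>
  have "a \<noteq> c'" using chords_cross_distinct[OF q(5)] by simp
  then obtain y where y: "y \<in> A - {e}" "y \<noteq> e'" "w i y = w i e'" using q by metis
  have jy: "w j y = w j e" using same_kernelD[OF c(5) y(1) e'] y T by simp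
  have cr: "crossing_on (A - {e'}) (w j)"
    using crossing_on_delete_neighbour[of A e' e "w j"] nb T crossing[OF c(3)]
    by (simp add: neighbours_commute)
  then obtain l where l: "l \<in> J" "l \<noteq> j" "same_kernel (A - {e'}) (w j) (w l)"
    using delete_partner[of e' j] e' c by blast
  have "l \<noteq> i" using same_kernelD[OF l(3), of y e] jy y nT c(1) e' by auto
  then have lk: "l = k" using J3[OF l(1)] l(2) by blast
  then have "config e' k j" using cr crossing_on_cong[OF l(3)] l e' c k(1) same_kernel_sym
    unfolding config_def by blast
  then have "\<not> single e' k" using no_single_config by blast
  then obtain z where z: "z \<in> A - {e'}" "w k z = w k e'" by (auto simp: single_def)
  have nk: "w k e \<noteq> w k e'"
  proof
    assume "w k e = w k e'"
    then have "same_kernel (A - {e}) (w k) (w j)"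
      using fuse_trivial[of e k e'] kj same_kernel_sym same_kernel_trans by blast
    then have "config e j k" using cfg c k crossing_on_cong same_kernel_sym unfolding config_def by blast
    with no_triple_config[of e j i k] cfg config_sym ki show False by blast
  qed
  \<comment> \<open>The agreement after fusing joins \<open>z\<close> to \<open>e\<close> in
    \<open>w j\<close>; the agreement after deleting \<open>e'\<close> carries this over to
    \<open>w k\<close>, where \<open>z\<close> lies in the block of \<open>e'\<close> and not in
    that of \<open>e\<close>.\<close>
  have "z \<in> A - {e}" using z nk by auto
  moreover have "fuse e e' (w k) z = fuse e e' (w k) e'" using z by (simp add: fuse_def)
  ultimately have "w j z = w j e" using same_kernelD[OF kj _ e'] T by simp
  then have "w k z = w k e" using same_kernelD[OF l(3), of z e] z c(1) e' lk by auto
  with z nk show False by simp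
qed

theorem J_empty: "J = {}"
proof (rule ccontr)
  assume "J \<noteq> {}"
  then obtain i where i: "i \<in> J" by blast
  obtain e where e: "e \<in> A" "crossing_on (A - {e}) (w i)"
    using crossing_on_delete_exists[OF crossing[OF i] finite_A card_A] by blast
  obtain j where j: "j \<in> J" "j \<noteq> i" "same_kernel (A - {e}) (w i) (w j)"
    using delete_partner[OF e(1) i e(2)] by blast
  obtain e1 e2 where nb: "neighbours A e e1" "neighbours A e e2" "e1 \<noteq> e2"
    using two_neighbours e by blast
  have e12: "e1 \<in> A - {e}" "e2 \<in> A - {e}" using nb by (auto simp: neighbours_def)
  have cfg: "config e i j" using e i j unfolding config_def by auto
  have O: "\<not> single e l" "w l e \<noteq> w l e1" "w l e \<noteq> w l e2" if "config e l m" for l m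
    using no_single_config that no_fused_config[of e m l] nb config_sym by blast+
  \<comment> \<open>If both fused partitions crossed, each would need a partner. Being different,
    both would be matched by the one remaining partition, which makes them equal.\<close>
  have one: "\<not> crossing_on (A - {e}) (fuse e f (w i)) \<or> \<not> crossing_on (A - {e}) (fuse e f (w j))"
    if f: "f = e1 \<or> f = e2" for f
  proof (rule ccontr)
    assume "\<not> ?thesis"
    then have cr: "crossing_on (A - {e}) (fuse e f (w i))" "crossing_on (A - {e}) (fuse e f (w j))" by auto
    have nbf: "neighbours A e f" using f nb by blast
    have nd: "\<not> same_kernel (A - {e}) (fuse e f (w i)) (fuse e f (w j))"
      using fuse_differ[OF cfg nbf] O[OF cfg] O[OF cfg[unfolded config_sym[of e i]]] f by blast
    obtain k where k: "k \<in> J" "k \<noteq> i" "same_kernel (A - {e}) (fuse e f (w i)) (fuse e f (w k))"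
      using fuse_partner[OF nbf i cr(1)] by blast
    obtain l where l: "l \<in> J" "l \<noteq> j" "same_kernel (A - {e}) (fuse e f (w j)) (fuse e f (w l))"
      using fuse_partner[OF nbf j(1) cr(2)] by blast
    have "k \<noteq> j" "l \<noteq> i" using k l nd same_kernel_sym by blast+
    then have "k = l" using J_three[of i j k l] i j k l by auto
    with k l nd same_kernel_sym same_kernel_trans show False by blast
  qed
  \<comment> \<open>The crossing of \<open>j\<close> lost by fusing with \<open>e1\<close> lies
    between the blocks of \<open>e1\<close> and \<open>e\<close>. The loss at \<open>e2\<close>
    forces \<open>e1\<close> and \<open>e2\<close> into one block, so deleting \<open>e1\<close>
    keeps crossings of both \<open>i\<close> and \<open>j\<close>, and the pigeonhole argument
    applies once more.\<close>
  have main: False if cfg: "config e i j"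
    and nc: "\<not> crossing_on (A - {e}) (fuse e e1 (w j))"
    and one: "\<not> crossing_on (A - {e}) (fuse e e2 (w i)) \<or> \<not> crossing_on (A - {e}) (fuse e e2 (w j))"
    for i j
  proof -
    note c = configD[OF cfg]
    note Oi = O[OF cfg] and Oj = O[OF cfg[unfolded config_sym[of e i]]]
    from fuse_noncrossingE[OF nc c(7)] obtain a c' b d where
      q: "a \<in> A - {e}" "c' \<in> A - {e}" "b \<in> A - {e}" "d \<in> A - {e}" "chords_cross a c' b d"
      "w j a = w j e1" "w j c' = w j e1" "w j b = w j e" "w j d = w j e" by metis
    note sk = same_kernelD[OF c(5)]
    have qi: "w i a = w i c'" "w i b = w i d" "w i a \<noteq> w i b" "w i a = w i e1"
      using sk[of a c'] sk[of b d] sk[of a b] sk[of a e1] q e12 Oj by auto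
    have j12: "w j e1 = w j e2"
    proof (cases "crossing_on (A - {e}) (fuse e e2 (w j))")
      case False
      from fuse_noncrossing[OF False q(1-5)] q Oj show ?thesis by auto
    next
      case True
      \<comment> \<open>This case is contradictory: the same four points cross in \<open>i\<close>,
        where neither of the two crossing blocks contains \<open>e\<close>, so fusing with
        \<open>e2\<close> cannot destroy that crossing.\<close>
      with one have nci: "\<not> crossing_on (A - {e}) (fuse e e2 (w i))" by blast
      have "w i b \<noteq> w i e" using config_disjoint[OF cfg q(3)] q by blast
      with fuse_noncrossing[OF nci q(1-5)] qi Oi show ?thesis by auto
    qed
    have i12: "w i e1 = w i e2" using sk[of e1 e2] e12 j12 by simp
    have cr: "crossing_on (A - {e1}) (w i)" "crossing_on (A - {e1}) (w j)"
      using crossing_on_delete_second_neighbour[OF nb i12 c(6)]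
        crossing_on_delete_second_neighbour[OF nb j12 c(7)]
      by (auto elim!: crossing_on_mono)
    have nij: "\<not> same_kernel (A - {e1}) (w i) (w j)"
    proof
      assume s: "same_kernel (A - {e1}) (w i) (w j)"
      have "b \<noteq> e1" using q Oj by auto
      then have "w i b = w i e" using same_kernelD[OF s, of b e] q c(1) e12 by auto
      with config_disjoint[OF cfg q(3)] q show False by blast
    qed
    obtain k where k: "k \<in> J" "k \<noteq> i" "same_kernel (A - {e1}) (w i) (w k)"
      using delete_partner[OF _ c(2) cr(1)] e12 by blast
    obtain l where l: "l \<in> J" "l \<noteq> j" "same_kernel (A - {e1}) (w j) (w l)"
      using delete_partner[OF _ c(3) cr(2)] e12 by blast
    have "k \<noteq> j" "l \<noteq> i" using k l nij same_kernel_sym by blast+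
    then have "k = l" using J_three[of i j k l] c k l by auto
    with k l nij same_kernel_sym same_kernel_trans show False by blast
  qed
  show False
    using main[OF cfg _ one[of e2]] main[of j i] cfg one[of e1] one[of e2] config_sym by blast
qed

end

section \<open>Matrices as functions of words\<close>

definition words :: "nat \<Rightarrow> nat \<Rightarrow> nat list set" where
  "words N n = {xs. set xs \<subseteq> {..<N} \<and> length xs = n}"

definition digits :: "nat \<Rightarrow> nat \<Rightarrow> nat \<Rightarrow> nat list" where
  "digits N n i = map (digit N n i) [1..<Suc n]"

text \<open>Entries are given as functions of multi-indices, so that Kronecker and matrix products
  become concatenation of words and summation over words.\<close>

definition fmat :: "nat \<Rightarrow> nat \<Rightarrow> nat \<Rightarrow> (nat list \<Rightarrow> nat list \<Rightarrow> complex) \<Rightarrow> complex mat" where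
  "fmat N k l f = mat (N ^ l) (N ^ k) (\<lambda>(i, j). f (digits N l i) (digits N k j))"

lemma finite_words [simp, intro]: "finite (words N n)"
  unfolding words_def by (rule finite_lists_length_eq) simp

lemma card_words: "card (words N n) = N ^ n"
  unfolding words_def by (simp add: card_lists_length_eq)

lemma words_0 [simp]: "words N 0 = {[]}"
  unfolding words_def by auto

lemma wordsD: "u \<in> words N n \<Longrightarrow> length u = n" "u \<in> words N n \<Longrightarrow> i < n \<Longrightarrow> u ! i < N"
  unfolding words_def by (auto dest: nth_mem)

lemma words_Suc: "words N (Suc n) = (\<lambda>(a, u). a # u) ` ({..<N} \<times> words N n)"
  unfolding words_def by (auto simp: image_iff length_Suc_conv)

lemma words_Cons_iff [simp]: "a # u \<in> words N (Suc n) \<longleftrightarrow> a < N \<and> u \<in> words N n"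
  unfolding words_def by auto

lemma words_append: "u \<in> words N m \<Longrightarrow> v \<in> words N n \<Longrightarrow> u @ v \<in> words N (m + n)"
  unfolding words_def by auto

lemma words_rev: "rev u \<in> words N n \<longleftrightarrow> u \<in> words N n"
  unfolding words_def by auto

lemma words_rotate1: "rotate1 u \<in> words N n \<longleftrightarrow> u \<in> words N n"
  unfolding words_def by auto

lemma words_take: "u \<in> words N (m + n) \<Longrightarrow> take m u \<in> words N m"
  and words_drop: "u \<in> words N (m + n) \<Longrightarrow> drop m u \<in> words N n"
  unfolding words_def by (auto dest: in_set_takeD in_set_dropD)

lemma sum_words_Suc: "(\<Sum>w\<in>words N (Suc n). F w) = (\<Sum>a<N. \<Sum>w\<in>words N n. F (a # w))"
  unfolding words_Suc
  by (subst sum.reindex) (auto simp: inj_on_def sum.cartesian_product split_def intro!: sum.cong)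

lemma sum_delta_mult:
  fixes F :: "'a \<Rightarrow> 'b::semiring_1"
  assumes "finite A" "a \<in> A"
  shows "(\<Sum>x\<in>A. (if a = x then 1 else 0) * F x) = F a"
  using assms by (simp add: if_distrib[of "\<lambda>c. c * _"] cong: if_cong)

lemma length_digits [simp]: "length (digits N n i) = n"
  by (simp add: digits_def)

lemma digits_nth: "x < n \<Longrightarrow> digits N n i ! x = digit N n i (Suc x)"
  by (simp add: digits_def del: upt_Suc)

lemma digits_in_words: "0 < N \<Longrightarrow> digits N n i \<in> words N n"
  unfolding words_def digits_def by (auto simp: digit_def)

text \<open>Splitting off the last \<open>b\<close> digits is division with remainder by
  \<open>N ^ b\<close>; this is what makes \<open>kron\<close> concatenate multi-indices.\<close>

lemma digits_append:
  "digits N (a + b) i = digits N a (i div N ^ b) @ digits N b (i mod N ^ b)"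
proof (rule nth_equalityI)
  fix x assume x: "x < length (digits N (a + b) i)"
  show "digits N (a + b) i ! x = (digits N a (i div N ^ b) @ digits N b (i mod N ^ b)) ! x"
  proof (cases "x < a")
    case True
    then have "N ^ (a + b - Suc x) = N ^ b * N ^ (a - Suc x)"
      by (simp add: add.commute flip: power_add)
    with True x show ?thesis by (simp add: nth_append digits_nth digit_def div_mult2_eq)
  next
    case False
    then obtain y where y: "x = a + y" "y < b" using x by (metis le_add_diff_inverse length_digits nat_add_left_cancel_less not_less)
    define c where "c = b - Suc y"
    have b: "b = c + Suc y" using y by (simp add: c_def)
    have "(i mod N ^ b) div N ^ c mod N = i div N ^ c mod N"
    proof (cases "N = 0")
      case False
      have "i mod N ^ b = N ^ c * (i div N ^ c mod N ^ Suc y) + i mod N ^ c"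
        unfolding b power_add by (rule mod_mult2_eq)
      then have "(i mod N ^ b) div N ^ c = i div N ^ c mod N ^ Suc y"
        using False by simp
      then show ?thesis by (simp add: mod_mod_cancel)
    qed (use y in \<open>auto simp: b\<close>)
    moreover have "a + b - Suc x = c" using y by (simp add: c_def)
    ultimately show ?thesis using y by (simp add: nth_append digits_nth digit_def c_def)
  qed
qed simp

lemma digits_inj: "i < N ^ n \<Longrightarrow> j < N ^ n \<Longrightarrow> digits N n i = digits N n j \<Longrightarrow> i = j"
proof (induction n arbitrary: i j)
  case (Suc n)
  have 1: "digits N (Suc 0) (i mod N) = [i mod N]" for i by (simp add: digits_def digit_def)
  have "digits N (Suc n) i = digits N n (i div N) @ [i mod N]" for i
    using digits_append[of N n "Suc 0" i] by (simp add: 1)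
  with Suc.prems(3) have
    "digits N n (i div N) = digits N n (j div N)" "i mod N = j mod N"
    by simp_all
  moreover have "i div N < N ^ n" "j div N < N ^ n"
    using Suc.prems by (simp_all add: less_mult_imp_div_less mult.commute)
  ultimately show ?case using Suc.IH by (metis div_mult_mod_eq)
qed simp

text \<open>Injectivity suffices, as both sets have \<open>N ^ n\<close> elements.\<close>

lemma bij_betw_digits:
  assumes "0 < N" shows "bij_betw (digits N n) {..<N ^ n} (words N n)"
proof -
  have inj: "inj_on (digits N n) {..<N ^ n}" using digits_inj by (auto simp: inj_on_def)
  moreover have "digits N n ` {..<N ^ n} = words N n"
    by (rule card_subset_eq) (use digits_in_words[OF assms] inj in \<open>auto simp: card_image card_words\<close>)
  ultimately show ?thesis by (simp add: bij_betw_def)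
qed

lemma fmat_carrier [simp]: "fmat N k l f \<in> carrier_mat (N ^ l) (N ^ k)"
  "dim_row (fmat N k l f) = N ^ l" "dim_col (fmat N k l f) = N ^ k"
  by (simp_all add: fmat_def)

lemma fmat_cong:
  assumes "0 < N" "\<And>u v. u \<in> words N l \<Longrightarrow> v \<in> words N k \<Longrightarrow> f u v = g u v"
  shows "fmat N k l f = fmat N k l g"
  unfolding fmat_def by (rule cong_mat) (auto simp: assms digits_in_words)

lemma fmat_add: "fmat N k l f + fmat N k l g = fmat N k l (\<lambda>u v. f u v + g u v)"
  and fmat_smult: "c \<cdot>\<^sub>m fmat N k l f = fmat N k l (\<lambda>u v. c * f u v)"
  and fmat_zero: "0\<^sub>m (N ^ l) (N ^ k) = fmat N k l (\<lambda>u v. 0)"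
  by (auto simp: fmat_def)

lemma fmat_adjoint: "mat_adjoint (fmat N k l f) = fmat N l k (\<lambda>u v. cnj (f v u))"
  by (rule eq_matI) (auto simp: fmat_def mat_adjoint_def mat_of_rows_def)

lemma fmat_mult:
  assumes "0 < N"
  shows "fmat N l m g * fmat N k l f = fmat N k m (\<lambda>u v. \<Sum>w\<in>words N l. g u w * f w v)"
proof (rule eq_matI)
  fix i j assume "i < dim_row (fmat N k m (\<lambda>u v. \<Sum>w\<in>words N l. g u w * f w v))"
    "j < dim_col (fmat N k m (\<lambda>u v. \<Sum>w\<in>words N l. g u w * f w v))"
  then show "(fmat N l m g * fmat N k l f) $$ (i, j) =
      fmat N k m (\<lambda>u v. \<Sum>w\<in>words N l. g u w * f w v) $$ (i, j)"
    using sum.reindex_bij_betw[OF bij_betw_digits[OF assms, of l],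
        of "\<lambda>w. g (digits N m i) w * f w (digits N k j)"]
    by (simp add: fmat_def scalar_prod_def lessThan_atLeast0)
qed simp_all

lemma fmat_kron:
  "kron (fmat N k l f) (fmat N k' l' g) = fmat N (k + k') (l + l')
     (\<lambda>u v. f (take l u) (take k v) * g (drop l u) (drop k v))"
proof (rule eq_matI)
  fix i j
  assume "i < dim_row (fmat N (k + k') (l + l') (\<lambda>u v. f (take l u) (take k v) * g (drop l u) (drop k v)))"
    "j < dim_col (fmat N (k + k') (l + l') (\<lambda>u v. f (take l u) (take k v) * g (drop l u) (drop k v)))"
  then have ij: "i < N ^ l * N ^ l'" "j < N ^ k * N ^ k'" by (simp_all add: power_add)
  then have "i div N ^ l' < N ^ l" "j div N ^ k' < N ^ k" "i mod N ^ l' < N ^ l'" "j mod N ^ k' < N ^ k'"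
    by (auto simp: less_mult_imp_div_less intro!: mod_less_divisor gr0I)
  with ij show "kron (fmat N k l f) (fmat N k' l' g) $$ (i, j) = fmat N (k + k') (l + l')
      (\<lambda>u v. f (take l u) (take k v) * g (drop l u) (drop k v)) $$ (i, j)"
    by (simp add: kron_def fmat_def power_add digits_append)
qed (simp_all add: kron_def power_add)

lemma fmat_one: "1\<^sub>m (N ^ n) = fmat N n n (\<lambda>u v. if u = v then 1 else 0)"
  by (rule eq_matI) (auto simp: fmat_def dest: digits_inj)

lemma pairing_fmat:
  "mat 1 (N ^ 2) (\<lambda>(_, j). if digit N 2 j 1 = digit N 2 j 2 then 1 else 0) =
     fmat N 2 0 (\<lambda>u v. if v ! 0 = v ! 1 then 1 else 0)"
  by (rule eq_matI) (auto simp: fmat_def digits_nth numeral_2_eq_2)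

text \<open>Abstracts the spaces hom(0, n) of a Tannaka-Krein dual, with tensors as functions on
  words. Only planar moves are available: juxtaposition, rotation, and contraction of adjacent legs.
  Since functions take arbitrary lists, \<open>cong\<close> identifies those that agree on actual
  multi-indices.\<close>

locale planar =
  fixes N :: nat and V :: "nat \<Rightarrow> (nat list \<Rightarrow> complex) set"
  assumes N: "0 < N"
    and zero: "(\<lambda>_. 0) \<in> V n"
    and add: "f \<in> V n \<Longrightarrow> g \<in> V n \<Longrightarrow> (\<lambda>u. f u + g u) \<in> V n"
    and scale: "f \<in> V n \<Longrightarrow> (\<lambda>u. c * f u) \<in> V n"
    and cong: "f \<in> V n \<Longrightarrow> (\<And>u. u \<in> words N n \<Longrightarrow> f u = g u) \<Longrightarrow> g \<in> V n"
    and tensor: "f \<in> V m \<Longrightarrow> g \<in> V n \<Longrightarrow> (\<lambda>u. f (take m u) * g (drop m u)) \<in> V (m + n)"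
    and rotate1: "f \<in> V n \<Longrightarrow> (\<lambda>u. f (rotate1 u)) \<in> V n"
    and contract: "f \<in> V (Suc (Suc n)) \<Longrightarrow> (\<lambda>u. \<Sum>a<N. f (a # a # u)) \<in> V n"
    and pairing: "(\<lambda>u. if u ! 0 = u ! 1 then 1 else 0) \<in> V 2"

section \<open>Bending points: from a Tannaka-Krein dual to its vectors\<close>

locale tk_dual = tannaka_krein_dual + assumes N_pos: "0 < N"
begin

lemma hom_linear:
  "0\<^sub>m (N ^ l) (N ^ k) \<in> hom_C k l" "A \<in> hom_C k l \<Longrightarrow> B \<in> hom_C k l \<Longrightarrow> A + B \<in> hom_C k l"
  "A \<in> hom_C k l \<Longrightarrow> c \<cdot>\<^sub>m A \<in> hom_C k l"
  using hom_subspace[of k l] unfolding subspace_mat_iff by blast+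

lemma hom_id_1: "fmat N 1 1 (\<lambda>u v. if u = v then 1 else 0) \<in> hom_C 1 1"
  using hom_id fmat_one[of N 1] by simp

lemma hom_cap: "fmat N 2 0 (\<lambda>u v. if v ! 0 = v ! 1 then 1 else 0) \<in> hom_C 2 0"
  using hom_pairing unfolding pairing_fmat .

lemma hom_cup: "fmat N 0 2 (\<lambda>u v. if u ! 0 = u ! 1 then 1 else 0) \<in> hom_C 0 2"
proof -
  have "mat_adjoint (fmat N 2 0 (\<lambda>u v. if v ! 0 = v ! 1 then 1 else 0)) =
      fmat N 0 2 (\<lambda>u v. if u ! 0 = u ! 1 then 1 else 0)"
    unfolding fmat_adjoint by (rule fmat_cong) (simp_all add: N_pos)
  with hom_adjoint[OF hom_cap] show ?thesis by simp
qed

lemma hom_identity: "fmat N n n (\<lambda>u v. if u = v then 1 else 0) \<in> hom_C n n"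
proof (induction n)
  case 0
  let ?c = "\<lambda>w :: nat list. if w ! 0 = w ! 1 then 1 else 0 :: complex"
  \<comment> \<open>The axioms provide the identity only on one point. The empty diagram is obtained
    from a closed loop, cap after cup, by dividing by its value \<open>N > 0\<close>.\<close>
  have "(\<Sum>w\<in>words N 2. ?c w * ?c w) = (\<Sum>w\<in>words N 2. ?c w)" by (rule sum.cong) auto
  also have "\<dots> = of_nat N" by (simp add: numeral_2_eq_2 sum_words_Suc)
  finally have *: "(\<Sum>w\<in>words N 2. ?c w * ?c w) = of_nat N" .
  have "(1 / of_nat N) \<cdot>\<^sub>m (fmat N 2 0 (\<lambda>u v. if v ! 0 = v ! 1 then 1 else 0) *
      fmat N 0 2 (\<lambda>u v. if u ! 0 = u ! 1 then 1 else 0)) = fmat N 0 0 (\<lambda>u v. if u = v then 1 else 0)"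
    unfolding fmat_mult[OF N_pos] fmat_smult
    by (rule fmat_cong) (use N_pos in \<open>simp_all add: *[simplified]\<close>)
  moreover have "(1 / of_nat N) \<cdot>\<^sub>m (fmat N 2 0 (\<lambda>u v. ?c v) * fmat N 0 2 (\<lambda>u v. ?c u)) \<in> hom_C 0 0"
    by (rule hom_linear(3)[OF hom_comp[OF hom_cup hom_cap]])
  ultimately show ?case by simp
next
  case (Suc n)
  have "kron (fmat N n n (\<lambda>u v. if u = v then 1 else 0)) (fmat N 1 1 (\<lambda>u v. if u = v then 1 else 0))
      = fmat N (Suc n) (Suc n) (\<lambda>u v. if u = v then 1 else 0)"
    unfolding fmat_kron Suc_eq_plus1
  proof (rule fmat_cong)
    fix u v :: "nat list"
    have "take n u = take n v \<and> drop n u = drop n v \<longleftrightarrow> u = v" by (metis append_take_drop_id)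
    then show "(if take n u = take n v then 1 else 0) * (if drop n u = drop n v then 1 else 0) =
        (if u = v then 1 else (0 :: complex))" by auto
  qed (rule N_pos)
  with hom_tensor[OF Suc hom_id_1] show ?case by simp
qed

text \<open>The map \<open>g\<close> is placed next to one identity strand and its last lower point
  is capped with that strand, which turns it into a new rightmost upper point.\<close>

lemma hom_bend:
  assumes "fmat N k (Suc l) g \<in> hom_C k (Suc l)"
  shows "fmat N (Suc k) l (\<lambda>u v. g (u @ [last v]) (butlast v)) \<in> hom_C (Suc k) l"
proof -
  let ?id = "\<lambda>u v. if u = v then 1 else 0 :: complex"
  let ?cap = "\<lambda>u v :: nat list. if v ! 0 = v ! 1 then 1 else 0 :: complex"
  have "kron (fmat N l l ?id) (fmat N 2 0 ?cap) * kron (fmat N k (Suc l) g) (fmat N 1 1 ?id)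
      \<in> hom_C (k + 1) (l + 0)"
    by (rule hom_comp[OF hom_tensor[OF assms hom_id_1]])
      (use hom_tensor[OF hom_identity hom_cap, of l] in simp)
  also have "kron (fmat N l l ?id) (fmat N 2 0 ?cap) * kron (fmat N k (Suc l) g) (fmat N 1 1 ?id) =
      fmat N (Suc k) l (\<lambda>u v. g (u @ [last v]) (butlast v))"
    unfolding fmat_kron
  proof -
    have "fmat N (l + 2) (l + 0) (\<lambda>u v. ?id (take l u) (take l v) * ?cap (drop l u) (drop l v)) *
        fmat N (k + 1) (Suc l + 1) (\<lambda>u v. g (take (Suc l) u) (take k v) * ?id (drop (Suc l) u) (drop k v)) =
      fmat N (Suc k) l (\<lambda>u v. \<Sum>w\<in>words N (l + 2). ?id (take l u) (take l w) * ?cap (drop l u) (drop l w) *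
         (g (take (Suc l) w) (take k v) * ?id (drop (Suc l) w) (drop k v)))"
      using fmat_mult[OF N_pos, of "l + 2" "l + 0" _ "k + 1"] by simp
    also have "\<dots> = fmat N (Suc k) l (\<lambda>u v. g (u @ [last v]) (butlast v))"
    proof (rule fmat_cong)
      fix u v assume u: "u \<in> words N l" and v: "v \<in> words N (Suc k)"
      let ?F = "\<lambda>w. ?id (take l u) (take l w) * ?cap (drop l u) (drop l w) *
         (g (take (Suc l) w) (take k v) * ?id (drop (Suc l) w) (drop k v))"
      have lu: "length u = l" and lv: "length v = Suc k" using wordsD u v by blast+
      obtain v' x where vx: "v = v' @ [x]" "length v' = k"
        using lv by (metis append_butlast_last_id length_butlast diff_Suc_1 list.size(3) nat.distinct(1))
      have x: "x < N" using v vx by (auto simp: words_def)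
      have w0: "u @ [x, x] \<in> words N (l + 2)" using u x by (auto simp: words_def)
      have "?F w = 0" if w: "w \<in> words N (l + 2) - {u @ [x, x]}" for w
      proof (rule ccontr)
        assume nz: "?F w \<noteq> 0"
        then have 1: "take l u = take l w" "drop l w ! 0 = drop l w ! 1" "drop (Suc l) w = [x]"
          by (auto split: if_splits simp: vx)
        have lw: "length w = l + 2" using w wordsD by blast
        then have "w = take l w @ [w ! l, w ! Suc l]"
          by (intro nth_equalityI) (auto simp: nth_append nth_Cons' less_Suc_eq numeral_2_eq_2)
        moreover have "w ! Suc l = x" using 1(3) lw by (metis add_Suc_right less_add_Suc1 nth_via_drop one_add_one plus_1_eq_Suc)
        moreover have "w ! l = w ! Suc l" using 1(2) lw by simp
        ultimately have "w = u @ [x, x]" using 1(1) lu by simp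
        with w show False by simp
      qed
      then have "(\<Sum>w\<in>words N (l + 2). ?F w) = ?F (u @ [x, x])"
        using sum.mono_neutral_right[of "words N (l + 2)" "{u @ [x, x]}" ?F] w0 by auto
      then show "(\<Sum>w\<in>words N (l + 2). ?F w) = g (u @ [last v]) (butlast v)"
        using lu vx by simp
    qed (rule N_pos)
    finally show "fmat N (l + 2) (l + 0) (\<lambda>u v. ?id (take l u) (take l v) * ?cap (drop l u) (drop l v)) *
        fmat N (k + 1) (Suc l + 1) (\<lambda>u v. g (take (Suc l) u) (take k v) * ?id (drop (Suc l) u) (drop k v)) =
      fmat N (Suc k) l (\<lambda>u v. g (u @ [last v]) (butlast v))" .
  qed
  finally show ?thesis by simp
qed

text \<open>Bending the last \<open>k\<close> points one by one puts them on top in opposite order,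
  hence \<open>rev v\<close>.\<close>

lemma hom_bend_vector:
  assumes "fmat N 0 (l + k) (\<lambda>u v. f u) \<in> hom_C 0 (l + k)"
  shows "fmat N k l (\<lambda>u v. f (u @ rev v)) \<in> hom_C k l"
  using assms
proof (induction k arbitrary: l)
  case 0
  have "fmat N 0 l (\<lambda>u v. f (u @ rev v)) = fmat N 0 l (\<lambda>u v. f u)"
    by (rule fmat_cong) (simp_all add: N_pos)
  with 0 show ?case by simp
next
  case (Suc k)
  have "fmat N k (Suc l) (\<lambda>u v. f (u @ rev v)) \<in> hom_C k (Suc l)"
    using Suc.IH[of "Suc l"] Suc.prems by simp
  from hom_bend[OF this] have "fmat N (Suc k) l (\<lambda>u v. f ((u @ [last v]) @ rev (butlast v))) \<in> hom_C (Suc k) l" .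
  also have "fmat N (Suc k) l (\<lambda>u v. f ((u @ [last v]) @ rev (butlast v))) = fmat N (Suc k) l (\<lambda>u v. f (u @ rev v))"
  proof (rule fmat_cong)
    fix u v assume "v \<in> words N (Suc k)"
    then have "v \<noteq> []" by (auto simp: words_def)
    then obtain v' x where "v = v' @ [x]" by (cases v rule: rev_cases) auto
    then show "f ((u @ [last v]) @ rev (butlast v)) = f (u @ rev v)" by simp
  qed (rule N_pos)
  finally show ?case .
qed

definition vectors :: "nat \<Rightarrow> (nat list \<Rightarrow> complex) set" where
  "vectors n = {f. fmat N 0 n (\<lambda>u v. f u) \<in> hom_C 0 n}"

lemma planar_vectors: "planar N vectors"
proof
  show "0 < N" by (rule N_pos)
next
  fix n show "(\<lambda>_. 0) \<in> vectors n"
    using hom_linear(1)[of n 0] fmat_zero[of N n 0] by (simp add: vectors_def)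
next
  fix f g n assume "f \<in> vectors n" "g \<in> vectors n"
  then show "(\<lambda>u. f u + g u) \<in> vectors n"
    using hom_linear(2)[of "fmat N 0 n (\<lambda>u v. f u)" 0 n "fmat N 0 n (\<lambda>u v. g u)"]
    by (simp add: vectors_def fmat_add)
next
  fix f n c assume "f \<in> vectors n"
  then show "(\<lambda>u. c * f u) \<in> vectors n"
    using hom_linear(3)[of "fmat N 0 n (\<lambda>u v. f u)" 0 n c] by (simp add: vectors_def fmat_smult)
next
  fix f g n assume "f \<in> vectors n" "\<And>u. u \<in> words N n \<Longrightarrow> f u = g u"
  then show "g \<in> vectors n"
    using fmat_cong[OF N_pos, of n 0 "\<lambda>u v. f u" "\<lambda>u v. g u"] by (simp add: vectors_def)
next
  fix f g m n assume "f \<in> vectors m" "g \<in> vectors n"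
  then show "(\<lambda>u. f (take m u) * g (drop m u)) \<in> vectors (m + n)"
    using hom_tensor[of "fmat N 0 m (\<lambda>u v. f u)" 0 m "fmat N 0 n (\<lambda>u v. g u)" 0 n]
    by (simp add: vectors_def fmat_kron)
next
  fix f n assume f: "f \<in> vectors n"
  show "(\<lambda>u. f (rotate1 u)) \<in> vectors n"
  proof (cases n)
    case 0
    have "fmat N 0 0 (\<lambda>u v. f (rotate1 u)) = fmat N 0 0 (\<lambda>u v. f u)"
      by (rule fmat_cong) (simp_all add: N_pos)
    with f 0 show ?thesis by (simp add: vectors_def)
  next
    case (Suc m)
    let ?id = "\<lambda>u v. if u = v then 1 else 0 :: complex"
    let ?cup = "\<lambda>u v :: nat list. if u ! 0 = u ! 1 then 1 else 0 :: complex"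
    let ?g = "\<lambda>u v. f (u @ rev v)"
    have g: "fmat N 1 m ?g \<in> hom_C 1 m"
      using hom_bend_vector[of m 1 f] f Suc by (simp add: vectors_def)
    \<comment> \<open>Rotation by bending: the last leg of \<open>f\<close> is turned up, and a cup
      brings it down again on the far left.\<close>
    have "kron (fmat N 1 1 ?id) (fmat N 1 m ?g) * fmat N 0 2 ?cup \<in> hom_C 0 (1 + m)"
      by (rule hom_comp[OF hom_cup]) (use hom_tensor[OF hom_id_1 g] in \<open>simp add: numeral_2_eq_2\<close>)
    also have "kron (fmat N 1 1 ?id) (fmat N 1 m ?g) * fmat N 0 2 ?cup = fmat N 0 (1 + m)
        (\<lambda>u v. \<Sum>w\<in>words N 2. ?id (take 1 u) (take 1 w) * ?g (drop 1 u) (drop 1 w) * ?cup w v)"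
      using fmat_mult[OF N_pos, of 2 "1 + m" _ 0] by (simp add: fmat_kron numeral_2_eq_2)
    also have "\<dots> = fmat N 0 n (\<lambda>u v. f (rotate1 u))"
      unfolding Suc plus_1_eq_Suc
    proof (rule fmat_cong)
      fix u v assume "u \<in> words N (Suc m)" "v \<in> words N 0"
      then obtain a u' where u: "u = a # u'" "a < N"
        by (auto simp: words_Suc)
      have "(\<Sum>w\<in>words N 2. ?id (take 1 u) (take 1 w) * ?g (drop 1 u) (drop 1 w) * ?cup w v) =
          (\<Sum>x<N. \<Sum>y<N. if x = a \<and> y = x then f (u' @ [y]) else 0)"
        by (auto simp: numeral_2_eq_2 sum_words_Suc u intro!: sum.cong)
      also have "\<dots> = (\<Sum>x<N. if x = a then f (u' @ [x]) else 0)"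
        by (intro sum.cong refl) auto
      also have "\<dots> = f (rotate1 u)" using u by simp
      finally show "(\<Sum>w\<in>words N 2. ?id (take 1 u) (take 1 w) * ?g (drop 1 u) (drop 1 w) * ?cup w v) = f (rotate1 u)" .
    qed (rule N_pos)
    finally show ?thesis using Suc by (simp add: vectors_def)
  qed
next
  fix f n assume f: "f \<in> vectors (Suc (Suc n))"
  let ?id = "\<lambda>u v. if u = v then 1 else 0 :: complex"
  let ?cap = "\<lambda>u v :: nat list. if v ! 0 = v ! 1 then 1 else 0 :: complex"
  have "kron (fmat N 2 0 ?cap) (fmat N n n ?id) * fmat N 0 (Suc (Suc n)) (\<lambda>u v. f u) \<in> hom_C 0 (0 + n)"
    by (rule hom_comp[of _ _ "Suc (Suc n)"])
      (use f hom_tensor[OF hom_cap hom_identity, of n] in \<open>simp_all add: vectors_def\<close>)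
  also have "kron (fmat N 2 0 ?cap) (fmat N n n ?id) * fmat N 0 (Suc (Suc n)) (\<lambda>u v. f u) =
      fmat N 0 (0 + n) (\<lambda>u v. \<Sum>w\<in>words N (2 + n). ?cap (take 0 u) (take 2 w) * ?id (drop 0 u) (drop 2 w) * f w)"
    using fmat_mult[OF N_pos, of "2 + n" "0 + n" _ 0] by (simp add: fmat_kron)
  also have "\<dots> = fmat N 0 n (\<lambda>u v. \<Sum>a<N. f (a # a # u))"
    unfolding add_0_left
  proof (rule fmat_cong)
    fix u v assume u: "u \<in> words N n" "v \<in> words N 0"
    have "(\<Sum>w\<in>words N (2 + n). ?cap (take 0 u) (take 2 w) * ?id (drop 0 u) (drop 2 w) * f w) =
        (\<Sum>x<N. \<Sum>y<N. (if x = y then 1 else 0) * (\<Sum>w\<in>words N n. (if u = w then 1 else 0) * f (x # y # w)))"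
      by (simp add: numeral_2_eq_2 sum_words_Suc mult.assoc sum_distrib_left)
    also have "\<dots> = (\<Sum>x<N. \<Sum>y<N. (if x = y then 1 else 0) * f (x # y # u))"
      using u(1) by (simp add: sum_delta_mult)
    also have "\<dots> = (\<Sum>a<N. f (a # a # u))"
      by (intro sum.cong refl sum_delta_mult) auto
    finally show "(\<Sum>w\<in>words N (2 + n). ?cap (take 0 u) (take 2 w) * ?id (drop 0 u) (drop 2 w) * f w) =
        (\<Sum>a<N. f (a # a # u))" .
  qed (rule N_pos)
  finally show "(\<lambda>u. \<Sum>a<N. f (a # a # u)) \<in> vectors n" by (simp add: vectors_def)
next
  show "(\<lambda>u. if u ! 0 = u ! 1 then 1 else 0) \<in> vectors 2"
    using hom_cup by (simp add: vectors_def)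
qed

end

section \<open>Tannaka--Krein duals spanned by words\<close>

context planar
begin

lemma rotate: "f \<in> V n \<Longrightarrow> (\<lambda>u. f (rotate m u)) \<in> V n"
proof (induction m arbitrary: f)
  case (Suc m)
  from Suc.IH[OF rotate1[OF Suc.prems]] show ?case by simp
qed simp

text \<open>Rotation brings the two adjacent legs to the front, where \<open>contract\<close>
  applies, and a second rotation restores the order.\<close>

lemma contract_at:
  assumes "f \<in> V (m + Suc (Suc n))"
  shows "(\<lambda>u. \<Sum>a<N. f (take m u @ a # a # drop m u)) \<in> V (m + n)"
proof -
  from assms have "(\<lambda>u. f (rotate (Suc (Suc n)) u)) \<in> V (Suc (Suc (m + n)))"
    by (intro rotate) simp
  from rotate[OF contract[OF this], of m]
  have "(\<lambda>u. \<Sum>a<N. f (rotate (Suc (Suc n)) (a # a # rotate m u))) \<in> V (m + n)" .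
  then show ?thesis
  proof (rule cong)
    fix u assume "u \<in> words N (m + n)"
    then have l: "length u = m + n" by (rule wordsD)
    have r: "rotate m u = drop m u @ take m u"
      using rotate_append[of "take m u" "drop m u"] l by simp
    have "rotate (Suc (Suc n)) (a # a # rotate m u) = take m u @ a # a # drop m u" for a
      using rotate_append[of "a # a # drop m u" "take m u"] l unfolding r by simp
    then show "(\<Sum>a<N. f (rotate (Suc (Suc n)) (a # a # rotate m u))) =
        (\<Sum>a<N. f (take m u @ a # a # drop m u))" by simp
  qed
qed

text \<open>The pairs in \<open>rev w @ w\<close> are nested; they are contracted from the innermost
  outwards.\<close>

lemma contract_block:
  assumes "f \<in> V (m + 2 * l + n)"
  shows "(\<lambda>u. \<Sum>w\<in>words N l. f (take m u @ rev w @ w @ drop m u)) \<in> V (m + n)"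
  using assms
proof (induction l arbitrary: f)
  case 0
  then show ?case by simp
next
  case (Suc l)
  let ?g = "\<lambda>u. \<Sum>a<N. f (take (m + l) u @ a # a # drop (m + l) u)"
  have "m + 2 * Suc l + n = m + l + Suc (Suc (l + n))" by simp
  then have "?g \<in> V (m + l + (l + n))"
    using Suc.prems by (intro contract_at) (simp only:)
  moreover have "m + l + (l + n) = m + 2 * l + n" by simp
  ultimately have "?g \<in> V (m + 2 * l + n)" by (simp only:)
  from Suc.IH[OF this] show ?case
  proof (rule cong)
    fix u assume "u \<in> words N (m + n)"
    then have lu: "length u = m + n" by (rule wordsD)
    have "(\<Sum>w\<in>words N l. ?g (take m u @ rev w @ w @ drop m u)) =
        (\<Sum>w\<in>words N l. \<Sum>a<N. f (take m u @ rev (a # w) @ (a # w) @ drop m u))"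
      by (intro sum.cong refl) (use lu in \<open>auto dest: wordsD\<close>)
    also have "\<dots> = (\<Sum>w\<in>words N (Suc l). f (take m u @ rev w @ w @ drop m u))"
      unfolding sum_words_Suc by (rule sum.swap)
    finally show "(\<Sum>w\<in>words N l. ?g (take m u @ rev w @ w @ drop m u)) =
        (\<Sum>w\<in>words N (Suc l). f (take m u @ rev w @ w @ drop m u))" .
  qed
qed

end

text \<open>In bent form the adjoint is a reflection: conjugate entries and reversed order of the
  points.\<close>

locale planar_star = planar +
  assumes star: "f \<in> V n \<Longrightarrow> (\<lambda>u. cnj (f (rev u))) \<in> V n"

text \<open>Frobenius reciprocity: upper points are bent down on the right, which reverses their
  order, so spaces of vectors determine a full family of spaces of maps.\<close>

definition bent :: "nat \<Rightarrow> (nat \<Rightarrow> (nat list \<Rightarrow> complex) set) \<Rightarrow> hom_family" where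
  "bent N V k l = {fmat N k l (\<lambda>u v. f (u @ rev v)) | f. f \<in> V (l + k)}"

lemma bentI: "f \<in> V (l + k) \<Longrightarrow> A = fmat N k l (\<lambda>u v. f (u @ rev v)) \<Longrightarrow> A \<in> bent N V k l"
  unfolding bent_def by blast

theorem (in planar_star) tannaka_krein_dual_bent: "tannaka_krein_dual N (bent N V)"
proof (rule tannaka_krein_dual.intro)
  fix k l
  show "VectorSpace.subspace class_ring (bent N V k l) (mat_space (N ^ l) (N ^ k))"
    unfolding subspace_mat_iff
  proof (intro conjI ballI allI)
    show "bent N V k l \<subseteq> carrier_mat (N ^ l) (N ^ k)" by (auto simp: bent_def)
    show "0\<^sub>m (N ^ l) (N ^ k) \<in> bent N V k l"
      by (rule bentI[OF zero]) (simp add: fmat_zero)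
  next
    fix A B assume "A \<in> bent N V k l" "B \<in> bent N V k l"
    then obtain f g where "f \<in> V (l + k)" "g \<in> V (l + k)"
      "A = fmat N k l (\<lambda>u v. f (u @ rev v))" "B = fmat N k l (\<lambda>u v. g (u @ rev v))"
      unfolding bent_def by blast
    then show "A + B \<in> bent N V k l" by (intro bentI[OF add[of f _ g]]) (simp_all add: fmat_add)
  next
    fix c A assume "A \<in> bent N V k l"
    then obtain f where "f \<in> V (l + k)" "A = fmat N k l (\<lambda>u v. f (u @ rev v))"
      unfolding bent_def by blast
    then show "c \<cdot>\<^sub>m A \<in> bent N V k l" by (intro bentI[OF scale[of f _ c]]) (simp_all add: fmat_smult)
  qed
next
  fix A B k l k' l' assume "A \<in> bent N V k l" "B \<in> bent N V k' l'"
  then obtain f g where f: "f \<in> V (l + k)" and g: "g \<in> V (l' + k')"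
    and A: "A = fmat N k l (\<lambda>u v. f (u @ rev v))" and B: "B = fmat N k' l' (\<lambda>u v. g (u @ rev v))"
    unfolding bent_def by blast
  \<comment> \<open>The points of the tensor product are read as lower points of \<open>A\<close>,
    all points of \<open>B\<close>, upper points of \<open>A\<close>. Rotating the last group to the
    front makes the points of \<open>A\<close> contiguous; the inner \<open>rotate k\<close>
    restores their own order.\<close>
  let ?t = "\<lambda>u. f (rotate k (take (l + k) u)) * g (drop (l + k) u)"
  have "?t \<in> V ((l + k) + (l' + k'))" by (rule tensor[OF rotate[OF f] g])
  then have "(\<lambda>u. ?t (rotate (l + l' + k') u)) \<in> V ((l + l') + (k + k'))"
    by (intro rotate) (simp add: algebra_simps)
  then show "kron A B \<in> bent N V (k + k') (l + l')"
  proof (rule bentI)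
    show "kron A B = fmat N (k + k') (l + l') (\<lambda>u v. ?t (rotate (l + l' + k') (u @ rev v)))"
      unfolding A B fmat_kron
    proof (rule fmat_cong[OF N])
      fix u v assume "u \<in> words N (l + l')" "v \<in> words N (k + k')"
      then have len: "length u = l + l'" "length v = k + k'" by (auto dest: wordsD)
      obtain u1 u2 v1 v2 where uv: "u = u1 @ u2" "v = v1 @ v2" "length u1 = l" "length v1 = k"
        using len by (metis append_take_drop_id length_take min.absorb2 le_add1)
      with len have l2: "length u2 = l'" "length v2 = k'" by auto
      have 1: "rotate (l + l' + k') (u @ rev v) = rev v1 @ u1 @ u2 @ rev v2"
        using rotate_append[of "u1 @ u2 @ rev v2" "rev v1"] uv l2 by (simp add: add.assoc)
      have 2: "rotate k (rev v1 @ u1) = u1 @ rev v1"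
        using rotate_append[of "rev v1" u1] uv by simp
      show "f (take l u @ rev (take k v)) * g (drop l u @ rev (drop k v)) =
          ?t (rotate (l + l' + k') (u @ rev v))"
        unfolding 1 using uv l2 2 by simp
    qed
  qed
next
  fix A B k l m assume "A \<in> bent N V k l" "B \<in> bent N V l m"
  then obtain f g where f: "f \<in> V (l + k)" and g: "g \<in> V (m + l)"
    and A: "A = fmat N k l (\<lambda>u v. f (u @ rev v))" and B: "B = fmat N l m (\<lambda>u v. g (u @ rev v))"
    unfolding bent_def by blast
  \<comment> \<open>In the product, the trailing upper points of \<open>g\<close>, read as
    \<open>rev w\<close>, meet the leading lower points of \<open>f\<close>, read as
    \<open>w\<close>; \<open>contract_block\<close> sums over these.\<close>
  let ?t = "\<lambda>u. g (take (m + l) u) * f (drop (m + l) u)"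
  have "m + l + (l + k) = m + 2 * l + k" by simp
  with tensor[OF g f] have "?t \<in> V (m + 2 * l + k)" by (simp only:)
  from contract_block[OF this]
  show "B * A \<in> bent N V k m"
  proof (rule bentI)
    show "B * A = fmat N k m (\<lambda>u v. \<Sum>w\<in>words N l.
        ?t (take m (u @ rev v) @ rev w @ w @ drop m (u @ rev v)))"
      unfolding A B fmat_mult[OF N]
    proof (rule fmat_cong[OF N], rule sum.cong[OF refl])
      fix u v w assume "u \<in> words N m" "w \<in> words N l"
      then have "length u = m" "length w = l" by (auto dest: wordsD)
      then show "g (u @ rev w) * f (w @ rev v) =
          ?t (take m (u @ rev v) @ rev w @ w @ drop m (u @ rev v))" by simp
    qed
  qed
next
  fix A k l assume "A \<in> bent N V k l"
  then obtain f where f: "f \<in> V (l + k)" and A: "A = fmat N k l (\<lambda>u v. f (u @ rev v))"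
    unfolding bent_def by blast
  from f star have "(\<lambda>u. cnj (f (rev u))) \<in> V (k + l)" by (simp add: add.commute)
  then show "mat_adjoint A \<in> bent N V l k"
    by (rule bentI) (simp add: A fmat_adjoint)
next
  have "1\<^sub>m N = fmat N 1 1 (\<lambda>u v. if u = v then 1 else 0)" using fmat_one[of N 1] by simp
  also have "\<dots> = fmat N 1 1 (\<lambda>u v. if (u @ rev v) ! 0 = (u @ rev v) ! 1 then 1 else 0)"
    by (rule fmat_cong[OF N]) (auto simp: words_Suc)
  finally show "1\<^sub>m N \<in> bent N V 1 1"
    using pairing by (intro bentI[of "\<lambda>u. if u ! 0 = u ! 1 then 1 else 0"]) (simp_all add: numeral_2_eq_2)
next
  have "fmat N 2 0 (\<lambda>u v. if v ! 0 = v ! 1 then 1 else 0) =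
      fmat N 2 0 (\<lambda>u v. if (u @ rev v) ! 0 = (u @ rev v) ! 1 then 1 else 0)"
    by (rule fmat_cong[OF N]) (auto simp: words_Suc numeral_2_eq_2)
  then show "mat 1 (N ^ 2) (\<lambda>(_, j). if digit N 2 j 1 = digit N 2 j 2 then 1 else 0) \<in> bent N V 2 0"
    unfolding pairing_fmat using pairing
    by (intro bentI[of "\<lambda>u. if u ! 0 = u ! 1 then 1 else 0"]) (simp_all add: numeral_2_eq_2)
qed

lemma (in tk_dual) bent_vectors_subset: "bent N vectors k l \<subseteq> hom_C k l"
  using hom_bend_vector by (auto simp: bent_def vectors_def)

text \<open>The vector of the partition of the positions of \<open>w\<close> into those carrying
  equal letters: an index word contributes exactly if it factors through \<open>w\<close>.\<close>

definition xi_word :: "nat list \<Rightarrow> nat list \<Rightarrow> complex" where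
  "xi_word w x = (if \<exists>h. x = map h w then 1 else 0)"

inductive_set span_words :: "nat \<Rightarrow> nat list set \<Rightarrow> nat \<Rightarrow> (nat list \<Rightarrow> complex) set"
  for N :: nat and K :: "nat list set" and n :: nat where
  gen: "w \<in> K \<Longrightarrow> length w = n \<Longrightarrow> xi_word w \<in> span_words N K n"
| zero: "(\<lambda>_. 0) \<in> span_words N K n"
| add: "f \<in> span_words N K n \<Longrightarrow> g \<in> span_words N K n \<Longrightarrow> (\<lambda>u. f u + g u) \<in> span_words N K n"
| scale: "f \<in> span_words N K n \<Longrightarrow> (\<lambda>u. c * f u) \<in> span_words N K n"
| cong: "f \<in> span_words N K n \<Longrightarrow> (\<And>u. u \<in> words N n \<Longrightarrow> f u = g u) \<Longrightarrow> g \<in> span_words N K n"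

text \<open>Closure properties under which the partition vectors of words in \<open>K\<close> span a
  planar family with adjoints. The shift by \<open>M\<close> keeps the blocks of the two
  concatenated words apart.\<close>

locale word_class =
  fixes K :: "nat list set"
  assumes pair_mem: "[0, 0] \<in> K"
    and rotate_mem: "ws @ [a] \<in> K \<Longrightarrow> a # ws \<in> K"
    and rev_mem: "w \<in> K \<Longrightarrow> rev w \<in> K"
    and append_mem: "w \<in> K \<Longrightarrow> w' \<in> K \<Longrightarrow> (\<forall>c\<in>set w. c < M) \<Longrightarrow> w @ map ((+) M) w' \<in> K"
    and contract_mem: "x # y # w \<in> K \<Longrightarrow> map (\<lambda>z. if z = x then y else z) w \<in> K"

lemma xi_word_append:
  assumes "\<forall>c\<in>set w. c < M" "length w = m"
  shows "xi_word w (take m u) * xi_word w' (drop m u) = xi_word (w @ map ((+) M) w') u"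
proof -
  have "(\<exists>h. take m u = map h w) \<and> (\<exists>h. drop m u = map h w') \<longleftrightarrow> (\<exists>h. u = map h (w @ map ((+) M) w'))"
  proof
    assume "(\<exists>h. take m u = map h w) \<and> (\<exists>h. drop m u = map h w')"
    then obtain h h' where h: "take m u = map h w" "drop m u = map h' w'" by blast
    have "u = map h w @ map h' w'" using append_take_drop_id[of m u] unfolding h by simp
    also have "\<dots> = map (\<lambda>c. if c < M then h c else h' (c - M)) (w @ map ((+) M) w')"
      using assms by simp
    finally show "\<exists>h. u = map h (w @ map ((+) M) w')" by blast
  next
    assume "\<exists>h. u = map h (w @ map ((+) M) w')"
    then show "(\<exists>h. take m u = map h w) \<and> (\<exists>h. drop m u = map h w')"
      using assms(2) by (auto simp: o_def)
  qed
  then show ?thesis by (auto simp: xi_word_def)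
qed

text \<open>Capping joins the blocks of the first two points and removes both. If the joint block
  has further points, the summation index is fixed by \<open>u\<close>; otherwise it is free and
  contributes \<open>N\<close>.\<close>

lemma xi_word_contract:
  fixes x y :: nat and u w :: "nat list"
  assumes "u \<in> words N n"
  defines "w' \<equiv> map (\<lambda>z. if z = x then y else z) w"
  shows "(\<Sum>a<N. xi_word (x # y # w) (a # a # u)) = (if y \<in> set w' then 1 else of_nat N) * xi_word w' u"
proof -
  have "(\<exists>h. a # a # u = map h (x # y # w)) \<longleftrightarrow> (\<exists>h. a # u = map h (y # w'))" for a
  proof
    assume "\<exists>h. a # a # u = map h (x # y # w)"
    then obtain h where "h x = a" "h y = a" "u = map h w" by auto
    then have "a # u = map h (y # w')" by (auto simp: w'_def)
    then show "\<exists>h. a # u = map h (y # w')" by (intro exI[of _ h])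
  next
    assume "\<exists>h. a # u = map h (y # w')"
    then obtain h where "h y = a" "u = map h w'" by auto
    then have "a # a # u = map (\<lambda>z. if z = x then h y else h z) (x # y # w)" by (auto simp: w'_def)
    then show "\<exists>h. a # a # u = map h (x # y # w)"
      by (intro exI[of _ "\<lambda>z. if z = x then h y else h z"])
  qed
  then have 1: "(\<Sum>a<N. xi_word (x # y # w) (a # a # u)) = (\<Sum>a<N. xi_word (y # w') (a # u))"
    unfolding xi_word_def by simp
  show ?thesis
  proof (cases "\<exists>h. u = map h w'")
    case False
    then show ?thesis unfolding 1 by (auto simp: xi_word_def)
  next
    case True
    then obtain h where h: "u = map h w'" by blast
    show ?thesis
    proof (cases "y \<in> set w'")
      case True
      then have "h y \<in> set u" using h by simp
      then have hN: "h y < N" using assms(1) by (auto simp: words_def)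
      have "xi_word (y # w') (a # u) = (if a = h y then 1 else 0)" for a
      proof -
        have "h' y = h y" if "u = map h' w'" for h' using that h True by simp
        then show ?thesis using h by (auto simp: xi_word_def)
      qed
      then show ?thesis unfolding 1 using True hN h by (auto simp: xi_word_def)
    next
      case False
      have "\<exists>h'. a # u = map h' (y # w')" for a
        using h False by (intro exI[of _ "h(y := a)"]) auto
      then show ?thesis unfolding 1 using False h by (auto simp: xi_word_def)
    qed
  qed
qed

lemma xi_word_pair: "u \<in> words N 2 \<Longrightarrow> xi_word [0, 0] u = (if u ! 0 = u ! 1 then 1 else 0)"
  by (auto simp: xi_word_def words_Suc numeral_2_eq_2)

lemma (in word_class) planar_star_span_words:
  assumes "0 < N"
  shows "planar_star N (span_words N K)"
proof
  fix f g m n assume f: "f \<in> span_words N K m" and g: "g \<in> span_words N K n"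
  from f show "(\<lambda>u. f (take m u) * g (drop m u)) \<in> span_words N K (m + n)"
  proof induction
    case (gen w)
    from g show ?case
    proof induction
      case (gen w')
      obtain M where M: "\<forall>c\<in>set w. c < M"
        using finite_nat_set_iff_bounded[of "set w"] by auto
      show ?case unfolding xi_word_append[OF M \<open>length w = m\<close>]
        using gen \<open>w \<in> K\<close> \<open>length w = m\<close> M by (intro span_words.gen append_mem) auto
    next
      case zero
      show ?case using span_words.zero by simp
    next
      case (add f g)
      then show ?case using span_words.add by (force simp: distrib_left)
    next
      case (scale f c)
      from span_words.scale[OF scale(2), of c] show ?case by (simp add: mult.left_commute)
    next
      case (cong f g)
      from cong(3) show ?case
        by (rule span_words.cong) (use cong(2) words_drop in auto)
    qed
  next
    case zero
    show ?case using span_words.zero by simp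
  next
    case (add f g)
    then show ?case using span_words.add by (force simp: distrib_right)
  next
    case (scale f c)
    from span_words.scale[OF scale(2), of c] show ?case by (simp add: mult.assoc)
  next
    case (cong f g)
    from cong(3) show ?case
      by (rule span_words.cong) (use cong(2) words_take in auto)
  qed
next
  fix f n assume "f \<in> span_words N K n"
  then show "(\<lambda>u. f (rotate1 u)) \<in> span_words N K n"
  proof induction
    case (gen w)
    show ?case
    proof (cases w rule: rev_cases)
      case Nil
      then have "(\<lambda>u. xi_word w (rotate1 u)) = xi_word w" by (auto simp: xi_word_def)
      with gen show ?thesis using span_words.gen[of w K n N] by simp
    next
      case (snoc ws a)
      have "rotate1 u = map h (ws @ [a]) \<longleftrightarrow> u = map h (a # ws)" for u and h :: "nat \<Rightarrow> nat"
        using inj_eq[OF inj_rotate1, of u "map h (a # ws)"] by simp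
      then have "(\<lambda>u. xi_word w (rotate1 u)) = xi_word (a # ws)"
        unfolding xi_word_def snoc by simp
      with gen snoc show ?thesis using span_words.gen[OF rotate_mem, of ws a n N] by simp
    qed
  next
    case (cong f g)
    from cong(3) show ?case by (rule span_words.cong) (use cong(2) words_rotate1 in auto)
  qed (auto intro: span_words.zero span_words.add span_words.scale)
next
  fix f n assume "f \<in> span_words N K (Suc (Suc n))"
  then show "(\<lambda>u. \<Sum>a<N. f (a # a # u)) \<in> span_words N K n"
  proof induction
    case (gen w)
    then obtain x y w0 where w: "w = x # y # w0" "length w0 = n" by (auto simp: length_Suc_conv)
    let ?w' = "map (\<lambda>z. if z = x then y else z) w0"
    have "xi_word ?w' \<in> span_words N K n"
      using gen w contract_mem by (intro span_words.gen) auto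
    then have "(\<lambda>u. (if y \<in> set ?w' then 1 else of_nat N) * xi_word ?w' u) \<in> span_words N K n"
      by (rule span_words.scale)
    then show ?case by (rule span_words.cong) (simp add: w xi_word_contract)
  next
    case (add f g)
    then show ?case using span_words.add by (force simp: sum.distrib)
  next
    case (scale f c)
    from span_words.scale[OF scale(2), of c] show ?case by (simp add: sum_distrib_left)
  next
    case (cong f g)
    from cong(3) show ?case by (rule span_words.cong) (use cong(2) in auto)
  qed (auto intro: span_words.zero)
next
  from span_words.gen[OF pair_mem, of 2 N]
  show "(\<lambda>u. if u ! 0 = u ! 1 then 1 else 0) \<in> span_words N K 2"
    by (auto intro: span_words.cong simp: xi_word_pair)
next
  fix f n assume "f \<in> span_words N K n"
  then show "(\<lambda>u. cnj (f (rev u))) \<in> span_words N K n"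
  proof induction
    case (gen w)
    have "rev u = map h w \<longleftrightarrow> u = map h (rev w)" for u and h :: "nat \<Rightarrow> nat" by (metis rev_map rev_rev_ident)
    then have "(\<lambda>u. cnj (xi_word w (rev u))) = xi_word (rev w)"
      unfolding xi_word_def by auto
    with gen show ?case using span_words.gen[OF rev_mem, of w n N] by simp
  next
    case (scale f c)
    from span_words.scale[OF scale(2), of "cnj c"] show ?case by simp
  next
    case (cong f g)
    from cong(3) show ?case by (rule span_words.cong) (use cong(2) words_rev in auto)
  qed (auto intro: span_words.zero span_words.add)
qed (use assms in \<open>auto intro: span_words.intros\<close>)

text \<open>Stating the pattern through \<open>subseq\<close> suits concatenation, reversal and
  relabelling; \<open>noncrossing_words_iff\<close> translates it into positions.\<close>

definition noncrossing_words :: "nat list set" where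
  "noncrossing_words = {w. \<forall>x y. subseq [x, y, x, y] w \<longrightarrow> x = y}"

lemma noncrossing_wordsI:
  "(\<And>x y. subseq [x, y, x, y] w \<Longrightarrow> x = y) \<Longrightarrow> w \<in> noncrossing_words"
  and noncrossing_wordsD: "w \<in> noncrossing_words \<Longrightarrow> subseq [x, y, x, y] w \<Longrightarrow> x = y"
  unfolding noncrossing_words_def by blast+

lemma subseq_rev: "subseq xs ys \<Longrightarrow> subseq (rev xs) (rev ys)"
  by (induction rule: list_emb.induct) (auto intro: subseq_rev_drop_many list_emb_append_mono)

lemma subseq_mapE:
  assumes "subseq xs (map f ys)"
  obtains zs where "subseq zs ys" "xs = map f zs"
  using assms unfolding subseq_conv_nths by (metis nths_map)

lemma subseq_subset: "subseq xs ys \<Longrightarrow> set xs \<subseteq> set ys"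
  by (auto dest: list_emb_set)

lemma word_class_UNIV: "word_class UNIV"
  by standard auto

lemma word_class_noncrossing: "word_class noncrossing_words"
proof
  show "[0, 0] \<in> noncrossing_words" by (simp add: noncrossing_words_def)
next
  fix ws a assume w: "ws @ [a] \<in> noncrossing_words"
  have "x = y" if s: "subseq [x, y, x, y] (a # ws)" for x y
  proof (cases "a = x")
    case True
    with s have "subseq [y, x, y] ws" by (simp split: if_splits)
    then have "subseq ([y, x, y] @ [x]) (ws @ [a])" using True by (intro list_emb_append_mono) auto
    then have "subseq [y, x, y, x] (ws @ [a])" by simp
    with w have "y = x" by (rule noncrossing_wordsD)
    then show ?thesis by simp
  next
    case False
    with s have "subseq [x, y, x, y] ws" by simp
    then have "subseq [x, y, x, y] (ws @ [a])" by (rule subseq_rev_drop_many)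
    with w show ?thesis by (rule noncrossing_wordsD)
  qed
  then show "a # ws \<in> noncrossing_words" by (rule noncrossing_wordsI)
next
  fix w assume w: "w \<in> noncrossing_words"
  have "x = y" if "subseq [x, y, x, y] (rev w)" for x y
    using subseq_rev[OF that] noncrossing_wordsD[OF w, of y x] by simp
  then show "rev w \<in> noncrossing_words" by (rule noncrossing_wordsI)
next
  fix w w' :: "nat list" and M
  assume w: "w \<in> noncrossing_words" "w' \<in> noncrossing_words" and M: "\<forall>c\<in>set w. c < M"
  have "x = y" if "subseq [x, y, x, y] (w @ map ((+) M) w')" for x y
    using that
  proof (cases rule: subseq_appendE)
    case (append xs1 xs2)
    from append(3) obtain zs where zs: "subseq zs w'" "xs2 = map ((+) M) zs" by (rule subseq_mapE)
    have lt: "c < M" if "c \<in> set xs1" for c using subseq_subset[OF append(2)] M that by auto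
    have ge: "M \<le> c" if "c \<in> set xs2" for c using zs that by auto
    \<comment> \<open>Cutting \<open>[x, y, x, y]\<close> into two non-empty pieces leaves a letter
      on both sides, which the disjoint alphabets exclude.\<close>
    consider "xs1 = []" | "xs2 = []" | "x \<in> set xs1" "x \<in> set xs2" | "y \<in> set xs1" "y \<in> set xs2"
      using append(1) by (auto simp: Cons_eq_append_conv)
    then show ?thesis
    proof cases
      case 1
      then obtain x' y' where "x = M + x'" "y = M + y'" "zs = [x', y', x', y']"
        using append(1) zs by (auto simp: map_eq_Cons_conv Cons_eq_map_conv)
      with zs noncrossing_wordsD[OF w(2), of x' y'] show ?thesis by simp
    next
      case 2
      with append noncrossing_wordsD[OF w(1), of x y] show ?thesis by simp
    next
      case 3
      with lt ge show ?thesis by (meson not_le)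
    next
      case 4
      with lt ge show ?thesis by (meson not_le)
    qed
  qed
  then show "w @ map ((+) M) w' \<in> noncrossing_words" by (rule noncrossing_wordsI)
next
  fix x y w assume w: "x # y # w \<in> noncrossing_words"
  have nc: "p = q" if "subseq [p, q, p, q] (x # y # w)" for p q
    using noncrossing_wordsD[OF w that] .
  have "p = q" if s: "subseq [p, q, p, q] (map (\<lambda>z. if z = x then y else z) w)" for p q
  proof (rule ccontr)
    assume pq: "p \<noteq> q"
    from s obtain zs where zs: "subseq zs w" "[p, q, p, q] = map (\<lambda>z. if z = x then y else z) zs"
      by (rule subseq_mapE)
    then obtain p1 q1 p2 q2 where z: "zs = [p1, q1, p2, q2]"
      and e: "p = (if p1 = x then y else p1)" "q = (if q1 = x then y else q1)"
        "p = (if p2 = x then y else p2)" "q = (if q2 = x then y else q2)"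
      by (auto simp: map_eq_Cons_conv Cons_eq_map_conv)
    have sub: "subseq [a, b, c, d] (x # y # w)" if "subseq [a, b, c, d] [x, y, p1, q1, p2, q2]" for a b c d
      using zs(1) z that by (meson subseq_Cons2 subseq_order.order_trans)
    \<comment> \<open>If merging created the pattern, the two occurrences of \<open>p\<close> or of
      \<open>q\<close> were \<open>x\<close> and \<open>y\<close>. One of the leading letters
      \<open>x\<close>, \<open>y\<close> then supplies the missing repetition, so a crossing was
      already present in \<open>x # y # w\<close>.\<close>
    have "subseq [p1, q1, p2, q2] [x, y, p1, q1, p2, q2]"
      "subseq [x, q1, p2, q2] [x, y, p1, q1, p2, q2]"
      "subseq [y, q1, p2, q2] [x, y, p1, q1, p2, q2]"
      "subseq [x, p1, q1, p2] [x, y, p1, q1, p2, q2]"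
      "subseq [y, p1, q1, p2] [x, y, p1, q1, p2, q2]"
      by (auto intro: list_emb.intros)
    note * = this[THEN sub]
    have "p1 = p2 \<Longrightarrow> q1 = q2 \<Longrightarrow> p1 = q1" "x = p2 \<Longrightarrow> q1 = q2 \<Longrightarrow> x = q1"
      "y = p2 \<Longrightarrow> q1 = q2 \<Longrightarrow> y = q1" "x = q1 \<Longrightarrow> p1 = p2 \<Longrightarrow> x = p1"
      "y = q1 \<Longrightarrow> p1 = p2 \<Longrightarrow> y = p1"
      using * nc by metis+
    moreover have "p1 = p2 \<or> p1 = x \<and> p2 = y \<and> p = y \<or> p1 = y \<and> p2 = x \<and> p = y"
      using e(1,3) by metis
    moreover have "q1 = q2 \<or> q1 = x \<and> q2 = y \<and> q = y \<or> q1 = y \<and> q2 = x \<and> q = y"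
      using e(2,4) by metis
    ultimately show False using e(1,2) pq by metis
  qed
  then show "map (\<lambda>z. if z = x then y else z) w \<in> noncrossing_words"
    by (rule noncrossing_wordsI)
qed

section \<open>Partitions as words\<close>

lemma mat_span_subspace:
  assumes "S \<subseteq> carrier_mat nr nc"
  shows "VectorSpace.subspace class_ring (mat_span nr nc S) (mat_space nr nc)"
    and mat_span_gen: "S \<subseteq> mat_span nr nc S"
    and mat_span_least: "VectorSpace.subspace class_ring W (mat_space nr nc) \<Longrightarrow> S \<subseteq> W \<Longrightarrow>
      mat_span nr nc S \<subseteq> W"
proof -
  have vs: "vectorspace class_ring (mat_space nr nc)" by (rule matrix_vs)
  then have m: "Module.module class_ring (mat_space nr nc)" by (simp add: vectorspace_def)
  have S: "S \<subseteq> carrier (mat_space nr nc)" using assms by (simp add: module_mat_simps)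
  show "VectorSpace.subspace class_ring (mat_span nr nc S) (mat_space nr nc)"
    unfolding mat_span_def VectorSpace.subspace_def
    using vs LinearCombinations.module.span_is_submodule[OF m S] by blast
  show "S \<subseteq> mat_span nr nc S"
    unfolding mat_span_def by (rule LinearCombinations.module.in_own_span[OF m S])
  show "mat_span nr nc S \<subseteq> W"
    if "VectorSpace.subspace class_ring W (mat_space nr nc)" "S \<subseteq> W"
    unfolding mat_span_def
    by (rule LinearCombinations.module.span_is_subset[OF m])
      (use that in \<open>simp_all add: VectorSpace.subspace_def\<close>)
qed

text \<open>The position of a point in the word obtained by reading the lower points from left to right and
  then the upper points from right to left.\<close>

fun index :: "nat \<Rightarrow> nat \<Rightarrow> nat + nat \<Rightarrow> nat" where
  "index k l (Inl x) = l + k - x"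
| "index k l (Inr y) = y - 1"

lemma points_iff [simp]:
  "Inl x \<in> points k l \<longleftrightarrow> 1 \<le> x \<and> x \<le> k" "Inr y \<in> points k l \<longleftrightarrow> 1 \<le> y \<and> y \<le> l"
  by (auto simp: points_def)

lemma bij_betw_index: "bij_betw (index k l) (points k l) {..<l + k}"
proof (rule bij_betwI')
  fix a b assume "a \<in> points k l" "b \<in> points k l"
  then show "index k l a = index k l b \<longleftrightarrow> a = b" by (cases a; cases b) auto
next
  fix a assume "a \<in> points k l"
  then show "index k l a \<in> {..<l + k}" by (cases a) auto
next
  fix i assume "i \<in> {..<l + k}"
  then have "i = index k l (if i < l then Inr (Suc i) else Inl (l + k - i))"
    "(if i < l then Inr (Suc i) else Inl (l + k - i)) \<in> points k l" by auto
  then show "\<exists>a\<in>points k l. i = index k l a" by blast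
qed

lemma index_less: "a \<in> points k l \<Longrightarrow> index k l a < l + k"
  using bij_betw_index[of k l] by (auto simp: bij_betw_def)

lemma index_inj: "a \<in> points k l \<Longrightarrow> b \<in> points k l \<Longrightarrow> index k l a = index k l b \<Longrightarrow> a = b"
  using bij_betw_index[of k l] by (auto simp: bij_betw_def inj_on_def)

lemma index_surj:
  assumes "i < l + k" obtains a where "a \<in> points k l" "index k l a = i"
  using assms bij_betw_index[of k l] unfolding bij_betw_def by (metis imageE lessThan_iff)

text \<open>\<open>index\<close> reads the points in the order opposite to \<open>pos\<close>;
  crossings are insensitive to this reversal.\<close>

lemma pos_eq_index: "a \<in> points k l \<Longrightarrow> pos k l a = k + l - index k l a"
  by (cases a) auto

lemma pos_less_iff:
  assumes "a \<in> points k l" "b \<in> points k l"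
  shows "pos k l a < pos k l b \<longleftrightarrow> index k l b < index k l a"
  using index_less[OF assms(1)] index_less[OF assms(2)] assms by (auto simp: pos_eq_index)

definition represents :: "nat \<Rightarrow> nat \<Rightarrow> (nat + nat) set set \<Rightarrow> nat list \<Rightarrow> bool" where
  "represents k l p w \<longleftrightarrow> length w = l + k \<and> (\<forall>a\<in>points k l. \<forall>b\<in>points k l.
     same_block p a b \<longleftrightarrow> w ! index k l a = w ! index k l b)"

lemma same_block_points: "p \<in> partitions2 k l \<Longrightarrow> same_block p a b \<Longrightarrow> a \<in> points k l \<and> b \<in> points k l"
  by (auto simp: partitions2_def same_block_def partition_on_def)

lemma same_block_equiv:
  assumes "p \<in> partitions2 k l"
  shows "a \<in> points k l \<Longrightarrow> same_block p a a" "same_block p a b \<Longrightarrow> same_block p b a"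
    "same_block p a b \<Longrightarrow> same_block p b c \<Longrightarrow> same_block p a c"
proof -
  show "a \<in> points k l \<Longrightarrow> same_block p a a" "same_block p a b \<Longrightarrow> same_block p b a"
    using assms by (auto simp: partitions2_def same_block_def partition_on_def)
  show "same_block p a c" if "same_block p a b" "same_block p b c"
  proof -
    from that obtain B C where BC: "B \<in> p" "a \<in> B" "b \<in> B" "C \<in> p" "b \<in> C" "c \<in> C"
      by (auto simp: same_block_def)
    moreover have "B = C"
      using assms BC unfolding partitions2_def partition_on_def disjoint_def by blast
    ultimately show ?thesis unfolding same_block_def by blast
  qed
qed

lemma represents_exists:
  assumes p: "p \<in> partitions2 k l"
  obtains w where "represents k l p w"
proof -
  \<comment> \<open>Each block receives its smallest index as letter.\<close>
  define lab where "lab a = (LEAST t. \<exists>b. same_block p a b \<and> index k l b = t)" for a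
  have lab: "\<exists>b. same_block p a b \<and> index k l b = lab a" if "a \<in> points k l" for a
    unfolding lab_def by (rule LeastI_ex) (use same_block_equiv(1)[OF p that] in blast)
  have eq: "same_block p a b \<longleftrightarrow> lab a = lab b" if a: "a \<in> points k l" and b: "b \<in> points k l" for a b
  proof
    assume "same_block p a b"
    then have "same_block p a = same_block p b" using same_block_equiv[OF p] by blast
    then show "lab a = lab b" by (simp add: lab_def)
  next
    assume "lab a = lab b"
    then obtain c d where "same_block p a c" "same_block p b d" "index k l c = index k l d"
      using lab[OF a] lab[OF b] by metis
    then show "same_block p a b"
      using index_inj same_block_points[OF p] same_block_equiv[OF p] by metis
  qed
  let ?w = "map (\<lambda>i. lab (inv_into (points k l) (index k l) i)) [0..<l + k]"
  have "?w ! index k l a = lab a" if "a \<in> points k l" for a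
    using that index_less[OF that] bij_betw_index[of k l] by (simp add: bij_betw_def inv_into_f_f)
  then have "represents k l p ?w" unfolding represents_def using eq by simp
  then show thesis by (rule that)
qed

lemma represents_exists_partition:
  assumes "length w = l + k"
  obtains p where "p \<in> partitions2 k l" "represents k l p w"
proof -
  define B where "B b = {a \<in> points k l. w ! index k l a = w ! index k l b}" for b
  define p where "p = B ` points k l"
  have "partition_on (points k l) p"
    by (rule partition_onI) (auto simp: p_def B_def disjnt_def)
  moreover have "represents k l p w"
    unfolding represents_def using assms by (auto simp: p_def B_def same_block_def)
  ultimately show thesis using that by (simp add: partitions2_def)
qed

lemma xi_word_iff:
  assumes "length x = length w"
  shows "(\<exists>h. x = map h w) \<longleftrightarrow> (\<forall>i<length w. \<forall>j<length w. w ! i = w ! j \<longrightarrow> x ! i = x ! j)"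
proof
  assume "\<exists>h. x = map h w"
  then show "\<forall>i<length w. \<forall>j<length w. w ! i = w ! j \<longrightarrow> x ! i = x ! j" by auto
next
  assume *: "\<forall>i<length w. \<forall>j<length w. w ! i = w ! j \<longrightarrow> x ! i = x ! j"
  define h where "h c = x ! (SOME i. i < length w \<and> w ! i = c)" for c
  have "x = map h w"
  proof (rule nth_equalityI)
    fix j assume "j < length x"
    with assms have j: "j < length w" by simp
    let ?i = "SOME i. i < length w \<and> w ! i = w ! j"
    have "?i < length w \<and> w ! ?i = w ! j" by (rule someI[of _ j]) (use j in simp)
    with * j have "x ! ?i = x ! j" by blast
    with j show "x ! j = map h w ! j" by (simp add: h_def)
  qed (simp add: assms)
  then show "\<exists>h. x = map h w" by blast
qed

text \<open>The bijection \<open>index\<close> turns the condition on pairs of points into one on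
  pairs of positions; the column word is reversed because upper points are read right to
  left.\<close>

lemma T_mat_eq_fmat:
  assumes p: "p \<in> partitions2 k l" and r: "represents k l p w"
  shows "T_mat N k l p = fmat N k l (\<lambda>u v. xi_word w (u @ rev v))"
proof (rule eq_matI)
  fix i j assume "i < dim_row (fmat N k l (\<lambda>u v. xi_word w (u @ rev v)))"
    "j < dim_col (fmat N k l (\<lambda>u v. xi_word w (u @ rev v)))"
  then have ij: "i < N ^ l" "j < N ^ k" by simp_all
  let ?label = "case_sum (digit N k j) (digit N l i)"
  let ?x = "digits N l i @ rev (digits N k j)"
  have lw: "length w = l + k" using r by (simp add: represents_def)
  have lab: "?label a = ?x ! index k l a" if "a \<in> points k l" for a
  proof (cases a)
    case (Inl x)
    with that have "k - Suc (l + k - x - l) = x - 1" "l + k - x - l < k" "\<not> l + k - x < l"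
      "x - Suc 0 < k" by auto
    then show ?thesis using Inl that by (simp add: nth_append rev_nth digits_nth)
  next
    case (Inr y)
    with that show ?thesis by (auto simp: nth_append digits_nth)
  qed
  have sb: "same_block p a b \<longleftrightarrow> w ! index k l a = w ! index k l b"
    if "a \<in> points k l" "b \<in> points k l" for a b
    using r that by (simp add: represents_def)
  have "(\<forall>a b. same_block p a b \<longrightarrow> ?label a = ?label b) \<longleftrightarrow>
      (\<forall>a\<in>points k l. \<forall>b\<in>points k l. same_block p a b \<longrightarrow> ?label a = ?label b)"
    using same_block_points[OF p] by blast
  also have "\<dots> \<longleftrightarrow> (\<forall>a\<in>points k l. \<forall>b\<in>points k l. w ! index k l a = w ! index k l b \<longrightarrow>
         ?x ! index k l a = ?x ! index k l b)"
    by (intro ball_cong refl) (simp only: sb lab)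
  also have "\<dots> \<longleftrightarrow> (\<forall>s\<in>index k l ` points k l. \<forall>t\<in>index k l ` points k l. w ! s = w ! t \<longrightarrow> ?x ! s = ?x ! t)"
    by blast
  also have "\<dots> \<longleftrightarrow> (\<exists>h. ?x = map h w)"
    using bij_betw_index[of k l] lw by (subst xi_word_iff) (auto simp: bij_betw_def)
  finally show "T_mat N k l p $$ (i, j) = fmat N k l (\<lambda>u v. xi_word w (u @ rev v)) $$ (i, j)"
    using ij by (simp add: T_mat_def fmat_def xi_word_def Let_def)
qed (simp_all add: T_mat_def)

lemma subseq_Cons_iff_nth:
  "subseq (x # xs) w \<longleftrightarrow> (\<exists>i<length w. w ! i = x \<and> subseq xs (drop (Suc i) w))"
proof
  assume "subseq (x # xs) w"
  then obtain us v vs where "w = us @ v # vs" "x = v" "subseq xs vs" by (blast dest: list_emb_ConsD)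
  then show "\<exists>i<length w. w ! i = x \<and> subseq xs (drop (Suc i) w)"
    by (intro exI[of _ "length us"]) auto
next
  assume "\<exists>i<length w. w ! i = x \<and> subseq xs (drop (Suc i) w)"
  then obtain i where i: "i < length w" "w ! i = x" "subseq xs (drop (Suc i) w)" by blast
  then have "subseq (x # xs) (drop i w)" by (simp add: Cons_nth_drop_Suc[symmetric])
  from subseq_drop_many[OF this, of "take i w"] show "subseq (x # xs) w" by simp
qed

lemma noncrossing_words_iff:
  "w \<in> noncrossing_words \<longleftrightarrow> \<not> (\<exists>a b c d. a < b \<and> b < c \<and> c < d \<and> d < length w \<and>
     w ! a = w ! c \<and> w ! b = w ! d \<and> w ! a \<noteq> w ! b)"
proof -
  have "subseq [x, y, x, y] w \<longleftrightarrow> (\<exists>a b c d. a < b \<and> b < c \<and> c < d \<and> d < length w \<and>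
     w ! a = x \<and> w ! b = y \<and> w ! c = x \<and> w ! d = y)" (is "_ \<longleftrightarrow> ?R") for x y
  proof
    assume "subseq [x, y, x, y] w"
    then obtain i j s t where "i < length w" "w ! i = x" "j < length w - Suc i" "w ! (Suc i + j) = y"
      "s < length w - Suc (Suc i + j)" "w ! (Suc (Suc i + j) + s) = x"
      "t < length w - Suc (Suc (Suc i + j) + s)" "w ! (Suc (Suc (Suc i + j) + s) + t) = y"
      by (auto simp: subseq_Cons_iff_nth[of _ _ w] subseq_Cons_iff_nth[of _ _ "drop _ w"] add.commute)
    then show ?R
      by (intro exI[of _ i] exI[of _ "Suc i + j"] exI[of _ "Suc (Suc i + j) + s"]
          exI[of _ "Suc (Suc (Suc i + j) + s) + t"]) auto
  next
    assume ?R
    then obtain a b c d where q: "a < b" "b < c" "c < d" "d < length w"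
      "w ! a = x" "w ! b = y" "w ! c = x" "w ! d = y" by blast
    have 4: "subseq [y] (drop (Suc c) w)"
      using q by (subst subseq_Cons_iff_nth) (auto intro!: exI[of _ "d - Suc c"])
    have 3: "subseq [x, y] (drop (Suc b) w)"
      using q 4 by (subst subseq_Cons_iff_nth) (auto intro!: exI[of _ "c - Suc b"])
    have 2: "subseq [y, x, y] (drop (Suc a) w)"
      using q 3 by (subst subseq_Cons_iff_nth) (auto intro!: exI[of _ "b - Suc a"])
    show "subseq [x, y, x, y] w"
      using q 2 by (subst subseq_Cons_iff_nth) (auto intro!: exI[of _ a])
  qed
  then have *: "w \<in> noncrossing_words \<longleftrightarrow> (\<forall>x y. (\<exists>a b c d. a < b \<and> b < c \<and> c < d \<and> d < length w \<and>
     w ! a = x \<and> w ! b = y \<and> w ! c = x \<and> w ! d = y) \<longrightarrow> x = y)"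
    by (simp only: noncrossing_words_def mem_Collect_eq)
  show ?thesis
  proof (rule iffI)
    assume w: "w \<in> noncrossing_words"
    show "\<not> (\<exists>a b c d. a < b \<and> b < c \<and> c < d \<and> d < length w \<and>
        w ! a = w ! c \<and> w ! b = w ! d \<and> w ! a \<noteq> w ! b)"
    proof (intro notI, elim exE conjE)
      fix a b c d assume q: "a < b" "b < c" "c < d" "d < length w" "w ! a = w ! c" "w ! b = w ! d"
        and ne: "w ! a \<noteq> w ! b"
      have "\<exists>a' b' c' d'. a' < b' \<and> b' < c' \<and> c' < d' \<and> d' < length w \<and>
          w ! a' = w ! a \<and> w ! b' = w ! b \<and> w ! c' = w ! a \<and> w ! d' = w ! b"
        using q by (intro exI[of _ a] exI[of _ b] exI[of _ c] exI[of _ d]) simp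
      then have "w ! a = w ! b" by (rule w[unfolded *, THEN spec, THEN spec, THEN mp])
      with ne show False by contradiction
    qed
  next
    assume nex: "\<not> (\<exists>a b c d. a < b \<and> b < c \<and> c < d \<and> d < length w \<and>
        w ! a = w ! c \<and> w ! b = w ! d \<and> w ! a \<noteq> w ! b)"
    show "w \<in> noncrossing_words"
      unfolding *
    proof (intro allI impI, elim exE conjE)
      fix x y a b c d
      assume q: "a < b" "b < c" "c < d" "d < length w" "w ! a = x" "w ! b = y" "w ! c = x" "w ! d = y"
      show "x = y"
      proof (rule ccontr)
        assume "x \<noteq> y"
        with q have "\<exists>a b c d. a < b \<and> b < c \<and> c < d \<and> d < length w \<and>
            w ! a = w ! c \<and> w ! b = w ! d \<and> w ! a \<noteq> w ! b"
          by (intro exI[of _ a] exI[of _ b] exI[of _ c] exI[of _ d]) simp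
        with nex show False by contradiction
      qed
    qed
  qed
qed

lemma crossing_iff_word:
  assumes "represents k l p w"
  shows "crossing k l p \<longleftrightarrow> w \<notin> noncrossing_words"
proof -
  have lw: "length w = l + k" using assms by (simp add: represents_def)
  note sb = assms[unfolded represents_def, THEN conjunct2, rule_format]
  show ?thesis
  proof
    assume "crossing k l p"
    then obtain a b c d where q: "a \<in> points k l" "b \<in> points k l" "c \<in> points k l" "d \<in> points k l"
      "pos k l a < pos k l b" "pos k l b < pos k l c" "pos k l c < pos k l d"
      "same_block p a c" "same_block p b d" "\<not> same_block p a b"
      unfolding crossing_def by blast
    then show "w \<notin> noncrossing_words"
      unfolding noncrossing_words_iff not_not
      by (intro exI[of _ "index k l d"] exI[of _ "index k l c"] exI[of _ "index k l b"]
          exI[of _ "index k l a"]) (simp add: pos_less_iff sb lw index_less)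
  next
    assume "w \<notin> noncrossing_words"
    then obtain a b c d where q: "a < b" "b < c" "c < d" "d < l + k"
      "w ! a = w ! c" "w ! b = w ! d" "w ! a \<noteq> w ! b"
      unfolding noncrossing_words_iff lw by blast
    obtain a' where a: "a' \<in> points k l" "index k l a' = a" using index_surj[of a l k] q by auto
    obtain b' where b: "b' \<in> points k l" "index k l b' = b" using index_surj[of b l k] q by auto
    obtain c' where c: "c' \<in> points k l" "index k l c' = c" using index_surj[of c l k] q by auto
    obtain d' where d: "d' \<in> points k l" "index k l d' = d" using index_surj[of d l k] q by auto
    show "crossing k l p"
      unfolding crossing_def
      by (intro bexI[of _ d'] bexI[of _ c'] bexI[of _ b'] bexI[of _ a'])
        (use q a b c d in \<open>simp_all add: pos_less_iff sb\<close>)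
  qed
qed

text \<open>For \<open>K = UNIV\<close> this describes \<open>P_dual N\<close>, for
  \<open>K = noncrossing_words\<close> it describes \<open>NC_dual N\<close>; through
  \<open>tannaka_krein_dual_bent\<close> both are seen to be Tannaka-Krein duals.\<close>

lemma mat_span_eq_bent:
  assumes "word_class K" "0 < N"
  shows "mat_span (N ^ l) (N ^ k) (T_mat N k l ` {p \<in> partitions2 k l. \<exists>w. represents k l p w \<and> w \<in> K})
    = bent N (span_words N K) k l" (is "mat_span _ _ ?S = _")
proof -
  interpret planar_star N "span_words N K"
    using word_class.planar_star_span_words[OF assms] .
  have S: "?S \<subseteq> carrier_mat (N ^ l) (N ^ k)" by (auto simp: T_mat_def)
  note sub = mat_span_subspace[OF S, unfolded subspace_mat_iff]
  show ?thesis
  proof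
    show "mat_span (N ^ l) (N ^ k) ?S \<subseteq> bent N (span_words N K) k l"
    proof (rule mat_span_least[OF S])
      show "VectorSpace.subspace class_ring (bent N (span_words N K) k l) (mat_space (N ^ l) (N ^ k))"
        by (rule tannaka_krein_dual.hom_subspace[OF tannaka_krein_dual_bent])
      show "?S \<subseteq> bent N (span_words N K) k l"
      proof safe
        fix p w assume "p \<in> partitions2 k l" "represents k l p w" "w \<in> K"
        then show "T_mat N k l p \<in> bent N (span_words N K) k l"
          by (intro bentI[of "xi_word w"] span_words.gen T_mat_eq_fmat) (auto simp: represents_def)
      qed
    qed
    show "bent N (span_words N K) k l \<subseteq> mat_span (N ^ l) (N ^ k) ?S"
    proof
      fix A assume "A \<in> bent N (span_words N K) k l"
      then obtain f where f: "f \<in> span_words N K (l + k)" and A: "A = fmat N k l (\<lambda>u v. f (u @ rev v))"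
        unfolding bent_def by blast
      from f have "fmat N k l (\<lambda>u v. f (u @ rev v)) \<in> mat_span (N ^ l) (N ^ k) ?S"
      proof induction
        case (gen w)
        obtain p where p: "p \<in> partitions2 k l" "represents k l p w"
          using represents_exists_partition[OF gen(2)] .
        with gen have "p \<in> {p \<in> partitions2 k l. \<exists>w. represents k l p w \<and> w \<in> K}" by blast
        then have "T_mat N k l p \<in> mat_span (N ^ l) (N ^ k) ?S"
          by (intro subsetD[OF mat_span_gen[OF S]] imageI)
        then show ?case unfolding T_mat_eq_fmat[OF p] .
      next
        case zero
        from sub(1) show ?case unfolding fmat_zero[symmetric] by blast
      next
        case (add f g)
        with sub show ?case unfolding fmat_add[symmetric] by blast
      next
        case (scale f c)
        with sub show ?case unfolding fmat_smult[symmetric] by blast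
      next
        case (cong f g)
        have "fmat N k l (\<lambda>u v. f (u @ rev v)) = fmat N k l (\<lambda>u v. g (u @ rev v))"
          by (rule fmat_cong[OF N], rule cong(2)) (simp add: words_append words_rev)
        with cong show ?case by simp
      qed
      with A show "A \<in> mat_span (N ^ l) (N ^ k) ?S" by simp
    qed
  qed
qed

lemma P_dual_eq_bent: "0 < N \<Longrightarrow> P_dual N = bent N (span_words N UNIV)"
proof (intro ext)
  fix k l assume "0 < N"
  have "{p \<in> partitions2 k l. \<exists>w. represents k l p w \<and> w \<in> UNIV} = partitions2 k l"
    by (auto elim: represents_exists)
  with mat_span_eq_bent[OF word_class_UNIV \<open>0 < N\<close>, of l k]
  show "P_dual N k l = bent N (span_words N UNIV) k l" by (simp add: P_dual_def)
qed

lemma NC_dual_eq_bent: "0 < N \<Longrightarrow> NC_dual N = bent N (span_words N noncrossing_words)"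
proof (intro ext)
  fix k l assume "0 < N"
  have "\<exists>w. represents k l p w" if "p \<in> partitions2 k l" for p
    using represents_exists[OF that] by blast
  then have "{p \<in> partitions2 k l. \<exists>w. represents k l p w \<and> w \<in> noncrossing_words} =
      {p \<in> partitions2 k l. \<not> crossing k l p}"
    using crossing_iff_word by blast
  with mat_span_eq_bent[OF word_class_noncrossing \<open>0 < N\<close>, of l k]
  show "NC_dual N k l = bent N (span_words N noncrossing_words) k l" by (simp add: NC_dual_def)
qed

text \<open>Passage from the cyclic to the linear description: for \<open>a < c\<close>, exactly one
  of \<open>b\<close>, \<open>d\<close> lies between them and the other lies to the left of
  \<open>a\<close> or to the right of \<open>c\<close>, which gives four linear
  arrangements.\<close>

lemma crossing_on_iff_word: "crossing_on {..<length w} ((!) w) \<longleftrightarrow> w \<notin> noncrossing_words"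
proof
  assume "crossing_on {..<length w} ((!) w)"
  then obtain a c b d where "a < length w" "c < length w" "b < length w" "d < length w"
    "chords_cross a c b d" "w ! a = w ! c" "w ! b = w ! d" "w ! a \<noteq> w ! b"
    by (auto elim!: crossing_onE)
  then have "\<exists>a b c d. a < b \<and> b < c \<and> c < d \<and> d < length w \<and>
      w ! a = w ! c \<and> w ! b = w ! d \<and> w ! a \<noteq> w ! b"
  proof (induction a c arbitrary: b d rule: linorder_wlog)
    case (le a c)
    show ?case
    proof (cases "a < b \<and> b < c")
      case True
      with le have "d < a \<or> c < d" unfolding chords_cross_iff by linarith
      then show ?thesis
      proof
        assume "d < a"
        with True le show ?thesis by (intro exI[of _ d] exI[of _ a] exI[of _ b] exI[of _ c]) auto
      next
        assume "c < d"
        with True le show ?thesis by (intro exI[of _ a] exI[of _ b] exI[of _ c] exI[of _ d]) auto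
      qed
    next
      case False
      with le have "(b < a \<or> c < b) \<and> a < d \<and> d < c" unfolding chords_cross_iff by linarith
      then show ?thesis
      proof (elim conjE disjE)
        assume "a < d" "d < c" "b < a"
        with le show ?thesis by (intro exI[of _ b] exI[of _ a] exI[of _ d] exI[of _ c]) auto
      next
        assume "a < d" "d < c" "c < b"
        with le show ?thesis by (intro exI[of _ a] exI[of _ d] exI[of _ c] exI[of _ b]) auto
      qed
    qed
  next
    case (sym a c)
    show ?case
      by (rule sym(1)[of b d]) (use sym(2-) chords_cross_sym(1)[of a c b d] in auto)
  qed
  then show "w \<notin> noncrossing_words" unfolding noncrossing_words_iff by blast
next
  assume "w \<notin> noncrossing_words"
  then obtain a b c d where "a < b" "b < c" "c < d" "d < length w"
      "w ! a = w ! c" "w ! b = w ! d" "w ! a \<noteq> w ! b"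
    unfolding noncrossing_words_iff by blast
  then show "crossing_on {..<length w} ((!) w)"
    by (intro crossing_onI[of a _ c b d]) (auto simp: chords_cross_iff)
qed

section \<open>Operations on crossing vectors\<close>

lemma crossing_on_list:
  assumes "sorted_wrt (<) L"
  shows "crossing_on (set L) w \<longleftrightarrow> map w L \<notin> noncrossing_words"
proof -
  have less: "L ! i < L ! j \<longleftrightarrow> i < j" if "i < length L" "j < length L" for i j
  proof -
    have "i < j \<Longrightarrow> L ! i < L ! j" "j < i \<Longrightarrow> L ! j < L ! i"
      using sorted_wrt_nth_less[OF assms] that by blast+
    then show ?thesis by (cases i j rule: linorder_cases) auto
  qed
  have eq: "L ! i = L ! j \<longleftrightarrow> i = j" if "i < length L" "j < length L" for i j
    using less[OF that] less[OF that(2,1)] by (cases i j rule: linorder_cases) auto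
  have cc: "chords_cross (L ! a) (L ! c) (L ! b) (L ! d) \<longleftrightarrow> chords_cross a c b d"
    if "a < length L" "c < length L" "b < length L" "d < length L" for a b c d
    using that by (simp add: chords_cross_iff less eq)
  have "crossing_on (set L) w \<longleftrightarrow> crossing_on {..<length (map w L)} ((!) (map w L))"
  proof
    assume "crossing_on (set L) w"
    then obtain x z y t where q: "x \<in> set L" "z \<in> set L" "y \<in> set L" "t \<in> set L"
      "chords_cross x z y t" "w x = w z" "w y = w t" "w x \<noteq> w y" by (rule crossing_onE)
    from q(1-4) obtain a c b d where "a < length L" "x = L ! a" "c < length L" "z = L ! c"
      "b < length L" "y = L ! b" "d < length L" "t = L ! d" by (auto simp: in_set_conv_nth)
    with q(5-8) show "crossing_on {..<length (map w L)} ((!) (map w L))"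
      by (intro crossing_onI[of a _ c b d]) (simp_all add: cc)
  next
    assume "crossing_on {..<length (map w L)} ((!) (map w L))"
    then obtain a c b d where "a < length L" "c < length L" "b < length L" "d < length L"
      "chords_cross a c b d" "map w L ! a = map w L ! c" "map w L ! b = map w L ! d"
      "map w L ! a \<noteq> map w L ! b"
      by (elim crossing_onE) auto
    then show "crossing_on (set L) w"
      by (intro crossing_onI[of "L ! a" _ "L ! c" "L ! b" "L ! d"]) (simp_all add: cc)
  qed
  then show ?thesis unfolding crossing_on_iff_word .
qed

text \<open>Labellings of a set of points, instead of words, allow points to be deleted without
  renumbering the others.\<close>

definition xi_on :: "nat set \<Rightarrow> (nat \<Rightarrow> nat) \<Rightarrow> (nat \<Rightarrow> nat) \<Rightarrow> complex" where
  "xi_on A w \<phi> = (if \<forall>x\<in>A. \<forall>y\<in>A. w x = w y \<longrightarrow> \<phi> x = \<phi> y then 1 else 0)"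

lemma xi_on_list: "xi_on (set L) w \<phi> = xi_word (map w L) (map \<phi> L)"
proof -
  have "(\<forall>x\<in>set L. \<forall>y\<in>set L. w x = w y \<longrightarrow> \<phi> x = \<phi> y) \<longleftrightarrow> (\<exists>h. map \<phi> L = map h (map w L))"
    by (subst xi_word_iff) (auto simp: all_set_conv_all_nth)
  then show ?thesis by (simp add: xi_on_def xi_word_def)
qed

lemma xi_on_cong: "same_kernel A v w \<Longrightarrow> xi_on A v \<phi> = xi_on A w \<phi>"
  unfolding xi_on_def same_kernel_def by (intro if_cong refl) blast

text \<open>If the block of \<open>e\<close> contains another point \<open>x\<close>, only the label
  \<open>a = \<phi> x\<close> contributes; otherwise all \<open>N\<close> labels do.\<close>

lemma xi_on_delete:
  assumes e: "e \<in> A" and \<phi>: "\<And>x. \<phi> x < N"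
  shows "(\<Sum>a<N. xi_on A w (\<phi>(e := a))) = delete_weight N A e w * xi_on (A - {e}) w \<phi>"
proof -
  have iff: "(\<forall>x\<in>A. \<forall>y\<in>A. w x = w y \<longrightarrow> (\<phi>(e := a)) x = (\<phi>(e := a)) y) \<longleftrightarrow>
      (\<forall>x\<in>A - {e}. \<forall>y\<in>A - {e}. w x = w y \<longrightarrow> \<phi> x = \<phi> y) \<and> (\<forall>x\<in>A - {e}. w x = w e \<longrightarrow> \<phi> x = a)" for a
  proof (intro iffI conjI ballI impI)
    fix x y assume *: "\<forall>x\<in>A. \<forall>y\<in>A. w x = w y \<longrightarrow> (\<phi>(e := a)) x = (\<phi>(e := a)) y"
      and "x \<in> A - {e}" "y \<in> A - {e}" "w x = w y"
    then show "\<phi> x = \<phi> y" using *[THEN bspec, THEN bspec, THEN mp, of x y] by simp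
  next
    fix x assume *: "\<forall>x\<in>A. \<forall>y\<in>A. w x = w y \<longrightarrow> (\<phi>(e := a)) x = (\<phi>(e := a)) y"
      and "x \<in> A - {e}" "w x = w e"
    then show "\<phi> x = a" using *[THEN bspec, THEN bspec, THEN mp, of x e] e by simp
  next
    fix x y assume *: "(\<forall>x\<in>A - {e}. \<forall>y\<in>A - {e}. w x = w y \<longrightarrow> \<phi> x = \<phi> y) \<and> (\<forall>x\<in>A - {e}. w x = w e \<longrightarrow> \<phi> x = a)"
      and xy: "x \<in> A" "y \<in> A" "w x = w y"
    have 1: "\<phi> x = \<phi> y" if "x \<noteq> e" "y \<noteq> e" using * xy that by blast
    have 2: "\<phi> z = a" if "z \<noteq> e" "z \<in> A" "w z = w e" for z using * that by blast
    show "(\<phi>(e := a)) x = (\<phi>(e := a)) y"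
      using 1 2[of x] 2[of y] xy by (cases "x = e"; cases "y = e") simp_all
  qed
  define P where "P \<longleftrightarrow> (\<forall>x\<in>A - {e}. \<forall>y\<in>A - {e}. w x = w y \<longrightarrow> \<phi> x = \<phi> y)"
  define Q where "Q a \<longleftrightarrow> (\<forall>x\<in>A - {e}. w x = w e \<longrightarrow> \<phi> x = a)" for a
  have xi: "xi_on A w (\<phi>(e := a)) = (if P \<and> Q a then 1 else 0)" for a
    by (simp only: xi_on_def iff P_def Q_def)
  have xi': "xi_on (A - {e}) w \<phi> = (if P then 1 else 0)"
    by (simp only: xi_on_def P_def)
  show ?thesis
  proof (cases P)
    case False
    then show ?thesis unfolding xi xi' by simp
  next
    case True
    show ?thesis
    proof (cases "\<exists>x\<in>A - {e}. w x = w e")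
      case ex: True
      then obtain x where x: "x \<in> A - {e}" "w x = w e" by blast
      have "Q a \<longleftrightarrow> a = \<phi> x" for a
      proof
        assume "Q a"
        then show "a = \<phi> x" using x by (auto simp: Q_def)
      next
        assume a: "a = \<phi> x"
        show "Q a" unfolding Q_def
        proof (intro ballI impI)
          fix y assume "y \<in> A - {e}" "w y = w e"
          then show "\<phi> y = a" using True[unfolded P_def, THEN bspec, THEN bspec, THEN mp, of y x] x a by simp
        qed
      qed
      then have "(\<Sum>a<N. xi_on A w (\<phi>(e := a))) = (\<Sum>a<N. if a = \<phi> x then 1 else 0)"
        unfolding xi using True by simp
      also have "\<dots> = 1" using \<phi> by simp
      finally show ?thesis using True ex by (simp add: delete_weight_def xi')
    next
      case nex: False
      then have "Q a" for a by (auto simp: Q_def)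
      then have "(\<Sum>a<N. xi_on A w (\<phi>(e := a))) = of_nat N"
        unfolding xi using True by simp
      moreover have "delete_weight N A e w = of_nat N"
        using nex unfolding delete_weight_def by (simp only: if_False)
      ultimately show ?thesis using True by (simp add: xi')
    qed
  qed
qed

lemma xi_on_fuse:
  assumes "e \<in> A" "e' \<in> A" "e \<noteq> e'"
  shows "xi_on A w (\<phi>(e := \<phi> e')) = xi_on (A - {e}) (fuse e e' w) \<phi>"
proof -
  let ?\<psi> = "\<phi>(e := \<phi> e')"
  have "(\<forall>x\<in>A. \<forall>y\<in>A. w x = w y \<longrightarrow> ?\<psi> x = ?\<psi> y) \<longleftrightarrow>
      (\<forall>x\<in>A - {e}. \<forall>y\<in>A - {e}. fuse e e' w x = fuse e e' w y \<longrightarrow> \<phi> x = \<phi> y)"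
  proof (intro iffI ballI impI)
    fix x y assume *: "\<forall>x\<in>A. \<forall>y\<in>A. w x = w y \<longrightarrow> ?\<psi> x = ?\<psi> y"
      and xy: "x \<in> A - {e}" "y \<in> A - {e}" "fuse e e' w x = fuse e e' w y"
    have R: "?\<psi> x = ?\<psi> y" if "x \<in> A" "y \<in> A" "w x = w y" for x y
      using * that by blast
    have r: "\<phi> z = \<phi> e'" if "z \<in> A - {e}" "w z = w e \<or> w z = w e'" for z
      using that(2)
    proof
      assume "w z = w e"
      then show ?thesis using R[of z e] that(1) assms by simp
    next
      assume "w z = w e'"
      then show ?thesis using R[of z e'] that(1) assms by simp
    qed
    have "w x = w y \<or> (w x = w e \<or> w x = w e') \<and> (w y = w e \<or> w y = w e')"
      using xy(3) by (cases "w x = w e"; cases "w y = w e") (simp_all add: fuse_def)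
    then show "\<phi> x = \<phi> y"
    proof
      assume "w x = w y"
      then show ?thesis using R[of x y] xy by simp
    next
      assume "(w x = w e \<or> w x = w e') \<and> (w y = w e \<or> w y = w e')"
      then show ?thesis using r[of x] r[of y] xy by simp
    qed
  next
    fix x y assume *: "\<forall>x\<in>A - {e}. \<forall>y\<in>A - {e}. fuse e e' w x = fuse e e' w y \<longrightarrow> \<phi> x = \<phi> y"
      and xy: "x \<in> A" "y \<in> A" "w x = w y"
    have R: "\<phi> x = \<phi> y" if "x \<in> A - {e}" "y \<in> A - {e}" "fuse e e' w x = fuse e e' w y" for x y
      using * that by blast
    have r: "\<phi> z = \<phi> e'" if "z \<in> A - {e}" "w z = w e" for z
      using R[of z e'] that assms by (simp add: fuse_def)
    have f: "fuse e e' w x = fuse e e' w y" using xy(3) by (simp add: fuse_def)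
    show "?\<psi> x = ?\<psi> y"
      using r[of x] r[of y] R[OF _ _ f] xy by (cases "x = e"; cases "y = e") simp_all
  qed
  then show ?thesis by (simp add: xi_on_def)
qed

text \<open>Cyclic neighbours can be rotated to the first two places, where
  \<open>fuse_first\<close> acts. They are adjacent in \<open>L\<close>, or the first and the last
  entry, in which case the rotation swaps their order.\<close>

lemma sorted_neighbours:
  assumes L: "sorted_wrt (<) L" and nb: "neighbours (set L) e e'"
  obtains M xs ys where "L = xs @ ys" "ys @ xs = e # e' # M \<or> ys @ xs = e' # e # M"
proof -
  have main: "\<exists>M xs ys. L = xs @ ys \<and> (ys @ xs = e # e' # M \<or> ys @ xs = e' # e # M)"
    if "e < e'" "neighbours (set L) e e'" for e e'
  proof -
    from that have A: "e \<in> set L" "e' \<in> set L" by (auto simp: neighbours_def)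
    then obtain xs ys where xs: "L = xs @ e # ys" by (meson split_list)
    have lt: "\<forall>x\<in>set xs. x < e" "\<forall>y\<in>set ys. e < y" "sorted_wrt (<) ys"
      using L xs by (auto simp: sorted_wrt_append)
    have e': "e' \<in> set ys" using A xs lt that by auto
    then obtain ps qs where ps: "ys = ps @ e' # qs" by (meson split_list)
    have lt': "\<forall>x\<in>set ps. x < e'" "\<forall>y\<in>set qs. e' < y"
      using lt(3) ps by (auto simp: sorted_wrt_append)
    from that(2) consider "\<forall>x\<in>set L. \<not> between e e' x" | "\<forall>x\<in>set L - {e, e'}. between e e' x"
      unfolding neighbours_def by blast
    then show ?thesis
    proof cases
      case 1
      have "ps = []"
      proof (cases ps)
        case (Cons z zs)
        then have "between e e' z" "z \<in> set L" using lt lt' xs ps by (auto simp: between_def)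
        with 1 show ?thesis by blast
      qed
      then have "L = xs @ (e # e' # qs)" "(e # e' # qs) @ xs = e # e' # (qs @ xs)" using xs ps by auto
      then show ?thesis by metis
    next
      case 2
      have "xs = []"
      proof (cases xs)
        case (Cons z zs)
        then have z: "z < e" "z \<in> set L" using lt xs by auto
        then have "between e e' z" using that(1) by (intro bspec[OF 2]) simp
        with z that(1) show ?thesis by (simp add: between_def)
      qed
      moreover have "qs = []"
      proof (cases qs)
        case (Cons z zs)
        then have z: "e' < z" "z \<in> set L" using lt' xs ps by auto
        then have "between e e' z" using that(1) by (intro bspec[OF 2]) simp
        with z that(1) show ?thesis by (simp add: between_def)
      qed
      ultimately have "L = (e # ps) @ [e']" "[e'] @ (e # ps) = e' # e # ps" using xs ps by auto
      then show ?thesis by metis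
    qed
  qed
  have "e \<noteq> e'" using nb by (simp add: neighbours_def)
  then have "\<exists>M xs ys. L = xs @ ys \<and> (ys @ xs = e # e' # M \<or> ys @ xs = e' # e # M)"
    using main[of e e'] main[of e' e] nb neighbours_commute[of "set L" e e']
    by (cases e e' rule: linorder_cases) auto
  then show thesis using that by (elim exE conjE)
qed

text \<open>The cyclic predecessor and successor are distinct because there are at least three
  points.\<close>

lemma two_neighbours_exist:
  assumes L: "sorted_wrt (<) L" and "3 \<le> length L" "e \<in> set L"
  shows "\<exists>e1 e2. e1 \<noteq> e2 \<and> neighbours (set L) e e1 \<and> neighbours (set L) e e2"
proof -
  obtain xs ys where xs: "L = xs @ e # ys" using assms(3) by (meson split_list)
  consider "xs \<noteq> []" "ys \<noteq> []" | "xs = []" "2 \<le> length ys" | "ys = []" "2 \<le> length xs"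
    using assms(2) xs by (cases xs; cases ys) auto
  then show ?thesis
  proof cases
    case 1
    then obtain xs' p s ys' where "xs = xs' @ [p]" "ys = s # ys'"
      by (metis append_butlast_last_id list.exhaust)
    with L xs have "p \<noteq> s" "neighbours (set L) e p" "neighbours (set L) e s"
      by (auto simp: sorted_wrt_append neighbours_def between_def)
    then show ?thesis by blast
  next
    case 2
    then obtain s ps p where "ys = s # ps @ [p]"
      by (metis One_nat_def Suc_1 Suc_le_length_iff append_butlast_last_id list.distinct(1))
    with L xs 2 have "p \<noteq> s" "neighbours (set L) e p" "neighbours (set L) e s"
      by (auto simp: sorted_wrt_append neighbours_def between_def)
    then show ?thesis by blast
  next
    case 3
    then obtain s ps p where "xs = s # ps @ [p]"
      by (metis One_nat_def Suc_1 Suc_le_length_iff append_butlast_last_id list.distinct(1))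
    with L xs 3 have "p \<noteq> s" "neighbours (set L) e p" "neighbours (set L) e s"
      by (auto simp: sorted_wrt_append neighbours_def between_def)
    then show ?thesis by blast
  qed
qed

section \<open>Operations supplied by the non-crossing partitions and by the basic crossing\<close>

locale planar_noncrossing = planar +
  assumes noncrossing: "w \<in> noncrossing_words \<Longrightarrow> length w = n \<Longrightarrow> xi_word w \<in> V n"
begin

lemma sum_V: "finite J \<Longrightarrow> (\<And>j. j \<in> J \<Longrightarrow> f j \<in> V n) \<Longrightarrow> (\<lambda>u. \<Sum>j\<in>J. f j u) \<in> V n"
proof (induction rule: finite_induct)
  case (insert j J)
  then show ?case using add[of "f j" n "\<lambda>u. \<Sum>j\<in>J. f j u"] by simp
qed (simp add: zero)

lemma constant_word_noncrossing: "replicate n 0 \<in> noncrossing_words"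
  by (rule noncrossing_wordsI) (auto dest!: subseq_subset split: if_splits)

text \<open>The one-point partition is the all-ones vector; contracting it with a leg sums that leg
  out.\<close>

lemma delete_first:
  assumes "f \<in> V (Suc n)"
  shows "(\<lambda>u. \<Sum>a<N. f (a # u)) \<in> V n"
proof -
  have "xi_word [0] \<in> V 1" using noncrossing constant_word_noncrossing[of 1] by simp
  from contract[of "\<lambda>u. xi_word [0] (take 1 u) * f (drop 1 u)" n] tensor[OF this assms]
  have "(\<lambda>u. \<Sum>a<N. xi_word [0] (take 1 (a # a # u)) * f (drop 1 (a # a # u))) \<in> V n" by simp
  moreover have "xi_word [0] [a] = 1" for a by (auto simp: xi_word_def)
  ultimately show ?thesis by simp
qed

text \<open>Two nested contractions glue the last two legs of \<open>g\<close> to the first two of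
  \<open>f\<close>, so that \<open>g\<close> acts on \<open>f\<close> as an operator from two legs
  to \<open>m\<close> legs.\<close>

lemma contract_two:
  assumes "g \<in> V (m + 2)" "f \<in> V (Suc (Suc n))"
  shows "(\<lambda>u. \<Sum>a<N. \<Sum>b<N. g (take m u @ [a, b]) * f (b # a # drop m u)) \<in> V (m + n)"
proof -
  let ?t = "\<lambda>u. g (take (m + 2) u) * f (drop (m + 2) u)"
  have "?t \<in> V (Suc m + Suc (Suc (Suc n)))" using tensor[OF assms] by simp
  then have "(\<lambda>u. \<Sum>b<N. ?t (take (Suc m) u @ b # b # drop (Suc m) u)) \<in> V (Suc m + Suc n)"
    by (rule contract_at)
  then have "(\<lambda>u. \<Sum>b<N. ?t (take (Suc m) u @ b # b # drop (Suc m) u)) \<in> V (m + Suc (Suc n))" by simp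
  from contract_at[OF this] show ?thesis
  proof (rule cong)
    fix u assume "u \<in> words N (m + n)"
    then have "length u = m + n" by (rule wordsD)
    then show "(\<Sum>a<N. \<Sum>b<N. ?t (take (Suc m) (take m u @ a # a # drop m u) @ b # b #
        drop (Suc m) (take m u @ a # a # drop m u))) =
        (\<Sum>a<N. \<Sum>b<N. g (take m u @ [a, b]) * f (b # a # drop m u))" by simp
  qed
qed

text \<open>As an operator, the three-point block merges two legs into one by evaluating
  \<open>f\<close> on equal indices.\<close>

lemma fuse_first:
  assumes "f \<in> V (Suc (Suc n))"
  shows "(\<lambda>u. f (hd u # u)) \<in> V (Suc n)"
proof -
  have "xi_word [0, 0, 0] \<in> V (1 + 2)"
    using noncrossing[OF constant_word_noncrossing[of 3]] by (simp add: numeral_3_eq_3)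
  from contract_two[OF this assms] show ?thesis
    unfolding plus_1_eq_Suc
  proof (rule cong)
    fix u assume "u \<in> words N (Suc n)"
    then obtain c u' where u: "u = c # u'" "c < N" by (auto simp: words_Suc)
    have xi: "xi_word [0, 0, 0] [c, a, b] = (if c = a then 1 else 0) * (if c = b then 1 else 0)" for a b
      by (auto simp: xi_word_def)
    have "(\<Sum>a<N. \<Sum>b<N. xi_word [0, 0, 0] (take 1 u @ [a, b]) * f (b # a # drop 1 u)) =
        (\<Sum>a<N. (if c = a then 1 else 0) * (\<Sum>b<N. (if c = b then 1 else 0) * f (b # a # u')))"
      by (simp add: u xi sum_distrib_left mult.assoc)
    also have "\<dots> = f (c # c # u')" using u by (simp add: sum_delta_mult)
    finally show "(\<Sum>a<N. \<Sum>b<N. xi_word [0, 0, 0] (take 1 u @ [a, b]) * f (b # a # drop 1 u)) = f (hd u # u)"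
      by (simp add: u)
  qed
qed

text \<open>As an operator from two legs to two legs, the basic crossing is the flip.\<close>

lemma swap_first:
  assumes "xi_word [0, 1, 0, 1] \<in> V 4" "f \<in> V (Suc (Suc n))"
  shows "(\<lambda>u. f (u ! 1 # u ! 0 # drop 2 u)) \<in> V (Suc (Suc n))"
proof -
  have "xi_word [0, 1, 0, 1] \<in> V (2 + 2)" using assms(1) by simp
  from contract_two[OF this assms(2)] have "(\<lambda>u. \<Sum>a<N. \<Sum>b<N.
      xi_word [0, 1, 0, 1] (take 2 u @ [a, b]) * f (b # a # drop 2 u)) \<in> V (Suc (Suc n))" by simp
  then show ?thesis
  proof (rule cong)
    fix u assume "u \<in> words N (Suc (Suc n))"
    then obtain c d u' where u: "u = c # d # u'" "c < N" "d < N" by (auto simp: words_Suc)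
    have "(\<exists>h. [c, d, a, b] = map h [0, 1, 0, 1 :: nat]) \<longleftrightarrow> a = c \<and> b = d" for a b
      by (auto intro!: exI[of _ "\<lambda>i. if i = 0 then c else d"])
    then have xi: "xi_word [0, 1, 0, 1] [c, d, a, b] = (if c = a then 1 else 0) * (if d = b then 1 else 0)" for a b
      by (auto simp: xi_word_def)
    have "(\<Sum>a<N. \<Sum>b<N. xi_word [0, 1, 0, 1] (take 2 u @ [a, b]) * f (b # a # drop 2 u)) =
        (\<Sum>a<N. (if c = a then 1 else 0) * (\<Sum>b<N. (if d = b then 1 else 0) * f (b # a # u')))"
      using xi by (simp add: u sum_distrib_left mult.assoc numeral_2_eq_2)
    also have "\<dots> = f (d # c # u')" using u by (simp add: sum_delta_mult)
    finally show "(\<Sum>a<N. \<Sum>b<N. xi_word [0, 1, 0, 1] (take 2 u @ [a, b]) * f (b # a # drop 2 u)) =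
        f (u ! 1 # u ! 0 # drop 2 u)"
      by (simp add: u)
  qed
qed

lemma xi_word_in_V_append_commute:
  assumes "xi_word (xs @ ys) \<in> V (length (xs @ ys))"
  shows "xi_word (ys @ xs) \<in> V (length (ys @ xs))"
proof -
  from rotate[OF assms, of "length ys"]
  have "(\<lambda>u. xi_word (xs @ ys) (rotate (length ys) u)) \<in> V (length (ys @ xs))" by (simp add: add.commute)
  then show ?thesis
  proof (rule cong)
    fix u assume "u \<in> words N (length (ys @ xs))"
    then have "length u = length ys + length xs" by (auto dest: wordsD)
    then obtain u1 u2 where u: "u = u1 @ u2" "length u1 = length ys" "length u2 = length xs"
      by (metis append_take_drop_id diff_add_inverse le_add1 length_drop length_take min.absorb2)
    have "rotate (length ys) u = u2 @ u1" using rotate_append[of u1 u2] u by simp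
    moreover have "u2 @ u1 = map h (xs @ ys) \<longleftrightarrow> u = map h (ys @ xs)" for h :: "nat \<Rightarrow> nat"
      using u by auto
    ultimately show "xi_word (xs @ ys) (rotate (length ys) u) = xi_word (ys @ xs) u"
      by (simp add: xi_word_def)
  qed
qed

context
  assumes cross: "xi_word [0, 1, 0, 1] \<in> V 4"
begin

lemma xi_word_in_V_swap:
  assumes "xi_word (p @ x # y # s) \<in> V (length (p @ x # y # s))"
  shows "xi_word (p @ y # x # s) \<in> V (length (p @ y # x # s))"
proof -
  have "xi_word (x # y # s @ p) \<in> V (Suc (Suc (length (s @ p))))"
    using xi_word_in_V_append_commute[of p "x # y # s"] assms by simp
  from swap_first[OF cross this] have "xi_word (y # x # s @ p) \<in> V (Suc (Suc (length (s @ p))))"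
  proof (rule cong)
    fix u assume "u \<in> words N (Suc (Suc (length (s @ p))))"
    then obtain c d u' where u: "u = c # d # u'" by (auto simp: words_Suc)
    show "xi_word (x # y # s @ p) (u ! 1 # u ! 0 # drop 2 u) = xi_word (y # x # s @ p) u"
      unfolding xi_word_def u by (intro if_cong refl ex_cong) auto
  qed
  then show ?thesis using xi_word_in_V_append_commute[of "y # x # s" p] by simp
qed

lemma xi_word_in_V_move:
  "xi_word (p @ u @ x # v) \<in> V (length (p @ u @ x # v)) \<Longrightarrow>
   xi_word (p @ x # u @ v) \<in> V (length (p @ x # u @ v))"
proof (induction u arbitrary: v rule: rev_induct)
  case (snoc y u)
  have "xi_word ((p @ u) @ x # y # v) \<in> V (length ((p @ u) @ x # y # v))"
    by (rule xi_word_in_V_swap) (use snoc.prems in simp)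
  then show ?case using snoc.IH[of "y # v"] by simp
qed simp

text \<open>Adjacent flips generate all permutations: the letters are moved to their target places
  one at a time, with \<open>p\<close> as the part already in order.\<close>

lemma xi_word_in_V_permute:
  "xi_word (p @ ys) \<in> V (length (p @ ys)) \<Longrightarrow> mset xs = mset ys \<Longrightarrow> xi_word (p @ xs) \<in> V (length (p @ xs))"
proof (induction xs arbitrary: p ys)
  case (Cons x xs)
  then have "x \<in> set ys" by (metis list.set_intros(1) set_mset_mset)
  then obtain u v where ys: "ys = u @ x # v" by (meson split_list)
  have "xi_word ((p @ [x]) @ u @ v) \<in> V (length ((p @ [x]) @ u @ v))"
    using xi_word_in_V_move[of p u x v] Cons.prems ys by simp
  moreover have "mset xs = mset (u @ v)" using Cons.prems(2) ys by simp
  ultimately have "xi_word ((p @ [x]) @ xs) \<in> V (length ((p @ [x]) @ xs))" by (rule Cons.IH)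
  then show ?case by simp
qed simp

lemma sorted_noncrossing: "sorted w \<Longrightarrow> w \<in> noncrossing_words"
  unfolding noncrossing_words_iff
proof (intro notI, elim exE conjE)
  fix a b c d assume s: "sorted w" and q: "a < b" "b < c" "c < d" "d < length w" "w ! a = w ! c" "w ! a \<noteq> w ! b"
  have "w ! a \<le> w ! b" "w ! b \<le> w ! c" 
    using sorted_nth_mono[OF s, of a b] sorted_nth_mono[OF s, of b c] q(1-4) by simp_all
  with q(5) have "w ! a = w ! b" by simp
  with q(6) show False by contradiction
qed

text \<open>Sorting the letters turns blocks into intervals, which do not cross; flips then undo the
  sorting.\<close>

lemma all_xi_word_in_V: "xi_word w \<in> V (length w)"
  using xi_word_in_V_permute[of "[]" "sort w" w] noncrossing[OF sorted_noncrossing[of "sort w"]] by simp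

lemma span_words_UNIV_subset: "f \<in> span_words N UNIV n \<Longrightarrow> f \<in> V n"
proof (induction rule: span_words.induct)
  case (gen w)
  then show ?case using all_xi_word_in_V by blast
next
  case (cong f g)
  then show ?case using planar.cong[OF planar_axioms] by blast
qed (auto intro: zero add scale)

end

text \<open>\<open>realised L g\<close>: the function \<open>g\<close> of a labelling of the points in \<open>L\<close> is a vector of the planar
  family, when the labels are read off in the order of \<open>L\<close>.\<close>

definition realised :: "nat list \<Rightarrow> ((nat \<Rightarrow> nat) \<Rightarrow> complex) \<Rightarrow> bool" where
  "realised L g \<longleftrightarrow> (\<exists>f\<in>V (length L). \<forall>\<phi>. (\<forall>x. \<phi> x < N) \<longrightarrow> g \<phi> = f (map \<phi> L))"

lemma realised_cong: "realised L g \<Longrightarrow> (\<And>\<phi>. (\<And>x. \<phi> x < N) \<Longrightarrow> g \<phi> = g' \<phi>) \<Longrightarrow> realised L g'"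
  unfolding realised_def by metis

lemma realised_diff:
  assumes "realised L g" "realised L h" shows "realised L (\<lambda>\<phi>. g \<phi> - h \<phi>)"
proof -
  from assms obtain f f' where f: "f \<in> V (length L)" "f' \<in> V (length L)"
    "\<And>\<phi>. (\<forall>x. \<phi> x < N) \<Longrightarrow> g \<phi> = f (map \<phi> L)" "\<And>\<phi>. (\<forall>x. \<phi> x < N) \<Longrightarrow> h \<phi> = f' (map \<phi> L)"
    unfolding realised_def by metis
  then show ?thesis
    unfolding realised_def using add[OF f(1) scale[OF f(2), of "-1"]]
    by (intro bexI[of _ "\<lambda>u. f u + - 1 * f' u"]) auto
qed

lemma realised_append_commute:
  assumes "realised (xs @ ys) g" shows "realised (ys @ xs) g"
proof -
  from assms obtain f where f: "f \<in> V (length (xs @ ys))"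
    "\<And>\<phi>. (\<forall>x. \<phi> x < N) \<Longrightarrow> g \<phi> = f (map \<phi> (xs @ ys))" unfolding realised_def by metis
  have "(\<lambda>u. f (List.rotate (length ys) u)) \<in> V (length (ys @ xs))"
    using rotate[OF f(1), of "length ys"] by (simp add: add.commute)
  moreover have "f (List.rotate (length ys) (map \<phi> (ys @ xs))) = f (map \<phi> (xs @ ys))" for \<phi>
    using rotate_append[of "map \<phi> ys" "map \<phi> xs"] by simp
  ultimately show ?thesis unfolding realised_def using f(2) by (intro bexI) auto
qed

lemma realised_delete:
  assumes "realised (xs @ e # ys) g" "e \<notin> set (xs @ ys)"
  shows "realised (xs @ ys) (\<lambda>\<phi>. \<Sum>a<N. g (\<phi>(e := a)))"
proof -
  from realised_append_commute[OF assms(1)] obtain f where f: "f \<in> V (Suc (length (ys @ xs)))"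
    "\<And>\<phi>. (\<forall>x. \<phi> x < N) \<Longrightarrow> g \<phi> = f (map \<phi> ((e # ys) @ xs))" unfolding realised_def by auto
  have "realised (ys @ xs) (\<lambda>\<phi>. \<Sum>a<N. g (\<phi>(e := a)))"
    unfolding realised_def
  proof (intro bexI allI impI)
    show "(\<lambda>u. \<Sum>a<N. f (a # u)) \<in> V (length (ys @ xs))" by (rule delete_first[OF f(1)])
    fix \<phi> :: "nat \<Rightarrow> nat" assume "\<forall>x. \<phi> x < N"
    then show "(\<Sum>a<N. g (\<phi>(e := a))) = (\<Sum>a<N. f (a # map \<phi> (ys @ xs)))"
      using assms(2) by (intro sum.cong refl) (simp add: f(2))
  qed
  then show ?thesis by (rule realised_append_commute)
qed

lemma realised_fuse:
  assumes "realised (xs @ ys) g" "ys @ xs = e # e' # M \<or> ys @ xs = e' # e # M" "distinct (xs @ ys)"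
  shows "realised (removeAll e (xs @ ys)) (\<lambda>\<phi>. g (\<phi>(e := \<phi> e')))"
proof -
  have d: "distinct (ys @ xs)" using assms(3) by auto
  then have "distinct (e # e' # M) \<or> distinct (e' # e # M)" using assms(2) by metis
  then have e: "e \<noteq> e'" "e \<notin> set M" by auto
  then have "removeAll e (e # e' # M) = e' # M" "removeAll e (e' # e # M) = e' # M" by auto
  then have rem: "removeAll e (ys @ xs) = e' # M" using assms(2) by metis
  from assms(2) have len: "length (ys @ xs) = Suc (Suc (length M))" by (metis length_Cons)
  from realised_append_commute[OF assms(1)] obtain f where f: "f \<in> V (length (ys @ xs))"
    "\<And>\<phi>. (\<forall>x. \<phi> x < N) \<Longrightarrow> g \<phi> = f (map \<phi> (ys @ xs))" unfolding realised_def by metis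
  have map: "map (\<phi>(e := \<phi> e')) (ys @ xs) = \<phi> e' # \<phi> e' # map \<phi> M" for \<phi>
    using assms(2)
  proof
    assume "ys @ xs = e # e' # M"
    then show ?thesis using e by (simp only:) simp
  next
    assume "ys @ xs = e' # e # M"
    then show ?thesis using e by (simp only:) simp
  qed
  have "realised (e' # M) (\<lambda>\<phi>. g (\<phi>(e := \<phi> e')))"
    unfolding realised_def
  proof (intro bexI allI impI)
    show "(\<lambda>u. f (hd u # u)) \<in> V (length (e' # M))" using fuse_first[OF f(1)[unfolded len]] by simp
    fix \<phi> :: "nat \<Rightarrow> nat" assume "\<forall>x. \<phi> x < N"
    then have "g (\<phi>(e := \<phi> e')) = f (map (\<phi>(e := \<phi> e')) (ys @ xs))" by (intro f(2)) simp
    then show "g (\<phi>(e := \<phi> e')) = f (hd (map \<phi> (e' # M)) # map \<phi> (e' # M))"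
      unfolding map by simp
  qed
  then have "realised (removeAll e ys @ removeAll e xs) (\<lambda>\<phi>. g (\<phi>(e := \<phi> e')))"
    using rem by simp
  from realised_append_commute[OF this] show ?thesis by simp
qed

lemma realised_noncrossing:
  assumes "sorted_wrt (<) L" "\<And>j. j \<in> J \<Longrightarrow> crossing_on (set L) (w j) \<Longrightarrow> \<alpha> j = 0" "finite J"
  shows "realised L (\<lambda>\<phi>. \<Sum>j\<in>J. \<alpha> j * xi_on (set L) (w j) \<phi>)"
  unfolding realised_def
proof (intro bexI allI impI)
  show "(\<lambda>u. \<Sum>j\<in>J. \<alpha> j * xi_word (map (w j) L) u) \<in> V (length L)"
  proof (rule sum_V[OF assms(3)])
    fix j assume "j \<in> J"
    show "(\<lambda>u. \<alpha> j * xi_word (map (w j) L) u) \<in> V (length L)"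
    proof (cases "crossing_on (set L) (w j)")
      case True
      then show ?thesis using assms(2) \<open>j \<in> J\<close> zero by simp
    next
      case False
      then show ?thesis using crossing_on_list[OF assms(1)] by (intro scale noncrossing) auto
    qed
  qed
qed (simp add: xi_on_list)

lemma realised_vector:
  assumes "realised L (\<lambda>\<phi>. f (map \<phi> L))" "distinct L"
  shows "f \<in> V (length L)"
proof -
  from assms(1) obtain f' where f': "f' \<in> V (length L)"
    "\<And>\<phi>. (\<forall>x. \<phi> x < N) \<Longrightarrow> f (map \<phi> L) = f' (map \<phi> L)" unfolding realised_def by auto
  from f'(1) show ?thesis
  proof (rule cong)
    fix u assume u: "u \<in> words N (length L)"
    then have lu: "length u = length L" by (rule wordsD)
    \<comment> \<open>The default label \<open>0\<close> outside \<open>L\<close> is admissible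
      since \<open>N > 0\<close>.\<close>
    define \<phi> where "\<phi> x = (case map_of (zip L u) x of Some c \<Rightarrow> c | None \<Rightarrow> 0)" for x
    have m: "map \<phi> L = u"
      by (rule nth_equalityI) (use assms(2) lu in \<open>simp_all add: \<phi>_def map_of_zip_nth\<close>)
    have "\<phi> x < N" for x
    proof (cases "x \<in> set L")
      case True
      then have "\<phi> x \<in> set u" using m by (metis imageI set_map)
      then show ?thesis using u by (auto simp: words_def)
    next
      case False
      then have "map_of (zip L u) x = None" using lu by (simp add: map_of_zip_is_None)
      then show ?thesis using N by (simp add: \<phi>_def)
    qed
    with f'(2)[of \<phi>] m show "f' u = f u" by simp
  qed
qed

end

section \<open>Descent to the basic crossing\<close>

lemma kernel_representatives:
  assumes "finite J"
  obtains R where "R \<subseteq> J" "\<And>i j. i \<in> R \<Longrightarrow> j \<in> R \<Longrightarrow> same_kernel A (w i) (w j) \<Longrightarrow> i = j"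
    "\<And>i. i \<in> J \<Longrightarrow> \<exists>r\<in>R. same_kernel A (w i) (w r)"
proof -
  from assms have "\<exists>R\<subseteq>J. (\<forall>i\<in>R. \<forall>j\<in>R. same_kernel A (w i) (w j) \<longrightarrow> i = j) \<and>
      (\<forall>i\<in>J. \<exists>r\<in>R. same_kernel A (w i) (w r))"
  proof (induction rule: finite_induct)
    case (insert j J)
    then obtain R where R: "R \<subseteq> J" "\<forall>i\<in>R. \<forall>j\<in>R. same_kernel A (w i) (w j) \<longrightarrow> i = j"
      "\<forall>i\<in>J. \<exists>r\<in>R. same_kernel A (w i) (w r)" by auto
    show ?case
    proof (cases "\<exists>r\<in>R. same_kernel A (w j) (w r)")
      case True
      with R show ?thesis by (intro exI[of _ R]) auto
    next
      case False
      then have "\<forall>i\<in>R. \<not> same_kernel A (w i) (w j)" using same_kernel_sym by blast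
      with False R show ?thesis by (intro exI[of _ "insert j R"]) auto
    qed
  qed simp
  then show thesis using that by blast
qed

text \<open>The formal coefficient of the partition of \<open>i\<close> after equal terms are
  collected.\<close>

abbreviation class_weight :: "nat set \<Rightarrow> nat set \<Rightarrow> (nat \<Rightarrow> nat \<Rightarrow> nat) \<Rightarrow> (nat \<Rightarrow> complex) \<Rightarrow> nat \<Rightarrow> complex" where
  "class_weight A J w \<alpha> i \<equiv> \<Sum>j | j \<in> J \<and> same_kernel A (w i) (w j). \<alpha> j"

lemma class_weight_cong:
  assumes "same_kernel A (w i) (w r)"
  shows "class_weight A J w \<alpha> i = class_weight A J w \<alpha> r"
proof (rule sum.cong)
  show "{j. j \<in> J \<and> same_kernel A (w i) (w j)} = {j. j \<in> J \<and> same_kernel A (w r) (w j)}"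
    using assms same_kernel_sym same_kernel_trans by blast
qed simp

lemma sum_xi_on_representatives:
  assumes J: "finite J" and R: "R \<subseteq> J"
    and "\<And>i j. i \<in> R \<Longrightarrow> j \<in> R \<Longrightarrow> same_kernel A (w i) (w j) \<Longrightarrow> i = j"
    and "\<And>i. i \<in> J \<Longrightarrow> \<exists>r\<in>R. same_kernel A (w i) (w r)"
  shows "(\<Sum>j\<in>J. \<alpha> j * xi_on A (w j) \<phi>) = (\<Sum>r\<in>R. class_weight A J w \<alpha> r * xi_on A (w r) \<phi>)"
proof -
  let ?cls = "\<lambda>r. {j. j \<in> J \<and> same_kernel A (w r) (w j)}"
  have "J = (\<Union>r\<in>R. ?cls r)" using assms(4) same_kernel_sym by blast
  then have "(\<Sum>j\<in>J. \<alpha> j * xi_on A (w j) \<phi>) = (\<Sum>j\<in>(\<Union>r\<in>R. ?cls r). \<alpha> j * xi_on A (w j) \<phi>)" by simp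
  also have "\<dots> = (\<Sum>r\<in>R. \<Sum>j\<in>?cls r. \<alpha> j * xi_on A (w j) \<phi>)"
  proof (rule sum.UNION_disjoint)
    show "finite R" using J R finite_subset by blast
    show "\<forall>r\<in>R. finite (?cls r)" using J by simp
    show "\<forall>i\<in>R. \<forall>j\<in>R. i \<noteq> j \<longrightarrow> ?cls i \<inter> ?cls j = {}"
      using assms(3) same_kernel_sym same_kernel_trans by blast
  qed
  also have "\<dots> = (\<Sum>r\<in>R. class_weight A J w \<alpha> r * xi_on A (w r) \<phi>)"
    unfolding sum_distrib_right by (intro sum.cong refl) (auto simp: xi_on_cong)
  finally show ?thesis .
qed

lemma xi_word_alternating: "p \<noteq> q \<Longrightarrow> xi_word [p, q, p, q] u = xi_word [0, 1, 0, 1] u"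
proof -
  assume pq: "p \<noteq> q"
  have "(\<exists>h. u = map h [p, q, p, q]) \<longleftrightarrow> (\<exists>h. u = map h [0, 1, 0, 1 :: nat])"
  proof
    assume "\<exists>h. u = map h [p, q, p, q]"
    then obtain h where "u = map h [p, q, p, q]" by blast
    then show "\<exists>h. u = map h [0, 1, 0, 1 :: nat]"
      by (intro exI[of _ "\<lambda>i. if i = 0 then h p else h q"]) simp
  next
    assume "\<exists>h. u = map h [0, 1, 0, 1 :: nat]"
    then obtain h where "u = map h [0, 1, 0, 1 :: nat]" by blast
    then show "\<exists>h. u = map h [p, q, p, q]"
      using pq by (intro exI[of _ "\<lambda>i. if i = p then h 0 else h 1"]) simp
  qed
  then show ?thesis by (simp only: xi_word_def)
qed

lemma crossing_on_four:
  assumes "sorted_wrt (<) [a, b, c, d]" "crossing_on (set [a, b, c, d]) w"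
  shows "w a = w c \<and> w b = w d \<and> w a \<noteq> w b"
proof -
  let ?l = "map w [a, b, c, d]"
  from assms have "?l \<notin> noncrossing_words" using crossing_on_list by blast
  then obtain i j s t where q: "i < j" "j < s" "s < t" "t < length ?l"
    "?l ! i = ?l ! s" "?l ! j = ?l ! t" "?l ! i \<noteq> ?l ! j"
    unfolding noncrossing_words_iff by blast
  then have "i = 0" "j = 1" "s = 2" "t = 3" by auto
  with q(5-7) show ?thesis by simp
qed

text \<open>Deleting and fusing create repeated and non-crossing terms, so the statement allows both
  and asks only for one crossing class of non-zero total weight. Each round passes to
  representatives \<open>R\<close>, then subtracts the non-crossing part to reach
  \<open>J'\<close>.\<close>

lemma (in planar_noncrossing) crossing_vector_descent:
  assumes N2: "2 \<le> N"
  shows "finite A \<Longrightarrow> 4 \<le> card A \<Longrightarrow> finite J \<Longrightarrow> card J \<le> 3 \<Longrightarrow>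
    realised (sorted_list_of_set A) (\<lambda>\<phi>. \<Sum>j\<in>J. \<alpha> j * xi_on A (w j) \<phi>) \<Longrightarrow>
    i \<in> J \<Longrightarrow> crossing_on A (w i) \<Longrightarrow> class_weight A J w \<alpha> i \<noteq> 0 \<Longrightarrow> xi_word [0, 1, 0, 1] \<in> V 4"
proof (induction "card A" arbitrary: A J \<alpha> w i rule: less_induct)
  case less
  define L where "L = sorted_list_of_set A"
  have L: "set L = A" "sorted_wrt (<) L" "length L = card A" "distinct L"
    using less.prems(1) by (auto simp: L_def)
  obtain R where R: "R \<subseteq> J" "\<And>i j. i \<in> R \<Longrightarrow> j \<in> R \<Longrightarrow> same_kernel A (w i) (w j) \<Longrightarrow> i = j"
    "\<And>i. i \<in> J \<Longrightarrow> \<exists>r\<in>R. same_kernel A (w i) (w r)"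
    using kernel_representatives[OF less.prems(3)] by metis
  define \<beta> where "\<beta> = class_weight A J w \<alpha>"
  define J' where "J' = {r \<in> R. crossing_on A (w r) \<and> \<beta> r \<noteq> 0}"
  have "finite R" using finite_subset[OF R(1) less.prems(3)] .
  then have fin: "finite R" "finite J'" by (auto simp: J'_def)
  have "card J' \<le> card J" using R(1) less.prems(3) by (intro card_mono) (auto simp: J'_def)
  then have card_J': "card J' \<le> 3" using less.prems(4) by simp
  have realised: "realised L (\<lambda>\<phi>. \<Sum>r\<in>J'. \<beta> r * xi_on A (w r) \<phi>)"
  proof -
    have "realised L (\<lambda>\<phi>. (\<Sum>j\<in>J. \<alpha> j * xi_on A (w j) \<phi>) - (\<Sum>r\<in>R - J'. \<beta> r * xi_on A (w r) \<phi>))"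
    proof (rule realised_diff)
      show "realised L (\<lambda>\<phi>. \<Sum>j\<in>J. \<alpha> j * xi_on A (w j) \<phi>)" using less.prems(5) by (simp add: L_def)
      show "realised L (\<lambda>\<phi>. \<Sum>r\<in>R - J'. \<beta> r * xi_on A (w r) \<phi>)"
        using realised_noncrossing[OF L(2), of "R - J'" w \<beta>] fin by (auto simp: L(1) J'_def)
    qed
    then show ?thesis
    proof (rule realised_cong)
      fix \<phi>
      have sum_\<alpha>: "(\<Sum>j\<in>J. \<alpha> j * xi_on A (w j) \<phi>) = (\<Sum>r\<in>R. \<beta> r * xi_on A (w r) \<phi>)"
        unfolding \<beta>_def by (rule sum_xi_on_representatives[OF less.prems(3) R])
      show "(\<Sum>j\<in>J. \<alpha> j * xi_on A (w j) \<phi>) - (\<Sum>r\<in>R - J'. \<beta> r * xi_on A (w r) \<phi>) =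
          (\<Sum>r\<in>J'. \<beta> r * xi_on A (w r) \<phi>)"
        unfolding sum_\<alpha>
        using sum.subset_diff[of J' R "\<lambda>r. \<beta> r * xi_on A (w r) \<phi>"] fin by (simp add: J'_def)
    qed
  qed
  have "J' \<noteq> {}"
  proof -
    obtain r where r: "r \<in> R" "same_kernel A (w i) (w r)" using R(3)[OF less.prems(6)] by blast
    then have "crossing_on A (w r)" "\<beta> r \<noteq> 0"
      using less.prems(7,8) crossing_on_cong[OF r(2)] class_weight_cong[OF r(2), where J = J and \<alpha> = \<alpha>]
      by (simp_all add: \<beta>_def)
    with r show ?thesis by (auto simp: J'_def)
  qed
  show ?case
  proof (cases "card A = 4")
    case True
    then obtain a b c d where abcd: "L = [a, b, c, d]"
      using L(3) by (auto simp: numeral_eq_Suc length_Suc_conv)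
    have cr: "w j a = w j c \<and> w j b = w j d \<and> w j a \<noteq> w j b" if "j \<in> J'" for j
      using crossing_on_four[of a b c d "w j"] that L by (simp add: J'_def abcd)
    obtain r where r: "r \<in> J'" using \<open>J' \<noteq> {}\<close> by blast
    have "j = r" if "j \<in> J'" for j
    proof (rule R(2))
      show "same_kernel A (w j) (w r)"
        using cr[OF that] cr[OF r] L(1) unfolding same_kernel_def abcd by auto
    qed (use that r in \<open>auto simp: J'_def\<close>)
    then have "J' = {r}" using r by blast
    have "realised L (\<lambda>\<phi>. \<beta> r * xi_word [0, 1, 0, 1] (map \<phi> L))"
      using realised
    proof (rule realised_cong)
      fix \<phi>
      have "xi_on A (w r) \<phi> = xi_word (map (w r) L) (map \<phi> L)" using xi_on_list[of L] L(1) by simp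
      also have "map (w r) L = [w r a, w r b, w r a, w r b]" using cr[OF r] abcd by simp
      finally show "(\<Sum>r\<in>J'. \<beta> r * xi_on A (w r) \<phi>) = \<beta> r * xi_word [0, 1, 0, 1] (map \<phi> L)"
        using \<open>J' = {r}\<close> xi_word_alternating[of "w r a" "w r b"] cr[OF r] by simp
    qed
    then have "(\<lambda>u. \<beta> r * xi_word [0, 1, 0, 1] u) \<in> V 4"
      using realised_vector[of L] L(3,4) True by simp
    from scale[OF this, of "1 / \<beta> r"] show ?thesis using r by (simp add: J'_def)
  next
    case False
    then have card5: "5 \<le> card A" using less.prems(2) by simp
    \<comment> \<open>The index set \<open>J'\<close> is kept and only words and coefficients
      change, so the bound of three terms is inherited.\<close>
    have IH: "xi_word [0, 1, 0, 1] \<in> V 4"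
      if e: "e \<in> A" and "realised (sorted_list_of_set (A - {e})) (\<lambda>\<phi>. \<Sum>j\<in>J'. \<gamma> j * xi_on (A - {e}) (v j) \<phi>)"
        "j \<in> J'" "crossing_on (A - {e}) (v j)" "class_weight (A - {e}) J' v \<gamma> j \<noteq> 0" for e \<gamma> v j
    proof (rule less.hyps[of "A - {e}" J' \<gamma> v j])
      show "card (A - {e}) < card A" using e less.prems(1) by (intro card_Diff1_less)
      show "4 \<le> card (A - {e})" using e less.prems(1) card5 by simp
    qed (use that less.prems(1) fin card_J' in auto)
    show ?thesis
    proof (rule ccontr)
      assume no: "xi_word [0, 1, 0, 1] \<notin> V 4"
      \<comment> \<open>Without the basic crossing, the contrapositive of \<open>IH\<close> makes
        every crossing class vanish after each deletion and each fusion.\<close>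
      have "uncappable A J' w \<beta> N"
      proof
        show "2 \<le> N" "finite A" "5 \<le> card A" "finite J'" "card J' \<le> 3"
          using N2 less.prems(1) card5 fin card_J' by auto
      next
        fix e assume "e \<in> A"
        then show "\<exists>e1 e2. e1 \<noteq> e2 \<and> neighbours A e e1 \<and> neighbours A e e2"
          using two_neighbours_exist[OF L(2), of e] L card5 by simp
      next
        fix j assume "j \<in> J'"
        then show "crossing_on A (w j)" "\<beta> j \<noteq> 0" by (auto simp: J'_def)
      next
        fix i j assume "i \<in> J'" "j \<in> J'" "same_kernel A (w i) (w j)"
        then show "i = j" using R(2) by (auto simp: J'_def)
      next
        fix e j assume e: "e \<in> A" and j: "j \<in> J'" and cr: "crossing_on (A - {e}) (w j)"
        obtain xs ys where L': "L = xs @ e # ys" using e L(1) by (meson split_list)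
        have d: "e \<notin> set (xs @ ys)" using L(4) L' by auto
        then have "sorted_list_of_set (A - {e}) = xs @ ys"
          using less.prems(1) L' by (simp add: sorted_list_of_set_remove L_def[symmetric] remove1_append)
        moreover have "realised (xs @ ys) (\<lambda>\<phi>. \<Sum>a<N. \<Sum>j\<in>J'. \<beta> j * xi_on A (w j) (\<phi>(e := a)))"
          using realised_delete[OF realised[unfolded L'] d] .
        then have "realised (xs @ ys)
            (\<lambda>\<phi>. \<Sum>j\<in>J'. (\<beta> j * delete_weight N A e (w j)) * xi_on (A - {e}) (w j) \<phi>)"
        proof (rule realised_cong)
          fix \<phi> :: "nat \<Rightarrow> nat" assume \<phi>: "\<And>x. \<phi> x < N"
          have "(\<Sum>a<N. \<Sum>j\<in>J'. \<beta> j * xi_on A (w j) (\<phi>(e := a))) =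
              (\<Sum>j\<in>J'. \<beta> j * (\<Sum>a<N. xi_on A (w j) (\<phi>(e := a))))"
            by (subst sum.swap) (simp add: sum_distrib_left)
          then show "(\<Sum>a<N. \<Sum>j\<in>J'. \<beta> j * xi_on A (w j) (\<phi>(e := a))) =
              (\<Sum>j\<in>J'. (\<beta> j * delete_weight N A e (w j)) * xi_on (A - {e}) (w j) \<phi>)"
            using xi_on_delete[OF e \<phi>] by (simp add: mult.assoc)
        qed
        ultimately show "(\<Sum>i | i \<in> J' \<and> same_kernel (A - {e}) (w j) (w i). \<beta> i * delete_weight N A e (w i)) = 0"
          using IH[OF e, of "\<lambda>j. \<beta> j * delete_weight N A e (w j)" w j] j cr no by auto
      next
        fix e e' j assume nb: "neighbours A e e'" and j: "j \<in> J'"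
          and cr: "crossing_on (A - {e}) (fuse e e' (w j))"
        have e: "e \<in> A" "e' \<in> A" "e \<noteq> e'" using nb by (auto simp: neighbours_def)
        obtain M xs ys where L': "L = xs @ ys" "ys @ xs = e # e' # M \<or> ys @ xs = e' # e # M"
          using sorted_neighbours[OF L(2)] nb L(1) by metis
        have "removeAll e L = sorted_list_of_set (A - {e})"
          using less.prems(1) L(4) by (simp add: sorted_list_of_set_remove L_def[symmetric] distinct_remove1_removeAll)
        then have "realised (sorted_list_of_set (A - {e}))
            (\<lambda>\<phi>. \<Sum>j\<in>J'. \<beta> j * xi_on A (w j) (\<phi>(e := \<phi> e')))"
          using realised_fuse[OF realised[unfolded L'(1)] L'(2)] L(4) L'(1) by simp
        then have "realised (sorted_list_of_set (A - {e}))
            (\<lambda>\<phi>. \<Sum>j\<in>J'. \<beta> j * xi_on (A - {e}) (fuse e e' (w j)) \<phi>)"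
          by (simp only: xi_on_fuse[OF e])
        then show "(\<Sum>i | i \<in> J' \<and> same_kernel (A - {e}) (fuse e e' (w j)) (fuse e e' (w i)). \<beta> i) = 0"
          using IH[OF e(1), of \<beta> "\<lambda>j. fuse e e' (w j)" j] j cr no by auto
      qed
      then have "J' = {}" by (rule uncappable.J_empty)
      with \<open>J' \<noteq> {}\<close> show False by contradiction
    qed
  qed
qed

section \<open>The theorem for set partitions, via words\<close>

lemma partitions_Inr_image:
  assumes "p \<in> partitions k" shows "(`) Inr ` p \<in> partitions2 0 k"
proof -
  have p: "partition_on {1..k} p" using assms by (simp add: partitions_def)
  have "partition_on (points 0 k) ((`) Inr ` p)"
  proof (rule partition_onI)
    show "\<Union> ((`) Inr ` p) = points 0 k"
      using partition_onD1[OF p] by (auto simp: points_def image_iff)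
    show "disjnt q q'" if "q \<in> (`) Inr ` p" "q' \<in> (`) Inr ` p" "q \<noteq> q'" for q q'
      using that partition_onD2[OF p] by (auto simp: disjnt_def disjoint_def)
    show "{} \<notin> (`) Inr ` p" using partition_onD3[OF p] by auto
  qed
  then show ?thesis by (simp add: partitions2_def)
qed

lemma xi_eq_fmat:
  assumes "0 < N" "p \<in> partitions k"
  obtains w where "length w = k" "xi N k p = fmat N 0 k (\<lambda>u v. xi_word w u)"
proof -
  from partitions_Inr_image[OF assms(2)] obtain w where w: "represents 0 k ((`) Inr ` p) w"
    by (rule represents_exists)
  have "xi N k p = fmat N 0 k (\<lambda>u v. xi_word w (u @ rev v))"
    unfolding xi_eq_T_mat by (rule T_mat_eq_fmat[OF partitions_Inr_image[OF assms(2)] w])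
  also have "\<dots> = fmat N 0 k (\<lambda>u v. xi_word w u)"
    by (rule fmat_cong) (use assms in auto)
  finally have "xi N k p = fmat N 0 k (\<lambda>u v. xi_word w u)" .
  moreover have "length w = k" using w by (simp add: represents_def)
  ultimately show thesis using that by blast
qed

lemma span_words_mono: "f \<in> span_words N K n \<Longrightarrow> K \<subseteq> K' \<Longrightarrow> f \<in> span_words N K' n"
  by (induction rule: span_words.induct) (auto intro: span_words.intros)

lemma bent_mono: "(\<And>n. V n \<subseteq> V' n) \<Longrightarrow> bent N V k l \<subseteq> bent N V' k l"
  unfolding bent_def by blast

lemma planar_noncrossing_span_words:
  assumes "0 < N" shows "planar_noncrossing N (span_words N noncrossing_words)"
proof -
  interpret planar_star N "span_words N noncrossing_words"
    by (rule word_class.planar_star_span_words[OF word_class_noncrossing assms])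
  show ?thesis by unfold_locales (rule span_words.gen)
qed

lemma fmat_vector_in_bent:
  assumes "0 < N" "f \<in> V n" shows "fmat N 0 n (\<lambda>u v. f u) \<in> bent N V 0 n"
  by (rule bentI[of f]) (use assms in \<open>auto intro: fmat_cong\<close>)

theorem theoremA:
  fixes N k :: nat and p\<^sub>1 p\<^sub>2 p\<^sub>3 :: "nat set set" and \<alpha>\<^sub>1 \<alpha>\<^sub>2 \<alpha>\<^sub>3 :: complex and \<xi> :: "complex mat"
  assumes "N \<ge> 1" and "k \<ge> 1"
    and "p\<^sub>1 \<in> partitions k" and "p\<^sub>2 \<in> partitions k" and "p\<^sub>3 \<in> partitions k"
    and "\<xi> = \<alpha>\<^sub>1 \<cdot>\<^sub>m xi N k p\<^sub>1 + \<alpha>\<^sub>2 \<cdot>\<^sub>m xi N k p\<^sub>2 + \<alpha>\<^sub>3 \<cdot>\<^sub>m xi N k p\<^sub>3"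
    and "\<xi> \<noteq> 0\<^sub>m (N ^ k) 1"
  shows "NC_gen N k \<xi> = P_dual N \<or> NC_gen N k \<xi> = NC_dual N"
proof -
  have N: "0 < N" using assms(1) by simp
  obtain w\<^sub>1 where w1: "length w\<^sub>1 = k" "xi N k p\<^sub>1 = fmat N 0 k (\<lambda>u v. xi_word w\<^sub>1 u)"
    using xi_eq_fmat[OF N assms(3)] .
  obtain w\<^sub>2 where w2: "length w\<^sub>2 = k" "xi N k p\<^sub>2 = fmat N 0 k (\<lambda>u v. xi_word w\<^sub>2 u)"
    using xi_eq_fmat[OF N assms(4)] .
  obtain w\<^sub>3 where w3: "length w\<^sub>3 = k" "xi N k p\<^sub>3 = fmat N 0 k (\<lambda>u v. xi_word w\<^sub>3 u)"
    using xi_eq_fmat[OF N assms(5)] .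
  define J where "J = {1, 2, 3 :: nat}"
  define W where "W j = (if j = 1 then w\<^sub>1 else if j = 2 then w\<^sub>2 else w\<^sub>3)" for j :: nat
  define \<alpha> where "\<alpha> j = (if j = 1 then \<alpha>\<^sub>1 else if j = 2 then \<alpha>\<^sub>2 else \<alpha>\<^sub>3)" for j :: nat
  define F where "F u = (\<Sum>j\<in>J. \<alpha> j * xi_word (W j) u)" for u
  define A where "A = {..<k}"
  define L where "L = sorted_list_of_set A"
  have L: "L = [0..<k]" "set L = A" "length L = k" "distinct L" "sorted_wrt (<) L"
    by (auto simp: L_def A_def lessThan_atLeast0)
  define w where "w j = (!) (W j)" for j
  have J: "finite J" "card J \<le> 3" by (simp_all add: J_def)
  have \<xi>: "\<xi> = fmat N 0 k (\<lambda>u v. F u)"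
    unfolding assms(6) w1 w2 w3 fmat_smult fmat_add
    by (rule fmat_cong[OF N]) (simp add: F_def J_def W_def \<alpha>_def)
  have map_W: "map (w j) L = W j" for j
    using w1 w2 w3 map_nth[of "W j"] by (auto simp: L(1) W_def w_def)
  have F: "F (map \<phi> L) = (\<Sum>j\<in>J. \<alpha> j * xi_on A (w j) \<phi>)" for \<phi>
    unfolding F_def L(2)[symmetric] xi_on_list map_W ..
  have \<xi>_carrier: "\<xi> \<in> carrier_mat (N ^ k) 1" unfolding \<xi> using fmat_carrier(1)[of N 0 k] by simp
  interpret C: tk_dual N "NC_gen N k \<xi>"
    using NC_gen_tannaka_krein_dual[OF \<xi>_carrier] N by (simp add: tk_dual_def tk_dual_axioms_def)
  have nc: "planar_noncrossing N C.vectors"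
  proof -
    interpret planar N C.vectors by (rule C.planar_vectors)
    show ?thesis
    proof
      fix w n assume "w \<in> noncrossing_words" "length w = n"
      then have "fmat N 0 n (\<lambda>u v. xi_word w u) \<in> NC_dual N 0 n"
        unfolding NC_dual_eq_bent[OF N] by (intro fmat_vector_in_bent[OF N] span_words.gen)
      then show "xi_word w \<in> C.vectors n"
        unfolding C.vectors_def using subsetD[OF NC_gen_contains(1)] by blast
    qed
  qed
  interpret C: planar_noncrossing N C.vectors by (rule nc)
  show ?thesis
  proof (cases "\<exists>i\<in>J. crossing_on A (w i) \<and> class_weight A J w \<alpha> i \<noteq> 0")
    case True
    then obtain i where i: "i \<in> J" "crossing_on A (w i)" "class_weight A J w \<alpha> i \<noteq> 0" by blast
    have cross: "xi_word [0, 1, 0, 1] \<in> C.vectors 4"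
    proof (cases "N = 1")
      case True
      \<comment> \<open>For \<open>N = 1\<close> there is only one index word of length four, so the
        crossing vector equals that of the one-block partition, which is non-crossing.\<close>
      have "xi_word (replicate 4 0) \<in> C.vectors 4"
        by (rule C.noncrossing[OF C.constant_word_noncrossing]) simp
      then show ?thesis
      proof (rule C.cong)
        fix u assume "u \<in> words N 4"
        then have u: "u = replicate 4 0" using True by (auto simp: words_def intro!: replicate_eqI)
        have "xi_word w u = 1" if "length w = 4" for w
        proof -
          have "u = map (\<lambda>_. 0) w" using that by (simp add: u map_replicate_const)
          then show ?thesis by (auto simp: xi_word_def)
        qed
        then show "xi_word (replicate 4 0) u = xi_word [0, 1, 0, 1] u" by simp
      qed
    next
      case False
      from i(2) obtain a c b d where q: "a \<in> A" "c \<in> A" "b \<in> A" "d \<in> A" "chords_cross a c b d"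
        by (rule crossing_onE)
      \<comment> \<open>The four endpoints of a crossing are distinct, so there are enough points to
        start the descent.\<close>
      then have "card {a, c, b, d} \<le> card A" by (intro card_mono) (auto simp: A_def)
      then have "4 \<le> card A" using chords_cross_distinct[OF q(5)] by simp
      moreover have "F \<in> C.vectors k"
        unfolding C.vectors_def mem_Collect_eq \<xi>[symmetric] by (rule NC_gen_contains(2))
      then have "C.realised L (\<lambda>\<phi>. \<Sum>j\<in>J. \<alpha> j * xi_on A (w j) \<phi>)"
        unfolding C.realised_def F[symmetric] L(3) by blast
      ultimately show ?thesis
        using C.crossing_vector_descent[of A J \<alpha> w i] False N i J by (simp add: L_def A_def)
    qed
    have "P_dual N k' l \<subseteq> NC_gen N k \<xi> k' l" for k' l
    proof -
      have "bent N (span_words N UNIV) k' l \<subseteq> bent N C.vectors k' l"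
        by (rule bent_mono) (use C.span_words_UNIV_subset[OF cross] in blast)
      then show ?thesis using C.bent_vectors_subset by (auto simp: P_dual_eq_bent[OF N])
    qed
    moreover have "NC_gen N k \<xi> k' l \<subseteq> P_dual N k' l" for k' l
    proof (rule NC_gen_least)
      show "tannaka_krein_dual N (P_dual N)"
        unfolding P_dual_eq_bent[OF N]
        by (rule planar_star.tannaka_krein_dual_bent[OF
              word_class.planar_star_span_words[OF word_class_UNIV N]])
      show "NC_dual N k' l \<subseteq> P_dual N k' l" for k' l
        unfolding P_dual_eq_bent[OF N] NC_dual_eq_bent[OF N]
        by (rule bent_mono) (auto intro: span_words_mono)
      interpret P: planar_star N "span_words N UNIV"
        by (rule word_class.planar_star_span_words[OF word_class_UNIV N])
      have "W j \<in> UNIV" "length (W j) = k" for j using w1 w2 w3 by (auto simp: W_def)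
      then have "F \<in> span_words N UNIV k"
        unfolding F_def[abs_def] J_def
        by (simp add: numeral_eq_Suc) (intro span_words.add span_words.scale span_words.gen; simp)
      then show "\<xi> \<in> P_dual N 0 k"
        unfolding P_dual_eq_bent[OF N] \<xi> by (rule fmat_vector_in_bent[OF N])
    qed
    ultimately have "NC_gen N k \<xi> = P_dual N" by (intro ext subset_antisym)
    then show ?thesis ..
  next
    case False
    interpret S: planar_noncrossing N "span_words N noncrossing_words"
      by (rule planar_noncrossing_span_words[OF N])
    obtain R where R: "R \<subseteq> J" "\<And>i j. i \<in> R \<Longrightarrow> j \<in> R \<Longrightarrow> same_kernel A (w i) (w j) \<Longrightarrow> i = j"
      "\<And>i. i \<in> J \<Longrightarrow> \<exists>r\<in>R. same_kernel A (w i) (w r)"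
      using kernel_representatives[OF J(1)] by metis
    \<comment> \<open>Once equal partitions are collected, every crossing class has weight zero, so
      only non-crossing vectors remain.\<close>
    have "S.realised L (\<lambda>\<phi>. \<Sum>r\<in>R. class_weight A J w \<alpha> r * xi_on (set L) (w r) \<phi>)"
      using R(1) False J finite_subset L(2) by (intro S.realised_noncrossing[OF L(5)]) blast+
    moreover have "F (map \<phi> L) = (\<Sum>r\<in>R. class_weight A J w \<alpha> r * xi_on (set L) (w r) \<phi>)" for \<phi>
      unfolding F L(2) by (rule sum_xi_on_representatives[OF J(1) R])
    ultimately have "S.realised L (\<lambda>\<phi>. F (map \<phi> L))" by simp
    then have "F \<in> span_words N noncrossing_words k"
      using S.realised_vector[of L F] L by simp
    then have \<xi>_NC: "\<xi> \<in> NC_dual N 0 k"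
      unfolding NC_dual_eq_bent[OF N] \<xi> by (rule fmat_vector_in_bent[OF N])
    have "NC_gen N k \<xi> k' l \<subseteq> NC_dual N k' l" for k' l
    proof (rule NC_gen_least)
      show "tannaka_krein_dual N (NC_dual N)"
        unfolding NC_dual_eq_bent[OF N]
        by (rule planar_star.tannaka_krein_dual_bent[OF
              word_class.planar_star_span_words[OF word_class_noncrossing N]])
      show "\<xi> \<in> NC_dual N 0 k" by (rule \<xi>_NC)
    qed simp
    then have "NC_gen N k \<xi> = NC_dual N" using NC_gen_contains(1) by (intro ext subset_antisym)
    then show ?thesis ..
  qed
qed

end
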